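(* The 2-convexified Tsirelson space $T^{(2)}$ admits a continuum of renormings (i.e. a family, of cardinality $\mathfrak{c}$, of equivalent norms) none of whose isometry groups is contained in any maximal bounded subgroup of the isomorphism group $\mathrm{GL}(T^{(2)})$. Moreover, these isometry groups are pairwise non-conjugate in $\mathrm{GL}(T^{(2)})$.
   Context: Tsirelson's space $T$ is the completion of $c_{00}$ under the unique norm satisfying $\|x\|_T=\max\{\|x\|_\infty,\ \tfrac12\sup\sum_{j=1}^n\|E_jx\|_T\}$, the supremum being over all $n\ge1$ and finite sets $E_1<\dots<E_n$ of positive integers with $n\le\min E_1$ ($E_jx$ is the restriction of $x$ to $E_j$). $T^{(2)}$ is its 2-convexification: the completion of $c_{00}$ under $\|\sum a_ie_i\|_{T^{(2)}}=\|\sum|a_i|^2e_i\|_T^{1/2}$. The isometry group of an equivalent norm is the group of its surjective linear isometries. $\mathrm{GL}(X)$ is the group of all isomorphisms of $X$ onto $X$; a subgroup $G$ is bounded if $\sup_{g\in G}\|g\|<\infty$, and a maximal bounded subgroup is a bounded subgroup not properly contained in any other bounded subgroup. Subgroups $G_1,G_2$ of $\mathrm{GL}(X)$ are conjugate if $G_1=S^{-1}G_2S$ for some $S\in\mathrm{GL}(X)$. *)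

theory Defs
  imports "HOL-Analysis.Analysis" "HOL-Algebra.Group" "HOL-Library.Equipollence"
begin

text \<open>The completion of a normed space as the space of its Cauchy sequences modulo null sequences;
  \<open>norm_to_completion\<close>, \<open>closure_range_to_completion\<close> and the \<open>banach\<close> instance below state that it is
  a complete space containing the original one isometrically and densely.\<close>

definition null_diff :: "(nat \<Rightarrow> 'a::real_normed_vector) \<Rightarrow> (nat \<Rightarrow> 'a) \<Rightarrow> bool" where
  "null_diff X Y \<longleftrightarrow> Cauchy X \<and> Cauchy Y \<and> (\<lambda>n. X n - Y n) \<longlonglongrightarrow> 0"

lemma part_equivp_null_diff: "part_equivp (null_diff :: (nat \<Rightarrow> 'a::real_normed_vector) \<Rightarrow> _)"
proof (rule part_equivpI)
  have "Cauchy (\<lambda>n. 0::'a)" by (simp add: convergent_Cauchy convergent_const)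
  then show "\<exists>X::nat \<Rightarrow> 'a. null_diff X X" by (auto simp: null_diff_def)
  show "symp (null_diff :: (nat \<Rightarrow> 'a) \<Rightarrow> _)"
  proof (rule sympI)
    fix X Y :: "nat \<Rightarrow> 'a" assume "null_diff X Y"
    then show "null_diff Y X"
      using tendsto_minus[of "\<lambda>n. X n - Y n" 0 sequentially] by (auto simp: null_diff_def)
  qed
  show "transp (null_diff :: (nat \<Rightarrow> 'a) \<Rightarrow> _)"
  proof (rule transpI)
    fix X Y Z :: "nat \<Rightarrow> 'a" assume "null_diff X Y" "null_diff Y Z"
    then show "null_diff X Z"
      using tendsto_add[of "\<lambda>n. X n - Y n" 0 sequentially "\<lambda>n. Y n - Z n" 0]
      by (auto simp: null_diff_def)
  qed
qed

quotient_type (overloaded) 'a banach_completion = "nat \<Rightarrow> 'a::real_normed_vector" / partial: null_diff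
  by (rule part_equivp_null_diff)

lemma null_diff_refl: "null_diff X X \<longleftrightarrow> Cauchy X"
  by (simp add: null_diff_def)

lemma Cauchy_add_nv: "Cauchy X \<Longrightarrow> Cauchy Y \<Longrightarrow> Cauchy (\<lambda>n. X n + Y n :: 'a::real_normed_vector)"
  unfolding Cauchy_iff
proof (intro allI impI)
  fix e :: real
  assume *: "\<forall>e>0. \<exists>M. \<forall>m\<ge>M. \<forall>n\<ge>M. norm (X m - X n) < e"
    "\<forall>e>0. \<exists>M. \<forall>m\<ge>M. \<forall>n\<ge>M. norm (Y m - Y n) < e" and "e > 0"
  then obtain M1 M2 where M: "\<forall>m\<ge>M1. \<forall>n\<ge>M1. norm (X m - X n) < e/2"
    "\<forall>m\<ge>M2. \<forall>n\<ge>M2. norm (Y m - Y n) < e/2" by (meson half_gt_zero)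
  have "norm (X m + Y m - (X n + Y n)) < e" if "m \<ge> max M1 M2" "n \<ge> max M1 M2" for m n
  proof -
    have "norm (X m + Y m - (X n + Y n)) \<le> norm (X m - X n) + norm (Y m - Y n)"
      using norm_triangle_ineq[of "X m - X n" "Y m - Y n"] by (simp add: algebra_simps)
    also have "\<dots> < e/2 + e/2" using M that by (intro add_strict_mono) auto
    finally show ?thesis by simp
  qed
  then show "\<exists>M. \<forall>m\<ge>M. \<forall>n\<ge>M. norm (X m + Y m - (X n + Y n)) < e" by blast
qed

lemma Cauchy_scaleR_nv: "Cauchy X \<Longrightarrow> Cauchy (\<lambda>n. c *\<^sub>R X n :: 'a::real_normed_vector)"
  using bounded_linear.Cauchy[OF bounded_linear_scaleR_right] by blast

lemma Cauchy_norm_nv: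
  assumes "Cauchy X" shows "convergent (\<lambda>n. norm (X n :: 'a::real_normed_vector))"
  unfolding Cauchy_convergent_iff[symmetric] Cauchy_iff
proof (intro allI impI)
  fix e :: real assume "e > 0"
  then obtain M where M: "\<forall>m\<ge>M. \<forall>n\<ge>M. norm (X m - X n) < e"
    using assms unfolding Cauchy_iff by blast
  have "norm (norm (X m) - norm (X n)) < e" if "m \<ge> M" "n \<ge> M" for m n
    using norm_triangle_ineq3[of "X m" "X n"] M that by (simp add: order.strict_trans1)
  then show "\<exists>M. \<forall>m\<ge>M. \<forall>n\<ge>M. norm (norm (X m) - norm (X n)) < e" by blast
qed

instantiation banach_completion :: (real_normed_vector) real_normed_vector
begin

lift_definition zero_banach_completion :: "'a banach_completion" is "\<lambda>_. 0"
  by (simp add: null_diff_refl convergent_Cauchy convergent_const)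

lift_definition plus_banach_completion ::
  "'a banach_completion \<Rightarrow> 'a banach_completion \<Rightarrow> 'a banach_completion" is "\<lambda>X Y n. X n + Y n"
  subgoal for X X' Y Y'
    using tendsto_add[of "\<lambda>n. X n - X' n" 0 sequentially "\<lambda>n. Y n - Y' n" 0]
    by (auto simp: null_diff_def Cauchy_add_nv add_diff_add)
  done

lift_definition scaleR_banach_completion ::
  "real \<Rightarrow> 'a banach_completion \<Rightarrow> 'a banach_completion" is "\<lambda>c X n. c *\<^sub>R X n"
  subgoal for c X Y
    using tendsto_scaleR[of "\<lambda>_. c" c sequentially "\<lambda>n. X n - Y n" 0]
    by (auto simp: null_diff_def Cauchy_scaleR_nv scaleR_diff_right)
  done

lift_definition norm_banach_completion :: "'a banach_completion \<Rightarrow> real" is "\<lambda>X. lim (\<lambda>n. norm (X n))"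
proof -
  fix X Y :: "nat \<Rightarrow> 'a" assume *: "null_diff X Y"
  then obtain l where l: "(\<lambda>n. norm (X n)) \<longlonglongrightarrow> l"
    using Cauchy_norm_nv by (auto simp: null_diff_def convergent_def)
  have "(\<lambda>n. norm (X n - Y n)) \<longlonglongrightarrow> 0"
    using * tendsto_norm_zero by (auto simp: null_diff_def)
  then have "(\<lambda>n. norm (Y n) - norm (X n)) \<longlonglongrightarrow> 0"
    by (rule tendsto_rabs_zero_cancel[OF tendsto_sandwich[OF _ _ tendsto_const], rotated 2])
       (auto simp: norm_triangle_ineq3 norm_minus_commute[of "X _" "Y _"] intro!: always_eventually)
  from tendsto_add[OF this l] have "(\<lambda>n. norm (Y n)) \<longlonglongrightarrow> l" by simp
  with l show "lim (\<lambda>n. norm (X n)) = lim (\<lambda>n. norm (Y n))" by (metis limI)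
qed

definition uminus_banach_completion :: "'a banach_completion \<Rightarrow> 'a banach_completion" where
  "- x = (-1) *\<^sub>R x" for x :: "'a banach_completion"
definition minus_banach_completion ::
  "'a banach_completion \<Rightarrow> 'a banach_completion \<Rightarrow> 'a banach_completion" where
  "x - y = x + (- y)" for x y :: "'a banach_completion"
definition dist_banach_completion :: "'a banach_completion \<Rightarrow> 'a banach_completion \<Rightarrow> real" where
  "dist x y = norm (x - y)" for x y :: "'a banach_completion"
definition sgn_banach_completion :: "'a banach_completion \<Rightarrow> 'a banach_completion" where
  "sgn x = inverse (norm x) *\<^sub>R x" for x :: "'a banach_completion"
definition uniformity_banach_completion :: "('a banach_completion \<times> 'a banach_completion) filter" where
  "uniformity_banach_completion = (INF e\<in>{0<..}. principal {(x, y). dist x y < e})"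
definition open_banach_completion :: "'a banach_completion set \<Rightarrow> bool" where
  "open_banach_completion U \<longleftrightarrow> (\<forall>x\<in>U. eventually (\<lambda>(x', y). x' = x \<longrightarrow> y \<in> U) uniformity)"

lemma null_diff_eqI: "Cauchy X \<Longrightarrow> (\<And>n. X n = Y n) \<Longrightarrow> null_diff X Y"
  by (subgoal_tac "X = Y") (auto simp: null_diff_refl)

lemma norm_lim_nv: "Cauchy X \<Longrightarrow> (\<lambda>n. norm (X n :: 'a)) \<longlonglongrightarrow> lim (\<lambda>n. norm (X n))"
  using Cauchy_norm_nv by (simp add: convergent_LIMSEQ_iff)

instance
proof
  fix x y z :: "'a banach_completion" and a b :: real
  show "x + y + z = x + (y + z)"
    by transfer (intro null_diff_eqI, auto simp: null_diff_refl Cauchy_add_nv algebra_simps)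
  show "x + y = y + x"
    by transfer (intro null_diff_eqI, auto simp: null_diff_refl Cauchy_add_nv algebra_simps)
  show "0 + x = x"
    by transfer (intro null_diff_eqI, auto simp: null_diff_refl)
  show "- x + x = 0"
    unfolding uminus_banach_completion_def
    by transfer (intro null_diff_eqI, auto simp: null_diff_refl Cauchy_add_nv Cauchy_scaleR_nv
       convergent_Cauchy convergent_const)
  show "x - y = x + - y" by (simp add: minus_banach_completion_def)
  show "a *\<^sub>R (x + y) = a *\<^sub>R x + a *\<^sub>R y"
    by transfer (intro null_diff_eqI, auto simp: null_diff_refl Cauchy_add_nv Cauchy_scaleR_nv scaleR_add_right)
  show "(a + b) *\<^sub>R x = a *\<^sub>R x + b *\<^sub>R x"
    by transfer (intro null_diff_eqI, auto simp: null_diff_refl Cauchy_add_nv Cauchy_scaleR_nv scaleR_add_left)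
  show "a *\<^sub>R b *\<^sub>R x = (a * b) *\<^sub>R x"
    by transfer (intro null_diff_eqI, auto simp: null_diff_refl Cauchy_scaleR_nv)
  show "1 *\<^sub>R x = x"
    by transfer (intro null_diff_eqI, auto simp: null_diff_refl)
  show "dist x y = norm (x - y)" by (simp add: dist_banach_completion_def)
  show "sgn x = inverse (norm x) *\<^sub>R x" by (simp add: sgn_banach_completion_def)
  show "uniformity = (INF e\<in>{0<..}. principal {(x, y :: 'a banach_completion). dist x y < e})"
    by (simp add: uniformity_banach_completion_def)
  show "open U = (\<forall>x\<in>U. \<forall>\<^sub>F (x', y) in uniformity. x' = x \<longrightarrow> y \<in> U)" for U :: "'a banach_completion set"
    by (simp add: open_banach_completion_def)
  show "norm x = 0 \<longleftrightarrow> x = 0"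
  proof (transfer, unfold null_diff_refl)
    fix X :: "nat \<Rightarrow> 'a" assume "Cauchy X"
    then have "lim (\<lambda>n. norm (X n)) = 0 \<longleftrightarrow> (\<lambda>n. norm (X n)) \<longlonglongrightarrow> 0"
      using norm_lim_nv[of X] by (metis limI)
    also have "\<dots> \<longleftrightarrow> null_diff X (\<lambda>_. 0)"
      using \<open>Cauchy X\<close> by (simp add: null_diff_def tendsto_norm_zero_iff convergent_Cauchy convergent_const)
    finally show "lim (\<lambda>n. norm (X n)) = 0 \<longleftrightarrow> null_diff X (\<lambda>_. 0)" .
  qed
  show "norm (x + y) \<le> norm x + norm y"
  proof (transfer, unfold null_diff_refl)
    fix X Y :: "nat \<Rightarrow> 'a" assume "Cauchy X" "Cauchy Y"
    then show "lim (\<lambda>n. norm (X n + Y n)) \<le> lim (\<lambda>n. norm (X n)) + lim (\<lambda>n. norm (Y n))"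
      by (intro LIMSEQ_le[OF norm_lim_nv tendsto_add[OF norm_lim_nv norm_lim_nv]])
         (auto simp: Cauchy_add_nv norm_triangle_ineq)
  qed
  show "norm (a *\<^sub>R x) = \<bar>a\<bar> * norm x"
  proof (transfer, unfold null_diff_refl)
    fix a and X :: "nat \<Rightarrow> 'a" assume "Cauchy X"
    then show "lim (\<lambda>n. norm (a *\<^sub>R X n)) = \<bar>a\<bar> * lim (\<lambda>n. norm (X n))"
      by (simp, intro limI tendsto_mult_left norm_lim_nv)
  qed
qed

end

lift_definition to_completion :: "'a::real_normed_vector \<Rightarrow> 'a banach_completion" is "\<lambda>x _. x"
  by (simp add: null_diff_refl convergent_Cauchy convergent_const)

lemma norm_to_completion: "norm (to_completion x) = norm x"
  by transfer simp

lemma linear_to_completion: "linear to_completion"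
  by (rule linearI; transfer; simp add: null_diff_refl convergent_Cauchy convergent_const)

lemma to_completion_diff: "to_completion x - to_completion y = to_completion (x - y)"
  using linear_diff[OF linear_to_completion] by metis

lemma norm_completion_le:
  assumes "null_diff X X" and "\<forall>\<^sub>F n in sequentially. norm (X n) \<le> r"
  shows "norm (abs_banach_completion X) \<le> r"
proof -
  have "lim (\<lambda>n. norm (X n)) \<le> r"
    using assms tendsto_upperbound[OF norm_lim_nv] by (auto simp: null_diff_refl)
  then show ?thesis using assms(1) by (simp add: norm_banach_completion.abs_eq)
qed

lemma to_completion_tendsto:
  assumes X: "Cauchy X"
  shows "(\<lambda>n. to_completion (X n)) \<longlonglongrightarrow> abs_banach_completion X"
proof (rule metric_LIMSEQ_I)
  fix e :: real assume "e > 0"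
  then obtain M where M: "\<forall>m\<ge>M. \<forall>n\<ge>M. norm (X m - X n) < e/2"
    using X unfolding Cauchy_iff by (meson half_gt_zero)
  have "dist (to_completion (X m)) (abs_banach_completion X) < e" if "m \<ge> M" for m
  proof -
    have C: "Cauchy (\<lambda>n. X n + (-1) *\<^sub>R X m)"
      using X by (intro Cauchy_add_nv) (auto simp: convergent_Cauchy convergent_const)
    have "abs_banach_completion X - to_completion (X m)
        = abs_banach_completion (\<lambda>n. X n + (-1) *\<^sub>R X m)"
      using X unfolding minus_banach_completion_def uminus_banach_completion_def to_completion_def
      by (simp del: scaleR_minus1_left scaleR_minus_left
          add: plus_banach_completion.abs_eq Cauchy_scaleR_nv scaleR_banach_completion.abs_eq null_diff_refl
          convergent_Cauchy convergent_const)
    moreover have "norm (abs_banach_completion (\<lambda>n. X n + (-1) *\<^sub>R X m)) \<le> e/2"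
      using C M that
      by (intro norm_completion_le) (auto simp: null_diff_refl eventually_sequentially intro!: exI[of _ M] less_imp_le)
    ultimately have "dist (abs_banach_completion X) (to_completion (X m)) \<le> e/2"
      unfolding dist_norm by (simp only:)
    then show ?thesis using \<open>e > 0\<close> unfolding dist_commute[of "to_completion (X m)"] by linarith
  qed
  then show "\<exists>M. \<forall>m\<ge>M. dist (to_completion (X m)) (abs_banach_completion X) < e" by blast
qed

lemma completion_rep: obtains X where "Cauchy X" "x = abs_banach_completion X"
  using Quotient3_abs_rep[OF Quotient3_banach_completion, of x]
    Quotient3_rep_reflp[OF Quotient3_banach_completion, of x] null_diff_refl by metis

lemma closure_range_to_completion: "closure (range to_completion) = UNIV"
proof -
  have "x \<in> closure (range to_completion)" for x :: "'a banach_completion"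
  proof -
    obtain X where "Cauchy X" "x = abs_banach_completion X" using completion_rep .
    then show ?thesis using to_completion_tendsto[of X]
      unfolding closure_sequential by (intro exI[of _ "\<lambda>n. to_completion (X n)"]) auto
  qed
  then show ?thesis by blast
qed

instance banach_completion :: (real_normed_vector) banach
proof
  fix X :: "nat \<Rightarrow> 'a banach_completion" assume X: "Cauchy X"
  have "\<exists>y. dist (to_completion y) (X n) < inverse (real (Suc n))" for n
  proof -
    have "X n \<in> closure (range to_completion)" by (simp add: closure_range_to_completion)
    moreover have "0 < inverse (real (Suc n))" by simp
    ultimately show ?thesis unfolding closure_approachable by blast
  qed
  then obtain y where y: "\<And>n. dist (to_completion (y n)) (X n) < inverse (real (Suc n))" by metis
  have lim0: "(\<lambda>n. to_completion (y n) - X n) \<longlonglongrightarrow> 0"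
    by (rule Lim_null_comparison[OF _ LIMSEQ_inverse_real_of_nat])
       (use y in \<open>auto intro!: always_eventually less_imp_le simp flip: dist_norm\<close>)
  have "Cauchy (\<lambda>n. X n + (to_completion (y n) - X n))"
    by (rule Cauchy_add_nv[OF X LIMSEQ_imp_Cauchy[OF lim0]])
  then have "Cauchy (\<lambda>n. to_completion (y n))" by simp
  then have "Cauchy y"
    unfolding Cauchy_iff by (simp add: to_completion_diff norm_to_completion)
  from tendsto_diff[OF to_completion_tendsto[OF this] lim0]
  show "convergent X" by (auto simp: convergent_def)
qed

definition is_norm :: "('a::real_vector \<Rightarrow> real) \<Rightarrow> bool" where
  "is_norm N \<longleftrightarrow>
     (\<forall>x. 0 \<le> N x) \<and> (\<forall>x. N x = 0 \<longleftrightarrow> x = 0) \<and>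
     (\<forall>x y. N (x + y) \<le> N x + N y) \<and> (\<forall>a x. N (a *\<^sub>R x) = \<bar>a\<bar> * N x)"

text \<open>Finitely supported real sequences indexed by the positive integers: index 0 is kept
  empty, so that coordinates are numbered as in the admissibility condition \<open>n \<le> min E\<^sub>1\<close>.
  The type is given the norm of the 2-convexified Tsirelson space further down.\<close>

typedef c00 = "{x :: nat \<Rightarrow> real. finite {i. x i \<noteq> 0} \<and> x 0 = 0}"
  morphisms coord Abs_c00
  by (intro exI[of _ "\<lambda>_. 0"]) simp

setup_lifting type_definition_c00

instantiation c00 :: real_vector
begin

lift_definition zero_c00 :: c00 is "\<lambda>_. 0" by simp
lift_definition plus_c00 :: "c00 \<Rightarrow> c00 \<Rightarrow> c00" is "\<lambda>x y i. x i + y i"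
  subgoal for x y by (auto intro: finite_subset[of _ "{i. x i \<noteq> 0} \<union> {i. y i \<noteq> 0}"])
  done
lift_definition minus_c00 :: "c00 \<Rightarrow> c00 \<Rightarrow> c00" is "\<lambda>x y i. x i - y i"
  subgoal for x y by (auto intro: finite_subset[of _ "{i. x i \<noteq> 0} \<union> {i. y i \<noteq> 0}"])
  done
lift_definition uminus_c00 :: "c00 \<Rightarrow> c00" is "\<lambda>x i. - x i" by simp
lift_definition scaleR_c00 :: "real \<Rightarrow> c00 \<Rightarrow> c00" is "\<lambda>a x i. a * x i" by simp

instance
  by standard (transfer; auto simp: algebra_simps)+

end

lift_definition restr :: "nat set \<Rightarrow> c00 \<Rightarrow> c00" is "\<lambda>E x i. if i \<in> E then x i else 0"
  by (auto elim: rev_finite_subset)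

lift_definition square :: "c00 \<Rightarrow> c00" is "\<lambda>x i. \<bar>x i\<bar>\<^sup>2"
  by simp

definition sup_norm :: "c00 \<Rightarrow> real" where
  "sup_norm x = (SUP i. \<bar>coord x i\<bar>)"

text \<open>The list \<open>[E\<^sub>1, \<dots>, E\<^sub>n]\<close> consists of nonempty finite sets of positive integers with
  \<open>E\<^sub>1 < \<dots> < E\<^sub>n\<close> (every element of \<open>E\<^sub>i\<close> is below every element of \<open>E\<^sub>j\<close> if \<open>i < j\<close>) and
  \<open>n \<le> min E\<^sub>1\<close>.\<close>

definition admissible :: "nat set list \<Rightarrow> bool" where
  "admissible Es \<longleftrightarrow>
     Es \<noteq> [] \<and> (\<forall>E\<in>set Es. finite E \<and> E \<noteq> {} \<and> 0 \<notin> E) \<and>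
     sorted_wrt (\<lambda>E F. \<forall>a\<in>E. \<forall>b\<in>F. a < b) Es \<and> length Es \<le> Min (hd Es)"

definition tsirelson_rhs :: "(c00 \<Rightarrow> real) \<Rightarrow> c00 \<Rightarrow> real" where
  "tsirelson_rhs N x =
     max (sup_norm x) (1 / 2 * (SUP Es\<in>{Es. admissible Es}. \<Sum>E\<leftarrow>Es. N (restr E x)))"

text \<open>Existence and uniqueness of the norm are \<open>tsirelson_norm_unique\<close> below. The supremum in
  \<open>tsirelson_rhs\<close> is over a nonempty set, which is bounded for every norm \<open>N\<close> (\<open>bdd_admissible\<close>).\<close>

definition tsirelson_norm :: "c00 \<Rightarrow> real" where
  "tsirelson_norm = (THE N. is_norm N \<and> (\<forall>x. N x = tsirelson_rhs N x))"

lemma coord_add [simp]: "coord (x + y) i = coord x i + coord y i" by transfer simp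
lemma coord_scale [simp]: "coord (a *\<^sub>R x) i = a * coord x i" by transfer simp
lemma coord_zero [simp]: "coord 0 i = 0" by transfer simp
lemma coord_restr [simp]: "coord (restr E x) i = (if i \<in> E then coord x i else 0)" by transfer simp
lemma coord_square [simp]: "coord (square x) i = (coord x i)\<^sup>2" by transfer simp
lemma coord_at_0 [simp]: "coord x 0 = 0" using coord[of x] by simp
lemma c00_eqI: "(\<And>i. coord x i = coord y i) \<Longrightarrow> x = y" by (simp add: coord_inject[symmetric] fun_eq_iff)

definition supp :: "c00 \<Rightarrow> nat set" where "supp x = {i. coord x i \<noteq> 0}"

lemma finite_supp: "finite (supp x)" using coord[of x] by (simp add: supp_def)

lemma restr_add: "restr E (x + y) = restr E x + restr E y" by (rule c00_eqI) simp
lemma restr_scale: "restr E (a *\<^sub>R x) = a *\<^sub>R restr E x" by (rule c00_eqI) simp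
lemma restr_supp: "restr (E \<inter> supp x) x = restr E x" by (rule c00_eqI) (simp add: supp_def)
lemma restr_disj: "E \<inter> supp x = {} \<Longrightarrow> restr E x = 0" by (rule c00_eqI) (auto simp: supp_def)
lemma restr_super: "supp x \<subseteq> E \<Longrightarrow> restr E x = x" by (rule c00_eqI) (auto simp: supp_def)
lemma supp_restr: "supp (restr E x) = E \<inter> supp x" by (auto simp: supp_def)

lemma bdd_coord: "bdd_above (range (\<lambda>i. \<bar>coord x i\<bar>))"
proof -
  have "\<bar>coord x i\<bar> \<in> insert 0 ((\<lambda>i. \<bar>coord x i\<bar>) ` supp x)" for i
    by (cases "i \<in> supp x") (blast, simp add: supp_def)
  then have "finite (range (\<lambda>i. \<bar>coord x i\<bar>))"
    by (meson finite_imageI finite_insert finite_subset finite_supp image_subsetI)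
  then show ?thesis by (rule bdd_above_finite)
qed

lemma coord_le_sup: "\<bar>coord x i\<bar> \<le> sup_norm x"
  unfolding sup_norm_def by (rule cSUP_upper[OF UNIV_I bdd_coord])

lemma sup_leI: "(\<And>i. \<bar>coord x i\<bar> \<le> r) \<Longrightarrow> sup_norm x \<le> r"
  unfolding sup_norm_def by (rule cSUP_least) auto

definition l1 :: "c00 \<Rightarrow> real" where "l1 x = (\<Sum>i\<in>supp x. \<bar>coord x i\<bar>)"

lemma admissible_distinct:
  assumes "admissible Es"
  shows "distinct Es" "\<And>E F. E \<in> set Es \<Longrightarrow> F \<in> set Es \<Longrightarrow> E \<noteq> F \<Longrightarrow> E \<inter> F = {}"
proof -
  have s: "sorted_wrt (\<lambda>E F. \<forall>a\<in>E. \<forall>b\<in>F. a < b) Es" and ne: "\<forall>E\<in>set Es. E \<noteq> {}"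
    using assms by (auto simp: admissible_def)
  from s ne show "distinct Es"
  proof (induction Es)
    case (Cons E Es)
    have "E \<notin> set Es"
    proof
      assume "E \<in> set Es"
      with Cons.prems have "\<forall>a\<in>E. \<forall>b\<in>E. a < b" "E \<noteq> {}" by auto
      then show False by blast
    qed
    with Cons show ?case by simp
  qed simp
  fix E F assume "E \<in> set Es" "F \<in> set Es" "E \<noteq> F"
  with s show "E \<inter> F = {}"
  proof (induction Es)
    case (Cons G Es)
    show ?case
    proof (cases "E \<in> set Es \<and> F \<in> set Es")
      case True with Cons show ?thesis by simp
    next
      case False
      with Cons.prems consider "E = G" "F \<in> set Es" | "F = G" "E \<in> set Es" by auto
      then show ?thesis
        using Cons.prems(1) by cases (simp; metis disjoint_iff less_irrefl)+
    qed
  qed simp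
qed

lemma admissible_ne: "{Es. admissible Es} \<noteq> {}"
  by (auto simp: admissible_def intro!: exI[of _ "[{1}]"])

lemma sum_admissible: "admissible Es \<Longrightarrow> (\<Sum>E\<leftarrow>Es. f E) = (\<Sum>E\<in>set Es. f E :: real)"
  by (simp add: admissible_distinct sum_list_distinct_conv_sum_set)

lemma bdd_admissible:
  fixes N :: "c00 \<Rightarrow> real"
  assumes "\<And>x. 0 \<le> N x" "N 0 = 0"
  shows "bdd_above ((\<lambda>Es. \<Sum>E\<leftarrow>Es. N (restr E x)) ` {Es. admissible Es})"
proof (rule bdd_aboveI2)
  fix Es assume "Es \<in> {Es. admissible Es}"
  then have a: "admissible Es" by simp
  let ?S = "{E \<in> set Es. E \<inter> supp x \<noteq> {}}"
  have "(\<Sum>E\<leftarrow>Es. N (restr E x)) = (\<Sum>E\<in>set Es. N (restr E x))" by (rule sum_admissible[OF a])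
  also have "\<dots> = (\<Sum>E\<in>?S. N (restr E x))"
    by (rule sum.mono_neutral_right) (auto simp: restr_disj assms)
  also have "\<dots> = (\<Sum>E\<in>?S. N (restr (E \<inter> supp x) x))" by (simp add: restr_supp)
  also have "\<dots> = (\<Sum>A\<in>(\<lambda>E. E \<inter> supp x) ` ?S. N (restr A x))"
  proof (rule sum.reindex_cong[symmetric, OF _ refl refl])
    show "inj_on (\<lambda>E. E \<inter> supp x) ?S"
      using admissible_distinct(2)[OF a] by (intro inj_onI) (simp, blast)
  qed
  also have "\<dots> \<le> (\<Sum>A\<in>Pow (supp x). N (restr A x))"
    by (rule sum_mono2) (auto simp: finite_supp assms)
  finally show "(\<Sum>E\<leftarrow>Es. N (restr E x)) \<le> (\<Sum>A\<in>Pow (supp x). N (restr A x))" .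
qed

lemma l1_admissible:
  assumes a: "admissible Es"
  shows "(\<Sum>E\<leftarrow>Es. l1 (restr E x)) \<le> l1 x"
proof -
  have "(\<Sum>E\<leftarrow>Es. l1 (restr E x)) = (\<Sum>E\<in>set Es. \<Sum>i\<in>E \<inter> supp x. \<bar>coord x i\<bar>)"
    unfolding sum_admissible[OF a] by (intro sum.cong refl) (auto simp: l1_def supp_restr)
  also have "\<dots> = (\<Sum>i\<in>(\<Union>E\<in>set Es. E \<inter> supp x). \<bar>coord x i\<bar>)"
    using admissible_distinct(2)[OF a]
    by (intro sum.UNION_disjoint[symmetric] ballI impI finite_set finite_Int disjI2 finite_supp) blast
  also have "\<dots> \<le> l1 x" unfolding l1_def by (rule sum_mono2) (auto simp: finite_supp)
  finally show ?thesis .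
qed

text \<open>An auxiliary class of functions, used to obtain the Tsirelson norm as the limit of the iterates
  of \<open>tsirelson_rhs\<close> started at the supremum norm.\<close>

definition good :: "(c00 \<Rightarrow> real) \<Rightarrow> bool" where
  "good N \<longleftrightarrow> (\<forall>x. sup_norm x \<le> N x) \<and> (\<forall>x. N x \<le> l1 x) \<and>
     (\<forall>x y. N (x + y) \<le> N x + N y) \<and> (\<forall>a x. N (a *\<^sub>R x) \<le> \<bar>a\<bar> * N x) \<and>
     (\<forall>x y. (\<forall>i. \<bar>coord x i\<bar> \<le> \<bar>coord y i\<bar>) \<longrightarrow> N x \<le> N y)"

lemma sup_norm_nonneg: "0 \<le> sup_norm x"
  using coord_le_sup[of x 0] by simp

lemma good_nonneg: "good N \<Longrightarrow> 0 \<le> N x"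
  using sup_norm_nonneg order_trans unfolding good_def by blast

lemma good_0: "good N \<Longrightarrow> N 0 = 0"
  using good_nonneg[of N 0] by (auto simp: good_def l1_def supp_def intro!: antisym dest!: spec[of "\<lambda>x. N x \<le> _ x" 0])

lemma good_sup_norm: "good sup_norm"
  unfolding good_def
proof (intro conjI allI impI)
  fix x y :: c00 and a :: real
  show "sup_norm x \<le> sup_norm x" by simp
  show "sup_norm x \<le> l1 x"
  proof (rule sup_leI)
    fix i show "\<bar>coord x i\<bar> \<le> l1 x"
    proof (cases "i \<in> supp x")
      case True then show ?thesis unfolding l1_def
        using member_le_sum[of i "supp x" "\<lambda>i. \<bar>coord x i\<bar>"] by (simp add: finite_supp)
    next
      case False then show ?thesis by (auto simp: supp_def l1_def sum_nonneg)
    qed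
  qed
  show "sup_norm (x + y) \<le> sup_norm x + sup_norm y"
  proof (rule sup_leI)
    fix i show "\<bar>coord (x + y) i\<bar> \<le> sup_norm x + sup_norm y"
      using coord_le_sup[of x i] coord_le_sup[of y i] by simp
  qed
  show "sup_norm (a *\<^sub>R x) \<le> \<bar>a\<bar> * sup_norm x"
    by (rule sup_leI) (simp add: abs_mult coord_le_sup mult_left_mono)
  assume "\<forall>i. \<bar>coord x i\<bar> \<le> \<bar>coord y i\<bar>"
  then show "sup_norm x \<le> sup_norm y" by (intro sup_leI) (meson coord_le_sup order_trans)
qed

lemma rhs_upper:
  assumes "\<And>x. 0 \<le> N x" "N 0 = 0" "admissible Es"
  shows "1 / 2 * (\<Sum>E\<leftarrow>Es. N (restr E x)) \<le> tsirelson_rhs N x"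
proof -
  have "(\<Sum>E\<leftarrow>Es. N (restr E x)) \<le> (SUP Es\<in>{Es. admissible Es}. \<Sum>E\<leftarrow>Es. N (restr E x))"
    by (rule cSUP_upper[OF _ bdd_admissible]) (auto simp: assms)
  then show ?thesis by (simp add: tsirelson_rhs_def)
qed

lemma rhs_leI:
  assumes "sup_norm x \<le> r" "\<And>Es. admissible Es \<Longrightarrow> 1 / 2 * (\<Sum>E\<leftarrow>Es. N (restr E x)) \<le> r"
  shows "tsirelson_rhs N x \<le> r"
proof -
  have "(SUP Es\<in>{Es. admissible Es}. \<Sum>E\<leftarrow>Es. N (restr E x)) \<le> 2 * r"
  proof (rule cSUP_least[OF admissible_ne])
    fix Es assume "Es \<in> {Es. admissible Es}"
    then show "(\<Sum>E\<leftarrow>Es. N (restr E x)) \<le> 2 * r" using assms(2)[of Es] by simp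
  qed
  then show ?thesis using assms(1) by (simp add: tsirelson_rhs_def)
qed

lemma good_rhs:
  assumes g: "good N" shows "good (tsirelson_rhs N)"
  unfolding good_def
proof (intro conjI allI impI)
  note up = rhs_upper[of N, OF good_nonneg[OF g] good_0[OF g]]
  have sl: "sup_norm x \<le> tsirelson_rhs N x" for x by (simp add: tsirelson_rhs_def)
  fix x y :: c00 and a :: real
  show "sup_norm x \<le> tsirelson_rhs N x" by (rule sl)
  show "tsirelson_rhs N x \<le> l1 x"
  proof (rule rhs_leI)
    show "sup_norm x \<le> l1 x" using good_sup_norm by (auto simp: good_def)
    fix Es assume a: "admissible Es"
    have "(\<Sum>E\<leftarrow>Es. N (restr E x)) \<le> (\<Sum>E\<leftarrow>Es. l1 (restr E x))"
      using g by (intro sum_list_mono) (auto simp: good_def)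
    moreover have "0 \<le> l1 x" by (simp add: l1_def sum_nonneg)
    ultimately show "1 / 2 * (\<Sum>E\<leftarrow>Es. N (restr E x)) \<le> l1 x"
      using l1_admissible[OF a, of x] by linarith
  qed
  show "tsirelson_rhs N (x + y) \<le> tsirelson_rhs N x + tsirelson_rhs N y"
  proof (rule rhs_leI)
    show "sup_norm (x + y) \<le> tsirelson_rhs N x + tsirelson_rhs N y"
      using good_sup_norm sl[of x] sl[of y] unfolding good_def by (smt (verit))
    fix Es assume a: "admissible Es"
    have "(\<Sum>E\<leftarrow>Es. N (restr E (x + y))) \<le> (\<Sum>E\<leftarrow>Es. N (restr E x) + N (restr E y))"
      using g by (intro sum_list_mono) (auto simp: good_def restr_add)
    also have "\<dots> = (\<Sum>E\<leftarrow>Es. N (restr E x)) + (\<Sum>E\<leftarrow>Es. N (restr E y))"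
      by (rule sum_list_addf)
    finally show "1 / 2 * (\<Sum>E\<leftarrow>Es. N (restr E (x + y))) \<le> tsirelson_rhs N x + tsirelson_rhs N y"
      using up[OF a, of x] up[OF a, of y] by linarith
  qed
  show "tsirelson_rhs N (a *\<^sub>R x) \<le> \<bar>a\<bar> * tsirelson_rhs N x"
  proof (rule rhs_leI)
    show "sup_norm (a *\<^sub>R x) \<le> \<bar>a\<bar> * tsirelson_rhs N x"
      using good_sup_norm mult_left_mono[OF sl[of x], of "\<bar>a\<bar>"] order_trans
      unfolding good_def by (meson abs_ge_zero)
    fix Es assume ad: "admissible Es"
    have "(\<Sum>E\<leftarrow>Es. N (restr E (a *\<^sub>R x))) \<le> (\<Sum>E\<leftarrow>Es. \<bar>a\<bar> * N (restr E x))"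
      using g by (intro sum_list_mono) (auto simp: good_def restr_scale)
    also have "\<dots> = \<bar>a\<bar> * (\<Sum>E\<leftarrow>Es. N (restr E x))"
      by (rule sum_list_const_mult)
    finally show "1 / 2 * (\<Sum>E\<leftarrow>Es. N (restr E (a *\<^sub>R x))) \<le> \<bar>a\<bar> * tsirelson_rhs N x"
      using mult_left_mono[OF up[OF ad, of x], of "\<bar>a\<bar>"] by simp
  qed
  assume le: "\<forall>i. \<bar>coord x i\<bar> \<le> \<bar>coord y i\<bar>"
  show "tsirelson_rhs N x \<le> tsirelson_rhs N y"
  proof (rule rhs_leI)
    show "sup_norm x \<le> tsirelson_rhs N y"
      using good_sup_norm le sl[of y] order_trans unfolding good_def by blast
    fix Es assume ad: "admissible Es"
    have "(\<Sum>E\<leftarrow>Es. N (restr E x)) \<le> (\<Sum>E\<leftarrow>Es. N (restr E y))"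
      using g le by (intro sum_list_mono) (auto simp: good_def)
    then show "1 / 2 * (\<Sum>E\<leftarrow>Es. N (restr E x)) \<le> tsirelson_rhs N y"
      using up[OF ad, of y] by linarith
  qed
qed

lemma rhs_mono:
  assumes "good M" "good N" "\<And>x. M x \<le> N x"
  shows "tsirelson_rhs M x \<le> tsirelson_rhs N x"
proof (rule rhs_leI)
  show "sup_norm x \<le> tsirelson_rhs N x" by (simp add: tsirelson_rhs_def)
  fix Es assume ad: "admissible Es"
  have "(\<Sum>E\<leftarrow>Es. M (restr E x)) \<le> (\<Sum>E\<leftarrow>Es. N (restr E x))"
    using assms by (intro sum_list_mono) auto
  then show "1 / 2 * (\<Sum>E\<leftarrow>Es. M (restr E x)) \<le> tsirelson_rhs N x"
    using rhs_upper[of N, OF good_nonneg[OF assms(2)] good_0[OF assms(2)] ad, of x] by linarith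
qed

lemma tsirelson_norm_exists: "\<exists>N. good N \<and> (\<forall>x. N x = tsirelson_rhs N x)"
proof -
  define M where "M k = (tsirelson_rhs ^^ k) sup_norm" for k
  have M0: "M 0 = sup_norm" and MS: "M (Suc k) = tsirelson_rhs (M k)" for k by (auto simp: M_def)
  have g: "good (M k)" for k
    by (induction k) (auto simp: M0 MS good_sup_norm good_rhs)
  have inc: "M k x \<le> M (Suc k) x" for k x
  proof (induction k arbitrary: x)
    case 0 then show ?case by (simp add: M0 MS tsirelson_rhs_def)
  next
    case (Suc k) then show ?case using rhs_mono[OF g g] by (metis MS)
  qed
  have Ml1: "M k x \<le> l1 x" for k x using g by (auto simp: good_def)
  define N where "N x = (SUP k. M k x)" for x
  have bdd: "bdd_above (range (\<lambda>k. M k x))" for x using Ml1 by (intro bdd_aboveI2)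
  have lim: "(\<lambda>k. M k x) \<longlonglongrightarrow> N x" for x
    unfolding N_def by (rule LIMSEQ_incseq_SUP[OF bdd]) (simp add: incseq_Suc_iff inc)
  have MN: "M k x \<le> N x" for k x unfolding N_def by (rule cSUP_upper[OF UNIV_I bdd])
  have gN: "good N"
    unfolding good_def
  proof (intro conjI allI impI)
    fix x y :: c00 and a :: real
    show "sup_norm x \<le> N x" using MN[of 0 x] by (simp add: M0)
    show "N x \<le> l1 x" by (rule LIMSEQ_le_const2[OF lim]) (simp add: Ml1)
    show "N (x + y) \<le> N x + N y"
      by (rule LIMSEQ_le[OF lim tendsto_add[OF lim lim]]) (use g in \<open>auto simp: good_def\<close>)
    show "N (a *\<^sub>R x) \<le> \<bar>a\<bar> * N x"
      by (rule LIMSEQ_le[OF lim tendsto_mult_left[OF lim]]) (use g in \<open>auto simp: good_def\<close>)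
    assume "\<forall>i. \<bar>coord x i\<bar> \<le> \<bar>coord y i\<bar>"
    then show "N x \<le> N y"
      by (intro LIMSEQ_le[OF lim lim]) (use g in \<open>auto simp: good_def\<close>)
  qed
  have "N x = tsirelson_rhs N x" for x
  proof (rule antisym)
    show "N x \<le> tsirelson_rhs N x"
    proof (rule LIMSEQ_le_const2[OF lim], intro exI allI impI)
      fix k
      have "M k x \<le> M (Suc k) x" by (rule inc)
      also have "\<dots> \<le> tsirelson_rhs N x" unfolding MS by (rule rhs_mono[OF g gN MN])
      finally show "M k x \<le> tsirelson_rhs N x" .
    qed
    show "tsirelson_rhs N x \<le> N x"
    proof (rule rhs_leI)
      show "sup_norm x \<le> N x" using gN by (auto simp: good_def)
      fix Es assume ad: "admissible Es"
      have "(\<lambda>k. 1 / 2 * (\<Sum>E\<in>set Es. M k (restr E x))) \<longlonglongrightarrow> 1 / 2 * (\<Sum>E\<in>set Es. N (restr E x))"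
        by (intro tendsto_mult_left tendsto_sum lim)
      then have "(\<lambda>k. 1 / 2 * (\<Sum>E\<leftarrow>Es. M k (restr E x))) \<longlonglongrightarrow> 1 / 2 * (\<Sum>E\<leftarrow>Es. N (restr E x))"
        by (simp only: sum_admissible[OF ad])
      then show "1 / 2 * (\<Sum>E\<leftarrow>Es. N (restr E x)) \<le> N x"
      proof (rule LIMSEQ_le_const2, intro exI allI impI)
        fix k
        have "1 / 2 * (\<Sum>E\<leftarrow>Es. M k (restr E x)) \<le> M (Suc k) x"
          unfolding MS by (rule rhs_upper[of "M k", OF good_nonneg[OF g] good_0[OF g] ad])
        also have "\<dots> \<le> N x" by (rule MN)
        finally show "1 / 2 * (\<Sum>E\<leftarrow>Es. M k (restr E x)) \<le> N x" .
      qed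
    qed
  qed
  with gN show ?thesis by blast
qed

lemma tsirelson_norm_le:
  assumes "is_norm M" "is_norm N" "\<And>x. M x = tsirelson_rhs M x" "\<And>x. N x = tsirelson_rhs N x"
  shows "M x \<le> N x"
proof (induction "card (supp x)" arbitrary: x rule: less_induct)
  case less
  have pos: "0 \<le> M y" "0 \<le> N y" "M 0 = 0" "N 0 = 0" for y using assms(1,2) by (auto simp: is_norm_def)
  have "M x = tsirelson_rhs M x" by (rule assms(3))
  also have "\<dots> \<le> max (N x) (1 / 2 * M x)"
  proof (rule rhs_leI)
    show "sup_norm x \<le> max (N x) (1 / 2 * M x)"
      using assms(4)[of x] by (simp add: tsirelson_rhs_def)
    fix Es assume ad: "admissible Es"
    show "1 / 2 * (\<Sum>E\<leftarrow>Es. M (restr E x)) \<le> max (N x) (1 / 2 * M x)"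
    proof (cases "\<exists>E\<in>set Es. supp x \<subseteq> E")
      case True
      then obtain E where E: "E \<in> set Es" "supp x \<subseteq> E" by blast
      have "M (restr F x) = 0" if "F \<in> set Es - {E}" for F
      proof -
        have "F \<inter> E = {}" using admissible_distinct(2)[OF ad] that E by blast
        then show ?thesis using E(2) by (subst restr_disj) (auto simp: pos)
      qed
      then have "(\<Sum>E\<leftarrow>Es. M (restr E x)) = M (restr E x)"
        unfolding sum_admissible[OF ad] using E(1) by (subst sum.remove[of _ E]) auto
      then show ?thesis by (simp add: restr_super[OF E(2)])
    next
      case False
      have "(\<Sum>E\<leftarrow>Es. M (restr E x)) \<le> (\<Sum>E\<leftarrow>Es. N (restr E x))"
      proof (rule sum_list_mono)
        fix E assume "E \<in> set Es"
        with False have "supp (restr E x) \<subset> supp x" by (auto simp: supp_restr)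
        then show "M (restr E x) \<le> N (restr E x)"
          by (intro less psubset_card_mono finite_supp)
      qed
      moreover have "1 / 2 * (\<Sum>E\<leftarrow>Es. N (restr E x)) \<le> N x"
        using rhs_upper[of N, OF pos(2) pos(4) ad, of x] assms(4)[of x] by simp
      ultimately show ?thesis by linarith
    qed
  qed
  finally show ?case using pos(1,2)[of x] by linarith
qed

lemma good_is_norm:
  assumes g: "good N" shows "is_norm N"
  unfolding is_norm_def
proof (intro conjI allI)
  fix x y :: c00 and a :: real
  show "0 \<le> N x" by (rule good_nonneg[OF g])
  show "N x = 0 \<longleftrightarrow> x = 0"
  proof
    assume "N x = 0"
    then have "sup_norm x \<le> 0" using g unfolding good_def by metis
    then show "x = 0" by (intro c00_eqI) (metis abs_le_zero_iff coord_le_sup coord_zero order_trans)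
  qed (simp add: good_0[OF g])
  show "N (x + y) \<le> N x + N y" using g by (auto simp: good_def)
  have le: "N (a *\<^sub>R x) \<le> \<bar>a\<bar> * N x" for a x using g by (auto simp: good_def)
  show "N (a *\<^sub>R x) = \<bar>a\<bar> * N x"
  proof (cases "a = 0")
    case False
    have "N x \<le> \<bar>inverse a\<bar> * N (a *\<^sub>R x)" using le[of "inverse a" "a *\<^sub>R x"] False by simp
    then have "\<bar>a\<bar> * N x \<le> N (a *\<^sub>R x)" using False by (simp add: field_simps)
    with le show ?thesis by (rule antisym)
  qed (simp add: good_0[OF g])
qed

lemma tsirelson_norm_good: "good tsirelson_norm \<and> (\<forall>x. tsirelson_norm x = tsirelson_rhs tsirelson_norm x)"
proof -
  obtain N where N: "good N" "\<And>x. N x = tsirelson_rhs N x" using tsirelson_norm_exists by blast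
  have "tsirelson_norm = N"
    unfolding tsirelson_norm_def
  proof (rule the_equality)
    show "is_norm N \<and> (\<forall>x. N x = tsirelson_rhs N x)"
      using good_is_norm[OF N(1)] N(2) by blast
    fix M assume "is_norm M \<and> (\<forall>x. M x = tsirelson_rhs M x)"
    then show "M = N"
      using tsirelson_norm_le[of M N] tsirelson_norm_le[of N M] good_is_norm[OF N(1)] N(2)
      by (intro ext antisym) blast+
  qed
  with N show ?thesis by simp
qed

lemma tsirelson_norm_unique:
  "\<exists>!N. is_norm N \<and> (\<forall>x. N x = tsirelson_rhs N x)"
  using tsirelson_norm_good good_is_norm tsirelson_norm_le
  by (intro ex1I[of _ tsirelson_norm] ext antisym) blast+

lemma tsirelson_norm_is_norm: "is_norm tsirelson_norm"
  and tsirelson_norm_eq: "tsirelson_norm x = tsirelson_rhs tsirelson_norm x"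
  using tsirelson_norm_good good_is_norm by blast+

instantiation c00 :: real_normed_vector
begin

definition norm_c00 :: "c00 \<Rightarrow> real" where
  "norm x = sqrt (tsirelson_norm (square x))" for x :: c00
definition dist_c00 :: "c00 \<Rightarrow> c00 \<Rightarrow> real" where
  "dist x y = norm (x - y)" for x y :: c00
definition sgn_c00 :: "c00 \<Rightarrow> c00" where
  "sgn x = inverse (norm x) *\<^sub>R x" for x :: c00
definition uniformity_c00 :: "(c00 \<times> c00) filter" where
  "uniformity_c00 = (INF e\<in>{0<..}. principal {(x, y). dist x y < e})"
definition open_c00 :: "c00 set \<Rightarrow> bool" where
  "open_c00 U \<longleftrightarrow> (\<forall>x\<in>U. eventually (\<lambda>(x', y). x' = x \<longrightarrow> y \<in> U) uniformity)"

instance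
proof
  note T = tsirelson_norm_is_norm[unfolded is_norm_def]
  have T0: "0 \<le> tsirelson_norm z" for z using T by blast
  have Tadd: "tsirelson_norm (z + w) \<le> tsirelson_norm z + tsirelson_norm w" for z w using T by blast
  have Tsc: "tsirelson_norm (c *\<^sub>R z) = \<bar>c\<bar> * tsirelson_norm z" for c z using T by blast
  fix x y :: c00 and a :: real
  have n0: "0 \<le> norm z" for z :: c00 by (simp add: norm_c00_def T0)
  have nsq: "(norm z)\<^sup>2 = tsirelson_norm (square z)" for z :: c00 by (simp add: norm_c00_def T0)
  have z: "norm z = 0 \<longleftrightarrow> z = 0" for z :: c00
  proof -
    have "norm z = 0 \<longleftrightarrow> square z = 0" using T by (simp add: norm_c00_def)
    also have "\<dots> \<longleftrightarrow> z = 0"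
    proof
      assume "square z = 0"
      then have "(coord z i)\<^sup>2 = 0" for i by (metis coord_square coord_zero)
      then show "z = 0" by (intro c00_eqI) simp
    next
      assume "z = 0" then show "square z = 0" by (intro c00_eqI) simp
    qed
    finally show ?thesis .
  qed
  show "norm x = 0 \<longleftrightarrow> x = 0" by (rule z)
  show "norm (x + y) \<le> norm x + norm y"
  proof (cases "x = 0 \<or> y = 0")
    case False
    define u v where "u = norm x" and "v = norm y"
    have uv: "u > 0" "v > 0" using False z n0 by (auto simp: u_def v_def less_le)
    define t where "t = v / u"
    have t: "t > 0" using uv by (simp add: t_def)
    have "\<bar>coord (square (x + y)) i\<bar>
        \<le> \<bar>coord ((1 + t) *\<^sub>R square x + (1 + inverse t) *\<^sub>R square y) i\<bar>" for i
    proof -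
      have "0 \<le> (sqrt t * coord x i - inverse (sqrt t) * coord y i)\<^sup>2" by simp
      also have "\<dots> = t * (coord x i)\<^sup>2 + inverse t * (coord y i)\<^sup>2 - 2 * coord x i * coord y i"
        using t by (simp add: power2_diff power_mult_distrib power_inverse)
      finally have "(coord x i + coord y i)\<^sup>2 \<le> (1 + t) * (coord x i)\<^sup>2 + (1 + inverse t) * (coord y i)\<^sup>2"
        by (simp add: power2_sum algebra_simps)
      then show ?thesis by simp
    qed
    then have "(norm (x + y))\<^sup>2 \<le> tsirelson_norm ((1 + t) *\<^sub>R square x + (1 + inverse t) *\<^sub>R square y)"
      unfolding nsq using tsirelson_norm_good unfolding good_def by blast
    also have "\<dots> \<le> (1 + t) * u\<^sup>2 + (1 + inverse t) * v\<^sup>2"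
      using Tadd[of "(1 + t) *\<^sub>R square x" "(1 + inverse t) *\<^sub>R square y"] t
      by (simp add: Tsc u_def v_def nsq)
    also have "\<dots> = (u + v)\<^sup>2"
    proof -
      have "t * u = v" "inverse t * v = u" using uv by (simp_all add: t_def)
      then have "t * u\<^sup>2 = v * u" "inverse t * v\<^sup>2 = u * v"
        by (simp_all add: power2_eq_square mult.assoc[symmetric])
      then show ?thesis unfolding distrib_right power2_sum by simp
    qed
    finally have "norm (x + y) \<le> u + v" by (rule power2_le_imp_le) (use uv in simp)
    then show ?thesis by (simp add: u_def v_def)
  next
    case True
    moreover have "norm (0 :: c00) = 0" by (simp add: z)
    ultimately show ?thesis by auto
  qed
  show "norm (a *\<^sub>R x) = \<bar>a\<bar> * norm x"
  proof -
    have "square (a *\<^sub>R x) = a\<^sup>2 *\<^sub>R square x" by (rule c00_eqI) (simp add: power_mult_distrib)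
    then show ?thesis by (simp add: norm_c00_def Tsc real_sqrt_mult)
  qed
qed (auto simp: dist_c00_def sgn_c00_def uniformity_c00_def open_c00_def)

end

type_synonym convexified_tsirelson = "c00 banach_completion"

definition equivalent_norm :: "('a::real_normed_vector \<Rightarrow> real) \<Rightarrow> bool" where
  "equivalent_norm N \<longleftrightarrow>
     is_norm N \<and> (\<exists>c>0. \<exists>C>0. \<forall>x. c * norm x \<le> N x \<and> N x \<le> C * norm x)"

definition GL :: "('a::real_normed_vector \<Rightarrow>\<^sub>L 'a) monoid" where
  "GL = \<lparr>carrier = {g. \<exists>h. g o\<^sub>L h = id_blinfun \<and> h o\<^sub>L g = id_blinfun},
         monoid.mult = (o\<^sub>L), one = id_blinfun\<rparr>"

text \<open>A linear map preserving an equivalent norm is automatically bounded, so requiring bounded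
  operators here excludes no linear isometry.\<close>

definition isometry_group :: "('a::real_normed_vector \<Rightarrow> real) \<Rightarrow> ('a \<Rightarrow>\<^sub>L 'a) set" where
  "isometry_group N = {g. surj (blinfun_apply g) \<and> (\<forall>x. N (g x) = N x)}"

definition bounded_subgroup :: "('a::real_normed_vector \<Rightarrow>\<^sub>L 'a) set \<Rightarrow> bool" where
  "bounded_subgroup G \<longleftrightarrow> subgroup G GL \<and> bounded G"

definition maximal_bounded_subgroup :: "('a::real_normed_vector \<Rightarrow>\<^sub>L 'a) set \<Rightarrow> bool" where
  "maximal_bounded_subgroup G \<longleftrightarrow>
     bounded_subgroup G \<and> (\<forall>H. bounded_subgroup H \<longrightarrow> \<not> G \<subset> H)"

definition conjugate_in_GL ::
  "('a::real_normed_vector \<Rightarrow>\<^sub>L 'a) set \<Rightarrow> ('a \<Rightarrow>\<^sub>L 'a) set \<Rightarrow> bool" where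
  "conjugate_in_GL G1 G2 \<longleftrightarrow>
     (\<exists>S\<in>carrier GL. G1 = (\<lambda>g. inv\<^bsub>GL\<^esub> S \<otimes>\<^bsub>GL\<^esub> g \<otimes>\<^bsub>GL\<^esub> S) ` G2)"

lemma group_GL: "group (GL :: ('a::real_normed_vector \<Rightarrow>\<^sub>L 'a) monoid)"
proof (rule groupI)
  fix g h :: "'a \<Rightarrow>\<^sub>L 'a" assume "g \<in> carrier GL" "h \<in> carrier GL"
  then obtain g' h' where *: "g o\<^sub>L g' = id_blinfun" "g' o\<^sub>L g = id_blinfun"
    "h o\<^sub>L h' = id_blinfun" "h' o\<^sub>L h = id_blinfun" by (auto simp: GL_def)
  have ap: "g (g' x) = x" "g' (g x) = x" "h (h' x) = x" "h' (h x) = x" for x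
    using *[THEN arg_cong[of _ _ "\<lambda>f. blinfun_apply f x"]] by simp_all
  have "(g o\<^sub>L h) o\<^sub>L (h' o\<^sub>L g') = id_blinfun" "(h' o\<^sub>L g') o\<^sub>L (g o\<^sub>L h) = id_blinfun"
    by (rule blinfun_eqI, simp add: ap)+
  then show "g \<otimes>\<^bsub>GL\<^esub> h \<in> carrier GL" by (auto simp: GL_def)
next
  fix g :: "'a \<Rightarrow>\<^sub>L 'a" assume "g \<in> carrier GL"
  then show "\<exists>h\<in>carrier GL. h \<otimes>\<^bsub>GL\<^esub> g = \<one>\<^bsub>GL\<^esub>" by (auto simp: GL_def)
next
  show "\<one>\<^bsub>GL\<^esub> \<in> carrier (GL :: ('a \<Rightarrow>\<^sub>L 'a) monoid)"
    by (auto simp: GL_def intro!: exI[of _ id_blinfun] blinfun_eqI)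
qed (auto simp: GL_def intro!: blinfun_eqI)

lemma isometry_group_bounded_subgroup:
  fixes N :: "'a::real_normed_vector \<Rightarrow> real"
  assumes "equivalent_norm N"
  shows "bounded_subgroup (isometry_group N)"
proof -
  obtain c C where N: "is_norm N" and c: "c > 0" "C > 0"
    and le: "\<And>x. c * norm x \<le> N x" "\<And>x. N x \<le> C * norm x"
    using assms unfolding equivalent_norm_def by blast
  have nn: "norm x \<le> C / c * norm y" if "N x = N y" for x y
    using le(1)[of x] le(2)[of y] that c by (simp add: field_simps)
  have inverse: "\<exists>h\<in>isometry_group N. g o\<^sub>L h = id_blinfun \<and> h o\<^sub>L g = id_blinfun"
    if g: "g \<in> isometry_group N" for g
  proof -
    from g have s: "surj (blinfun_apply g)" and iso: "\<And>x. N (g x) = N x"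
      by (auto simp: isometry_group_def)
    have i: "inj (blinfun_apply g)"
    proof (rule injI)
      fix x y assume "g x = g y"
      then have "g (x - y) = 0" by (simp add: blinfun.diff_right)
      then have "N (x - y) = N 0" using iso[of "x - y"] by simp
      moreover have N0: "N z = 0 \<longleftrightarrow> z = 0" for z using N unfolding is_norm_def by blast
      ultimately have "x - y = 0" using N0[of 0] N0[of "x - y"] by simp
      then show "x = y" by simp
    qed
    define k where "k = inv_into UNIV (blinfun_apply g)"
    have gk: "g (k x) = x" and kg: "k (g x) = x" for x
      unfolding k_def by (simp_all add: s i surj_f_inv_f)
    have Nk: "N (k x) = N x" for x using iso[of "k x"] by (simp add: gk)
    have "bounded_linear k"
    proof (rule bounded_linear_intro[where K = "C / c"])
      show "k (x + y) = k x + k y" for x y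
        by (rule injD[OF i]) (simp add: blinfun.add_right gk)
      show "k (r *\<^sub>R x) = r *\<^sub>R k x" for r x
        by (rule injD[OF i]) (simp add: blinfun.scaleR_right gk)
      show "norm (k x) \<le> norm x * (C / c)" for x
        using nn[OF Nk] by (simp add: mult.commute)
    qed
    then have B: "blinfun_apply (Blinfun k) = k" by (rule bounded_linear_Blinfun_apply)
    have "Blinfun k \<in> isometry_group N"
      using Nk surjI[of k "blinfun_apply g", OF kg] by (simp add: isometry_group_def B)
    moreover have "g o\<^sub>L Blinfun k = id_blinfun" "Blinfun k o\<^sub>L g = id_blinfun"
      by (rule blinfun_eqI, simp add: B gk kg)+
    ultimately show ?thesis by blast
  qed
  have "subgroup (isometry_group N) GL"
  proof (rule group.subgroupI[OF group_GL])
    show "isometry_group N \<subseteq> carrier GL" using inverse by (auto simp: GL_def)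
    have "id_blinfun \<in> isometry_group N" by (auto simp: isometry_group_def)
    then show "isometry_group N \<noteq> {}" by blast
  next
    fix g assume g: "g \<in> isometry_group N"
    obtain h where h: "h \<in> isometry_group N" "g o\<^sub>L h = id_blinfun" "h o\<^sub>L g = id_blinfun"
      using inverse[OF g] by blast
    then have "inv\<^bsub>GL\<^esub> g = h"
      by (intro group.inv_equality[OF group_GL]) (auto simp: GL_def)
    then show "inv\<^bsub>GL\<^esub> g \<in> isometry_group N" using h by simp
  next
    fix g h assume "g \<in> isometry_group N" "h \<in> isometry_group N"
    then show "g \<otimes>\<^bsub>GL\<^esub> h \<in> isometry_group N"
      by (auto simp: isometry_group_def GL_def surj_def) metis
  qed
  moreover have "bounded (isometry_group N)"
    unfolding bounded_iff
  proof (intro exI ballI)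
    fix g assume "g \<in> isometry_group N"
    then show "norm g \<le> C / c"
      using c nn by (intro norm_blinfun_bound) (auto simp: isometry_group_def)
  qed
  ultimately show ?thesis by (simp add: bounded_subgroup_def)
qed

end

theory Submission
  imports Defs
begin

text \<open>
  Cut the positive integers into blocks of sizes 3, 4, 8, 16, and so on. Replacing a vector by the \<open>\<ell>\<^sub>2\<close>
  norms of its blocks, placed at the first elements of the blocks, gives an equivalent norm on \<open>T\<^sup>(\<^sup>2\<^sup>)\<close>:
  on a block the \<open>T\<close> norm is equivalent to the \<open>\<ell>\<^sub>1\<close> norm, and moving mass within
  a block changes the \<open>T\<close> norm by a bounded factor only. The isometry group contains the product of
  the orthogonal groups of the blocks.

  For an equivalent norm \<open>N\<close> which is invariant under sign changes of a basis, call two basis vectors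
  related if \<open>N\<close> is invariant under the rotations of the plane they span. This is an
  equivalence relation, \<open>N\<close> is Euclidean on every class, and every isometry maps the span of a class
  to the span of a class. If all classes are finite and have distinct sizes, every isometry preserves
  each of these spans, and replacing \<open>N\<close> on two of them by a common Euclidean norm yields a strictly larger
  isometry group. A maximal bounded group containing the orthogonal groups of the
  blocks is the isometry group of such a norm \<open>N\<close>: its classes are unions of blocks; they are finite
  because \<open>T\<close> does not dominate the \<open>\<ell>\<^sub>1\<close> norm on any infinite set of coordinates, and
  their sizes are distinct because the block sizes have distinct subset sums. So there is no such group.

  Merging the blocks \<open>2 m\<close> and \<open>2 m + 1\<close> for the \<open>m\<close> in an arbitrary set of integers gives a continuum
  of norms. A conjugacy carries minimal invariant subspaces to minimal
  invariant subspaces, so it preserves the set of class sizes, which determines which blocks were merged.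
\<close>

section \<open>Norms invariant under sign changes\<close>

text \<open>All that is known of a maximal bounded group containing the given one is this
  containment, so every structural statement about its invariant norm has to come from the sign
  changes and rotations that it inherits.

  Symmetries are compared through their generators. A rotation of a coordinate plane, conjugated by
  an isometry, bears no visible relation to the basis, whereas its generator is a matrix whose
  entries can be isolated by sign changes. Generators can be added, isometries cannot. Defining them
  by difference quotients of the norm avoids exponentials of operators; the few flows that occur are
  explicit.

  Dyadic length makes a block Euclidean up to a constant: a block from \<open>n\<close> to
  \<open>2 n\<close> has at most \<open>n\<close> elements, so its singletons form an admissible
  family. Joining two neighbours only changes that constant, so all choices of pairs give equivalent
  norms.\<close>

locale unconditional_norm =
  fixes N :: "'a::real_normed_vector \<Rightarrow> real" and e :: "'i \<Rightarrow> 'a" and \<phi> :: "'i \<Rightarrow> 'a \<Rightarrow> real"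
  assumes equivalent: "equivalent_norm N"
    and bounded_linear_coord: "bounded_linear (\<phi> i)"
    and coord_basis: "\<phi> i (e j) = (if i = j then 1 else 0)"
    and coord_total: "(\<And>i. \<phi> i x = 0) \<Longrightarrow> x = 0"
    and dense_span: "closure (span (range e)) = UNIV"
    and normalised: "N (e i) = 1"
    and sign_change: "N (x - (2 * \<phi> i x) *\<^sub>R e i) = N x"
begin

lemma is_norm: "is_norm N"
  using equivalent by (simp add: equivalent_norm_def)

lemma N_nonneg: "0 \<le> N x" and N_eq_0: "N x = 0 \<longleftrightarrow> x = 0"
  and N_triangle: "N (x + y) \<le> N x + N y" and N_scale: "N (a *\<^sub>R x) = \<bar>a\<bar> * N x"
  using is_norm by (auto simp: is_norm_def)

lemma N_minus: "N (- x) = N x"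
  using N_scale[of "-1" x] by simp

lemma N_diff_le: "N x - N y \<le> N (x - y)"
  using N_triangle[of "x - y" y] by simp

lemma N_bound: obtains C where "C > 0" "\<And>x. N x \<le> C * norm x"
  using equivalent by (auto simp: equivalent_norm_def)

lemma linear_coord: "linear (\<phi> i)"
  using bounded_linear_coord bounded_linear.linear by blast

lemmas coord_simps = linear_add[OF linear_coord] linear_diff[OF linear_coord]
  linear_neg[OF linear_coord] linear_scale[OF linear_coord] linear_0[OF linear_coord]
  linear_sum[OF linear_coord] coord_basis

text \<open>Infinitesimal isometries: the derivative of \<open>N\<close> at \<open>x\<close> in the direction \<open>A x\<close> vanishes.
  As \<open>N\<close> is convex, the one-sided upper estimate suffices, and it makes the set of skew maps closed
  under sums.\<close>

definition skew :: "('a \<Rightarrow> 'a) \<Rightarrow> bool" where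
  "skew A \<longleftrightarrow> (\<forall>x. \<forall>\<epsilon>>0. \<exists>\<delta>>0. \<forall>t. \<bar>t\<bar> < \<delta> \<longrightarrow> N (x + t *\<^sub>R A x) \<le> N x + \<epsilon> * \<bar>t\<bar>)"

text \<open>\<open>N x\<close> is at most the mean of the values of \<open>N\<close> at
  \<open>x + t A x\<close> and \<open>x - t A x\<close>, so the upper bound at \<open>-t\<close> is
  a lower bound at \<open>t\<close>.\<close>

lemma skewE:
  assumes "skew A" "\<epsilon> > 0"
  obtains \<delta> where "\<delta> > 0" "\<And>t. \<bar>t\<bar> < \<delta> \<Longrightarrow> \<bar>N (x + t *\<^sub>R A x) - N x\<bar> \<le> \<epsilon> * \<bar>t\<bar>"
proof -
  obtain \<delta> where d: "\<delta> > 0" "\<And>t. \<bar>t\<bar> < \<delta> \<Longrightarrow> N (x + t *\<^sub>R A x) \<le> N x + \<epsilon> * \<bar>t\<bar>"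
    using assms unfolding skew_def by blast
  have "\<bar>N (x + t *\<^sub>R A x) - N x\<bar> \<le> \<epsilon> * \<bar>t\<bar>" if "\<bar>t\<bar> < \<delta>" for t
  proof -
    have "2 * N x = N ((x + t *\<^sub>R A x) + (x + (- t) *\<^sub>R A x))"
      using N_scale[of 2 x] by (simp add: scaleR_2)
    also have "\<dots> \<le> N (x + t *\<^sub>R A x) + N (x + (- t) *\<^sub>R A x)" by (rule N_triangle)
    finally show ?thesis using d(2)[of t] d(2)[of "- t"] that by auto
  qed
  with d(1) show ?thesis using that by blast
qed

text \<open>The point \<open>x + t (A x + B x)\<close> is the midpoint of \<open>x + 2 t A x\<close>
  and \<open>x + 2 t B x\<close>, so convexity of the norm combines the two estimates.\<close>

lemma skew_add:
  assumes "skew A" "skew B" shows "skew (\<lambda>x. A x + B x)"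
  unfolding skew_def
proof (intro allI impI)
  fix x and \<epsilon> :: real assume e: "\<epsilon> > 0"
  then have "\<epsilon> / 2 > 0" by simp
  then obtain d1 d2 where d: "d1 > 0" "d2 > 0"
    "\<And>t. \<bar>t\<bar> < d1 \<Longrightarrow> N (x + t *\<^sub>R A x) \<le> N x + \<epsilon> / 2 * \<bar>t\<bar>"
    "\<And>t. \<bar>t\<bar> < d2 \<Longrightarrow> N (x + t *\<^sub>R B x) \<le> N x + \<epsilon> / 2 * \<bar>t\<bar>"
    using assms unfolding skew_def by metis
  have "N (x + t *\<^sub>R (A x + B x)) \<le> N x + \<epsilon> * \<bar>t\<bar>" if "\<bar>t\<bar> < min d1 d2 / 2" for t
  proof -
    have "2 * N (x + t *\<^sub>R (A x + B x)) = N ((x + (2 * t) *\<^sub>R A x) + (x + (2 * t) *\<^sub>R B x))"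
      using N_scale[of 2 "x + t *\<^sub>R (A x + B x)"] by (simp add: scaleR_2 algebra_simps)
    also have "\<dots> \<le> N (x + (2 * t) *\<^sub>R A x) + N (x + (2 * t) *\<^sub>R B x)" by (rule N_triangle)
    also have "\<dots> \<le> 2 * N x + 2 * \<epsilon> * \<bar>t\<bar>"
      using d(3)[of "2 * t"] d(4)[of "2 * t"] that by (auto simp: abs_mult)
    finally show ?thesis by simp
  qed
  then show "\<exists>\<delta>>0. \<forall>t. \<bar>t\<bar> < \<delta> \<longrightarrow> N (x + t *\<^sub>R (A x + B x)) \<le> N x + \<epsilon> * \<bar>t\<bar>"
    using d(1,2) by (intro exI[of _ "min d1 d2 / 2"]) auto
qed

lemma skew_scale:
  assumes "skew A" shows "skew (\<lambda>x. c *\<^sub>R A x)"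
  unfolding skew_def
proof (intro allI impI)
  fix x and \<epsilon> :: real assume e: "\<epsilon> > 0"
  then have "\<epsilon> / (\<bar>c\<bar> + 1) > 0" by simp
  then obtain d where d: "d > 0" "\<And>t. \<bar>t\<bar> < d \<Longrightarrow> N (x + t *\<^sub>R A x) \<le> N x + \<epsilon> / (\<bar>c\<bar> + 1) * \<bar>t\<bar>"
    using assms unfolding skew_def by blast
  have "N (x + t *\<^sub>R c *\<^sub>R A x) \<le> N x + \<epsilon> * \<bar>t\<bar>" if "\<bar>t\<bar> < d / (\<bar>c\<bar> + 1)" for t
  proof -
    have "\<bar>t\<bar> * (\<bar>c\<bar> + 1) < d" using that by (simp add: pos_less_divide_eq)
    then have "\<bar>t * c\<bar> < d" by (simp add: abs_mult distrib_left)
    from d(2)[OF this] have "N (x + t *\<^sub>R c *\<^sub>R A x) \<le> N x + \<epsilon> / (\<bar>c\<bar> + 1) * (\<bar>t\<bar> * \<bar>c\<bar>)"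
      by (simp add: abs_mult)
    also have "\<epsilon> / (\<bar>c\<bar> + 1) * (\<bar>t\<bar> * \<bar>c\<bar>) \<le> \<epsilon> / (\<bar>c\<bar> + 1) * (\<bar>t\<bar> * (\<bar>c\<bar> + 1))"
      using e by (intro mult_left_mono) auto
    also have "\<dots> = \<epsilon> * \<bar>t\<bar>" by simp
    finally show ?thesis by simp
  qed
  then show "\<exists>\<delta>>0. \<forall>t. \<bar>t\<bar> < \<delta> \<longrightarrow> N (x + t *\<^sub>R c *\<^sub>R A x) \<le> N x + \<epsilon> * \<bar>t\<bar>"
    using d(1) by (intro exI[of _ "d / (\<bar>c\<bar> + 1)"]) auto
qed

lemma skew_diff: "skew A \<Longrightarrow> skew B \<Longrightarrow> skew (\<lambda>x. A x - B x)"
  using skew_add[of A "\<lambda>x. (-1) *\<^sub>R B x"] skew_scale[of B "-1"] by simp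

lemma skew_conj:
  assumes "skew A" "linear u" "\<And>x. N (u x) = N x" "\<And>x. u (v x) = x"
  shows "skew (\<lambda>x. u (A (v x)))"
  unfolding skew_def
proof (intro allI impI)
  fix x and \<epsilon> :: real assume e: "\<epsilon> > 0"
  have "N (x + t *\<^sub>R u (A (v x))) = N (v x + t *\<^sub>R A (v x))" for t
    using assms(3)[of "v x + t *\<^sub>R A (v x)"]
    by (simp add: linear_add[OF assms(2)] linear_scale[OF assms(2)] assms(4))
  moreover have "N (v x) = N x" using assms(3)[of "v x"] assms(4) by simp
  moreover obtain \<delta> where "\<delta> > 0" "\<forall>t. \<bar>t\<bar> < \<delta> \<longrightarrow> N (v x + t *\<^sub>R A (v x)) \<le> N (v x) + \<epsilon> * \<bar>t\<bar>"
    using assms(1) e unfolding skew_def by blast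
  ultimately show "\<exists>\<delta>>0. \<forall>t. \<bar>t\<bar> < \<delta> \<longrightarrow> N (x + t *\<^sub>R u (A (v x))) \<le> N x + \<epsilon> * \<bar>t\<bar>"
    by auto
qed

text \<open>The curve agrees with its tangent up to \<open>o(h)\<close>, \<open>N\<close> is
  Lipschitz, and along the tangent direction \<open>A (z t)\<close> it changes by
  \<open>o(h)\<close> only, so the composite has derivative 0. Integral curves are written down by
  hand wherever this is used.\<close>

lemma skew_flow_invariant:
  assumes "skew A" and z: "\<And>t. (z has_vector_derivative A (z t)) (at t)"
  shows "N (z s) = N (z t)"
proof -
  obtain C where C: "C > 0" "\<And>x. N x \<le> C * norm x" by (rule N_bound) blast
  have "((\<lambda>t. N (z t)) has_real_derivative 0) (at t)" for t
    unfolding DERIV_def tendsto_iff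
  proof (intro allI impI)
    fix \<epsilon> :: real assume e: "\<epsilon> > 0"
    then obtain d where d: "d > 0"
      "\<And>h. \<bar>h\<bar> < d \<Longrightarrow> \<bar>N (z t + h *\<^sub>R A (z t)) - N (z t)\<bar> \<le> \<epsilon> / 3 * \<bar>h\<bar>"
      using skewE[OF assms(1), of "\<epsilon> / 3" "z t"] by auto
    have "\<epsilon> / (3 * C) > 0" using e C by simp
    then obtain d' where d': "d' > 0" "\<And>h. \<bar>h\<bar> < d' \<Longrightarrow>
        norm (z (t + h) - z t - h *\<^sub>R A (z t)) \<le> \<epsilon> / (3 * C) * \<bar>h\<bar>"
    proof -
      have "\<exists>d'>0. \<forall>y. norm (y - t) < d' \<longrightarrow> norm (z y - z t - (y - t) *\<^sub>R A (z t)) \<le> \<epsilon> / (3 * C) * norm (y - t)"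
        using z[of t] \<open>\<epsilon> / (3 * C) > 0\<close> unfolding has_vector_derivative_def has_derivative_at_alt by blast
      then obtain d' where "d' > 0"
        "\<And>y. norm (y - t) < d' \<Longrightarrow> norm (z y - z t - (y - t) *\<^sub>R A (z t)) \<le> \<epsilon> / (3 * C) * norm (y - t)"
        by blast
      from this(1) this(2)[of "t + _"] show ?thesis using that[of d'] by simp
    qed
    have "dist ((N (z (t + h)) - N (z t)) / h) 0 < \<epsilon>" if h: "h \<noteq> 0" "\<bar>h\<bar> < min d d'" for h
    proof -
      let ?y = "z t + h *\<^sub>R A (z t)"
      have "\<bar>N (z (t + h)) - N ?y\<bar> \<le> N (z (t + h) - ?y)"
        using N_diff_le[of "z (t + h)" ?y] N_diff_le[of ?y "z (t + h)"] N_minus[of "z (t + h) - ?y"]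
        by (simp add: abs_le_iff)
      also have "\<dots> \<le> C * norm (z (t + h) - ?y)" by (rule C(2))
      also have "\<dots> \<le> C * (\<epsilon> / (3 * C) * \<bar>h\<bar>)"
        using d'(2)[of h] h C(1) by (intro mult_left_mono) (auto simp: algebra_simps)
      also have "\<dots> = \<epsilon> / 3 * \<bar>h\<bar>" using C by simp
      finally have "\<bar>N (z (t + h)) - N ?y\<bar> \<le> \<epsilon> / 3 * \<bar>h\<bar>" .
      moreover have "\<bar>N ?y - N (z t)\<bar> \<le> \<epsilon> / 3 * \<bar>h\<bar>" using d(2)[of h] h by simp
      ultimately have "\<bar>N (z (t + h)) - N (z t)\<bar> \<le> \<epsilon> / 3 * \<bar>h\<bar> + \<epsilon> / 3 * \<bar>h\<bar>" by linarith
      then have "\<bar>N (z (t + h)) - N (z t)\<bar> \<le> 2 * \<epsilon> / 3 * \<bar>h\<bar>" by simp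
      then have "\<bar>(N (z (t + h)) - N (z t)) / h\<bar> \<le> 2 * \<epsilon> / 3" using h by (simp add: field_simps)
      also have "\<dots> < \<epsilon>" using e by simp
      finally show ?thesis by (simp add: dist_real_def)
    qed
    then show "\<forall>\<^sub>F h in at 0. dist ((N (z (t + h)) - N (z t)) / h) 0 < \<epsilon>"
      unfolding eventually_at using d(1) d'(1) by (intro exI[of _ "min d d'"]) auto
  qed
  then show ?thesis using DERIV_isconst_all[of "\<lambda>t. N (z t)"] by blast
qed

abbreviation refl_coord :: "'i \<Rightarrow> 'a \<Rightarrow> 'a" where
  "refl_coord i x \<equiv> x - (2 * \<phi> i x) *\<^sub>R e i"

lemma linear_refl_coord: "linear (refl_coord i)"
  by (rule linearI) (simp_all add: coord_simps algebra_simps)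

lemma refl_coord_refl_coord: "refl_coord i (refl_coord i x) = x"
  by (simp add: coord_simps algebra_simps)

lemma skew_refl_diff: "skew A \<Longrightarrow> skew (\<lambda>x. A x - refl_coord i (A (refl_coord i x)))"
  by (rule skew_diff, assumption)
     (rule skew_conj[where u = "refl_coord i" and v = "refl_coord i"],
      simp_all only: linear_refl_coord refl_coord_refl_coord sign_change)

text \<open>Comparing \<open>A\<close> with its conjugates under two sign changes isolates a pair of matrix entries.\<close>

lemma skew_entries:
  assumes A: "linear A" "skew A" and ij: "i \<noteq> j"
  shows "skew (\<lambda>x. (\<phi> i (A (e j)) * \<phi> j x) *\<^sub>R e i + (\<phi> j (A (e i)) * \<phi> i x) *\<^sub>R e j)"
proof -
  \<comment> \<open>Conjugation by the sign change at \<open>i\<close> flips the entries with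
    exactly one index equal to \<open>i\<close>, so the difference doubles these and deletes all
    others. Doing this for \<open>i\<close> and \<open>j\<close> leaves the entries
    \<open>(i, j)\<close> and \<open>(j, i)\<close>, four times too large.\<close>
  have "skew (\<lambda>x. (1/4) *\<^sub>R ((A x - refl_coord i (A (refl_coord i x)))
     - refl_coord j (A (refl_coord j x) - refl_coord i (A (refl_coord i (refl_coord j x))))))"
    by (rule skew_scale) (rule skew_refl_diff[OF skew_refl_diff[OF A(2)]])
  also have "(\<lambda>x. (1/4) *\<^sub>R ((A x - refl_coord i (A (refl_coord i x)))
     - refl_coord j (A (refl_coord j x) - refl_coord i (A (refl_coord i (refl_coord j x))))))
    = (\<lambda>x. (\<phi> i (A (e j)) * \<phi> j x) *\<^sub>R e i + (\<phi> j (A (e i)) * \<phi> i x) *\<^sub>R e j)"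
    using ij by (intro ext) (simp add: coord_simps linear_add[OF A(1)] linear_diff[OF A(1)] linear_scale[OF A(1)] 
      scaleR_diff_right scaleR_diff_left algebra_simps)
  finally show ?thesis .
qed

text \<open>Sign invariance bounds coordinate \<open>p\<close> of a vector by its norm, because the
  vector minus its reflection is a multiple of \<open>e p\<close>. A nonzero diagonal entry would
  make the norm grow at full rate along \<open>A (e p)\<close>, while skewness allows no more than
  half that rate.\<close>

lemma skew_diag:
  assumes A: "skew A" shows "\<phi> p (A (e p)) = 0"
proof (rule ccontr)
  let ?a = "\<phi> p (A (e p))"
  assume a: "?a \<noteq> 0"
  then obtain d where d: "d > 0"
    "\<And>t. \<bar>t\<bar> < d \<Longrightarrow> \<bar>N (e p + t *\<^sub>R A (e p)) - N (e p)\<bar> \<le> \<bar>?a\<bar> / 2 * \<bar>t\<bar>"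
    using skewE[OF A, of "\<bar>?a\<bar> / 2" "e p"] by auto
  define t where "t = sgn ?a * d / 2"
  have t: "\<bar>t\<bar> = d / 2" "t * ?a = d / 2 * \<bar>?a\<bar>" using a d(1) by (cases "?a > 0"; simp add: t_def)+
  let ?y = "e p + t *\<^sub>R A (e p)"
  have "refl_coord p ?y = refl_coord p (e p) + t *\<^sub>R (refl_coord p (A (e p)))"
    by (simp add: coord_simps algebra_simps)
  have eq: "?y + (- refl_coord p ?y) = (2 * (1 + t * ?a)) *\<^sub>R e p"
    by (simp add: coord_simps algebra_simps scaleR_2)
  have "N (?y + (- refl_coord p ?y)) = 2 * \<bar>1 + t * ?a\<bar>"
    unfolding eq N_scale normalised abs_mult by simp
  moreover have "N (?y + (- refl_coord p ?y)) \<le> N ?y + N ?y"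
    using N_triangle[of ?y "- refl_coord p ?y"] by (simp only: N_minus sign_change)
  ultimately have "2 * \<bar>1 + t * ?a\<bar> \<le> 2 * N ?y" by linarith
  moreover have "N ?y \<le> 1 + \<bar>?a\<bar> / 2 * (d / 2)"
    using d(2)[of t] d(1) t(1) unfolding normalised abs_le_iff by simp
  moreover have "0 < d / 2 * \<bar>?a\<bar>" using a d(1) by simp
  ultimately show False unfolding t(2) by (simp add: mult.commute[of _ d])
qed

text \<open>The flow through \<open>e j\<close> is the shear \<open>e j + t a e i\<close>, unbounded
  unless \<open>a\<close> vanishes; the parameter \<open>3 / a\<close> already gives norm at least
  2.\<close>

lemma skew_nilpotent:
  assumes "skew (\<lambda>x. (a * \<phi> j x) *\<^sub>R e i)" "i \<noteq> j" shows "a = 0"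
proof (rule ccontr)
  assume a: "a \<noteq> 0"
  have "N (e j + t *\<^sub>R a *\<^sub>R e i) = N (e j + 0 *\<^sub>R a *\<^sub>R e i)" for t
    by (rule skew_flow_invariant[OF assms(1)])
       (use assms(2) in \<open>auto intro!: derivative_eq_intros simp: coord_simps\<close>)
  from this[of "3 / a"] have "N (e j + 3 *\<^sub>R e i) = 1" using a by (simp add: normalised)
  moreover have "N (3 *\<^sub>R e i) - N (- e j) \<le> N (3 *\<^sub>R e i - (- e j))" by (rule N_diff_le)
  ultimately show False by (simp add: N_scale N_minus normalised add.commute)
qed

text \<open>The sign of \<open>a * b\<close> decides the type of the flow on the plane. If it is
  zero, the flow is a shear; if positive, there is an eigenvector with nonzero real eigenvalue,
  along which the norm grows; if negative, the flow runs along ellipses and its quarter turn takes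
  \<open>e j\<close> to a multiple of \<open>e i\<close>, with a factor of modulus 1 because both
  vectors are normalised.\<close>

lemma skew_antisym:
  assumes A: "skew (\<lambda>x. (a * \<phi> j x) *\<^sub>R e i + (b * \<phi> i x) *\<^sub>R e j)" (is "skew ?A") and ij: "i \<noteq> j"
  shows "a = - b"
proof -
  consider "a = 0" | "b = 0" | "a * b > 0" | "a * b < 0" by (meson linorder_neqE mult_eq_0_iff)
  then show ?thesis
  proof cases
    case 1 with A show ?thesis using skew_nilpotent[of b i j] ij by simp
  next
    case 2 with A show ?thesis using skew_nilpotent[of a j i] ij by simp
  next
    case 3
    define x where "x = sqrt \<bar>a\<bar> *\<^sub>R e i + sqrt \<bar>b\<bar> *\<^sub>R e j"
    define m where "m = sgn a * sqrt (\<bar>a\<bar> * \<bar>b\<bar>)"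
    have ab: "a \<noteq> 0" "b \<noteq> 0" "sgn b = sgn a" using 3 by (auto simp: sgn_if zero_less_mult_iff)
    have "a * sqrt \<bar>b\<bar> = m * sqrt \<bar>a\<bar>" "b * sqrt \<bar>a\<bar> = m * sqrt \<bar>b\<bar>"
      using ab mult_sgn_abs[of a] mult_sgn_abs[of b] by (auto simp: m_def real_sqrt_mult)
    then have Ax: "?A x = m *\<^sub>R x"
      using ij by (simp add: x_def coord_simps scaleR_add_right)
    have "\<phi> i x \<noteq> 0" using ij ab by (simp add: x_def coord_simps)
    then have "x \<noteq> 0" by (auto simp: coord_simps)
    then have Nx: "N x > 0" using N_nonneg[of x] N_eq_0[of x] by linarith
    have m: "m \<noteq> 0" using ab by (simp add: m_def sgn_eq_0_iff)
    with Nx have "\<bar>m\<bar> * N x / 2 > 0" by simp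
    then obtain d where d: "d > 0"
      "\<And>t. \<bar>t\<bar> < d \<Longrightarrow> \<bar>N (x + t *\<^sub>R ?A x) - N x\<bar> \<le> \<bar>m\<bar> * N x / 2 * \<bar>t\<bar>"
      using skewE[OF A, of "\<bar>m\<bar> * N x / 2" x] by blast
    define t where "t = sgn m * d / 2"
    have t: "\<bar>t\<bar> = d / 2" "t * m = d / 2 * \<bar>m\<bar>" using m d(1) by (cases "m > 0"; simp add: t_def)+
    have "x + t *\<^sub>R ?A x = (1 + t * m) *\<^sub>R x" unfolding Ax by (simp add: algebra_simps)
    then have "N (x + t *\<^sub>R ?A x) = (1 + d / 2 * \<bar>m\<bar>) * N x"
      using d(1) by (simp add: N_scale t)
    then have "N (x + t *\<^sub>R ?A x) - N x = d / 2 * \<bar>m\<bar> * N x" by (simp add: algebra_simps)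
    moreover have "\<bar>N (x + t *\<^sub>R ?A x) - N x\<bar> \<le> \<bar>m\<bar> * N x / 2 * (d / 2)"
      using d(2)[of t] d(1) t(1) by simp
    ultimately have "d / 2 * \<bar>m\<bar> * N x \<le> \<bar>m\<bar> * N x / 2 * (d / 2)" by linarith
    moreover have "0 < d * (\<bar>m\<bar> * N x)" using d(1) m Nx by simp
    ultimately show ?thesis by (simp add: algebra_simps)
  next
    case 4
    define w where "w = sqrt (- (a * b))"
    have w: "w > 0" "w * w = - (a * b)" using 4 by (auto simp: w_def)
    define z where "z t = cos (w * t) *\<^sub>R e j + (a / w * sin (w * t)) *\<^sub>R e i" for t
    have "(z has_vector_derivative ?A (z t)) (at t)" for t
    proof -
      have "(z has_vector_derivative (- sin (w * t) * w) *\<^sub>R e j + (a / w * (cos (w * t) * w)) *\<^sub>R e i) (at t)"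
        unfolding z_def by (auto intro!: derivative_eq_intros simp: has_real_derivative_iff_has_vector_derivative[symmetric])
      moreover have "\<phi> j (z t) = cos (w * t)" "\<phi> i (z t) = a / w * sin (w * t)"
        using ij by (simp_all add: z_def coord_simps)
      moreover have "b * (a / w * sin (w * t)) = - sin (w * t) * w"
      proof -
        have "b * (a / w * sin (w * t)) = a * b / w * sin (w * t)" by simp
        also have "a * b = - (w * w)" using w(2) by simp
        finally show ?thesis using w(1) by simp
      qed
      moreover have "a / w * (cos (w * t) * w) = a * cos (w * t)" using w(1) by simp
      ultimately show ?thesis by (simp only: add.commute)
    qed
    from skew_flow_invariant[OF A this, of "pi / 2 / w" 0] have "\<bar>a\<bar> = w"
      using w(1) by (simp add: z_def N_scale normalised)
    then have "a * a = - (a * b)" using w(2) by (metis abs_mult_self_eq)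
    then have "a * (a + b) = 0" by (simp add: distrib_left)
    then show ?thesis using 4 by auto
  qed
qed

section \<open>Rotational symmetry as an equivalence relation on coordinates\<close>

definition rel :: "'i \<Rightarrow> 'i \<Rightarrow> bool" where
  "rel i j \<longleftrightarrow> i = j \<or> skew (\<lambda>x. \<phi> j x *\<^sub>R e i - \<phi> i x *\<^sub>R e j)"

lemma skew_entries_antisym:
  assumes A: "linear A" "skew A"
  shows "\<phi> p (A (e q)) = - \<phi> q (A (e p))"
proof (cases "p = q")
  case True then show ?thesis using skew_diag[OF A(2), of p] by simp
next
  case False show ?thesis by (rule skew_antisym[OF skew_entries[OF A False] False])
qed

lemma rel_if_skew:
  assumes A: "linear A" "skew A" and "\<phi> p (A (e q)) \<noteq> 0"
  shows "rel p q"
proof (cases "p = q")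
  case False
  let ?a = "\<phi> p (A (e q))"
  have "skew (\<lambda>x. (1 / ?a) *\<^sub>R ((?a * \<phi> q x) *\<^sub>R e p + ((- ?a) * \<phi> p x) *\<^sub>R e q))"
    by (rule skew_scale)
       (use skew_entries[OF A False] skew_entries_antisym[OF A, of p q] in simp)
  then show ?thesis using assms(3) by (simp add: rel_def scaleR_diff_right)
qed (simp add: rel_def)

lemma rel_refl [simp]: "rel i i" by (simp add: rel_def)

lemma rel_sym: "rel i j \<Longrightarrow> rel j i"
  using skew_scale[of "\<lambda>x. \<phi> j x *\<^sub>R e i - \<phi> i x *\<^sub>R e j" "-1"] by (auto simp: rel_def scaleR_diff_right)

text \<open>Relatedness speaks about the generator; this is its integrated form, with the orbit of
  \<open>x\<close> written out. A pair \<open>c, s\<close> instead of an angle lets applications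
  prescribe the direction of the rotated vector.\<close>

lemma rotation_invariant:
  assumes "rel i j" "i \<noteq> j" "c\<^sup>2 + s\<^sup>2 = 1"
  shows "N (x + (c - 1) *\<^sub>R (\<phi> i x *\<^sub>R e i + \<phi> j x *\<^sub>R e j) + s *\<^sub>R (\<phi> j x *\<^sub>R e i - \<phi> i x *\<^sub>R e j)) = N x"
proof -
  obtain t where t: "c = cos t" "s = sin t" using sincos_total_2pi[OF assms(3)] by metis
  have A: "skew (\<lambda>x. \<phi> j x *\<^sub>R e i - \<phi> i x *\<^sub>R e j)" using assms by (simp add: rel_def)
  define z where "z t = x + (cos t - 1) *\<^sub>R (\<phi> i x *\<^sub>R e i + \<phi> j x *\<^sub>R e j)
     + sin t *\<^sub>R (\<phi> j x *\<^sub>R e i - \<phi> i x *\<^sub>R e j)" for t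
  have "(z has_vector_derivative \<phi> j (z t) *\<^sub>R e i - \<phi> i (z t) *\<^sub>R e j) (at t)" for t
  proof -
    have "(z has_vector_derivative (- sin t) *\<^sub>R (\<phi> i x *\<^sub>R e i + \<phi> j x *\<^sub>R e j)
       + cos t *\<^sub>R (\<phi> j x *\<^sub>R e i - \<phi> i x *\<^sub>R e j)) (at t)"
      unfolding z_def by (auto intro!: derivative_eq_intros simp: has_real_derivative_iff_has_vector_derivative[symmetric])
    then show ?thesis using assms(2) by (simp add: z_def coord_simps algebra_simps)
  qed
  from skew_flow_invariant[OF A this, of t 0] show ?thesis by (simp add: z_def t)
qed

abbreviation swap :: "'i \<Rightarrow> 'i \<Rightarrow> 'a \<Rightarrow> 'a" where
  "swap i j x \<equiv> x + (\<phi> j x - \<phi> i x) *\<^sub>R (e i - e j)"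

lemma linear_swap: "linear (swap i j)"
  by (rule linearI) (simp_all add: coord_simps algebra_simps)

lemma swap_swap: "swap i j (swap i j x) = x"
  by (simp add: coord_simps algebra_simps)

text \<open>A swap is the quarter turn (\<open>c = 0\<close>, \<open>s = 1\<close>) followed by the
  sign change at \<open>j\<close>.\<close>

lemma swap_invariant:
  assumes "rel i j" shows "N (swap i j x) = N x"
proof (cases "i = j")
  case False
  define y where "y = x + (0 - 1) *\<^sub>R (\<phi> i x *\<^sub>R e i + \<phi> j x *\<^sub>R e j) + 1 *\<^sub>R (\<phi> j x *\<^sub>R e i - \<phi> i x *\<^sub>R e j)"
  have "\<phi> j y = - \<phi> i x" using False by (simp add: y_def coord_simps)
  then have "refl_coord j y = y + (2 * \<phi> i x) *\<^sub>R e j" by simp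
  also have "(2 * \<phi> i x) *\<^sub>R e j = \<phi> i x *\<^sub>R e j + \<phi> i x *\<^sub>R e j"
    by (metis mult_2 scaleR_left_distrib)
  also have "y + \<dots> = swap i j x"
    by (simp add: y_def algebra_simps)
  finally have "N (swap i j x) = N y" using sign_change[of y j] by (simp only:)
  also have "\<dots> = N x" unfolding y_def by (rule rotation_invariant[OF assms False]) simp
  finally show ?thesis .
qed simp

text \<open>Conjugation by the swap of \<open>i\<close> and \<open>j\<close>, an isometry since
  these are related, turns the generator for \<open>j, k\<close> into the one for
  \<open>i, k\<close>.\<close>

lemma rel_trans:
  assumes "rel i j" "rel j k" shows "rel i k"
proof (cases "i = j \<or> j = k \<or> i = k")
  case False
  then have "skew (\<lambda>x. \<phi> k x *\<^sub>R e j - \<phi> j x *\<^sub>R e k)" using assms(2) by (simp add: rel_def)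
  then have "skew (\<lambda>x. swap i j (\<phi> k (swap i j x) *\<^sub>R e j - \<phi> j (swap i j x) *\<^sub>R e k))"
    by (rule skew_conj[where u = "swap i j" and v = "swap i j"])
       (simp_all only: linear_swap swap_swap swap_invariant[OF assms(1)])
  moreover have "(\<lambda>x. swap i j (\<phi> k (swap i j x) *\<^sub>R e j - \<phi> j (swap i j x) *\<^sub>R e k))
      = (\<lambda>x. \<phi> k x *\<^sub>R e i - \<phi> i x *\<^sub>R e k)"
    using False by (intro ext) (auto simp: coord_simps algebra_simps)
  ultimately show ?thesis by (simp add: rel_def)
qed (use assms in auto)

text \<open>A rotation in the plane of \<open>e i\<close> and \<open>e j\<close> merges the
  coefficients \<open>r\<close> and \<open>a j\<close> into their Euclidean length \<rho> at
  \<open>e i\<close>; repetition absorbs all of \<open>A\<close>. The index \<open>i\<close> is kept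
  outside \<open>A\<close> to serve as accumulator.\<close>

lemma N_eq_l2_aux:
  assumes "finite A" "i \<notin> A" "\<And>j. j \<in> A \<Longrightarrow> rel i j"
  shows "N (r *\<^sub>R e i + (\<Sum>j\<in>A. a j *\<^sub>R e j)) = sqrt (r\<^sup>2 + (\<Sum>j\<in>A. (a j)\<^sup>2))"
  using assms
proof (induction A arbitrary: r rule: finite_induct)
  case empty
  then show ?case by (simp add: N_scale normalised)
next
  case (insert j A)
  define \<rho> where "\<rho> = sqrt (r\<^sup>2 + (a j)\<^sup>2)"
  define x where "x = r *\<^sub>R e i + (\<Sum>j\<in>insert j A. a j *\<^sub>R e j)"
  have ij: "i \<noteq> j" "i \<notin> A" "j \<notin> A" using insert by auto
  have x: "\<phi> i x = r" "\<phi> j x = a j"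
    using ij insert(1) by (simp_all add: x_def coord_simps if_distrib sum.delta' cong: if_cong)
  show ?case
  proof (cases "\<rho> = 0")
    case True
    then have "r\<^sup>2 + (a j)\<^sup>2 = 0" by (simp add: \<rho>_def)
    then have "r = 0" "a j = 0" by (simp_all add: sum_power2_eq_zero_iff)
    then show ?thesis using insert.IH[of 0] insert.hyps ij insert.prems by simp
  next
    case False
    define c s where "c = r / \<rho>" and "s = a j / \<rho>"
    have \<rho>2: "\<rho>\<^sup>2 = r\<^sup>2 + (a j)\<^sup>2" by (simp add: \<rho>_def)
    have "r\<^sup>2 + (a j)\<^sup>2 \<noteq> 0" using False by (simp add: \<rho>_def)
    then have cs: "c\<^sup>2 + s\<^sup>2 = 1"
      unfolding c_def s_def power_divide add_divide_distrib[symmetric] \<rho>2 by (rule divide_self)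
    have "c * r + s * a j = \<rho>" "c * a j = s * r"
      using False \<rho>2 by (simp_all add: c_def s_def field_simps power2_eq_square)
    moreover have "x + (c - 1) *\<^sub>R (\<phi> i x *\<^sub>R e i + \<phi> j x *\<^sub>R e j) + s *\<^sub>R (\<phi> j x *\<^sub>R e i - \<phi> i x *\<^sub>R e j)
        = (c * r + s * a j) *\<^sub>R e i + (c * a j - s * r) *\<^sub>R e j + (\<Sum>j\<in>A. a j *\<^sub>R e j)"
      unfolding x using ij insert(1) by (simp add: x_def algebra_simps)
    ultimately have "x + (c - 1) *\<^sub>R (\<phi> i x *\<^sub>R e i + \<phi> j x *\<^sub>R e j) + s *\<^sub>R (\<phi> j x *\<^sub>R e i - \<phi> i x *\<^sub>R e j)
        = \<rho> *\<^sub>R e i + (\<Sum>j\<in>A. a j *\<^sub>R e j)" by simp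
    then have "N x = N (\<rho> *\<^sub>R e i + (\<Sum>j\<in>A. a j *\<^sub>R e j))"
      using rotation_invariant[OF _ ij(1) cs, of x] insert(5) by simp
    also have "\<dots> = sqrt (\<rho>\<^sup>2 + (\<Sum>j\<in>A. (a j)\<^sup>2))" using insert by simp
    finally show ?thesis using insert(1) ij by (simp add: x_def \<rho>2 add.assoc)
  qed
qed

lemma N_eq_l2:
  assumes "finite A" "\<And>j. j \<in> A \<Longrightarrow> rel i j"
  shows "N (\<Sum>j\<in>A. a j *\<^sub>R e j) = sqrt (\<Sum>j\<in>A. (a j)\<^sup>2)"
proof (cases "A = {}")
  case True then show ?thesis using N_eq_0[of 0] by simp
next
  case False
  then obtain k where k: "k \<in> A" by blast
  then have "rel k j" if "j \<in> A" for j using assms(2) that rel_sym rel_trans by blast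
  then show ?thesis using N_eq_l2_aux[of "A - {k}" k "a k" a] assms(1) k by (simp add: sum.remove)
qed

end

section \<open>Isometries and classes of coordinates\<close>

lemma linear_blinfun_apply: "linear (blinfun_apply g)"
  by (simp add: blinfun.bounded_linear_right bounded_linear.linear)

text \<open>The hypotheses put both \<open>(u, u')\<close> and \<open>(v, v')\<close> on the line
  orthogonal to the nonzero vector \<open>(b, -b')\<close>.\<close>

lemma parallel_transitive:
  fixes b b' u u' v v' :: real
  assumes 1: "b * u = b' * u'" and 2: "b * v = b' * v'" and 3: "\<not> (b = 0 \<and> b' = 0)"
  shows "u * v' = u' * v"
proof -
  have "b * (u * v') = b' * u' * v'" using 1 by (metis mult.assoc)
  also have "\<dots> = u' * (b' * v')" by simp
  also have "\<dots> = b * (u' * v)" using 2 by simp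
  finally have A: "b * (u * v') = b * (u' * v)" .
  have "b' * (u * v') = u * (b' * v')" by simp
  also have "\<dots> = b * u * v" using 2 by simp
  also have "\<dots> = b' * (u' * v)" using 1 by simp
  finally show ?thesis using A 3 by auto
qed

context unconditional_norm
begin

lemma isometry_inverse:
  assumes "g \<in> isometry_group N"
  obtains h where "h \<in> isometry_group N" "\<And>x. blinfun_apply g (blinfun_apply h x) = x"
    "\<And>x. blinfun_apply h (blinfun_apply g x) = x"
proof -
  have "subgroup (isometry_group N) GL"
    using isometry_group_bounded_subgroup[OF equivalent] by (simp add: bounded_subgroup_def)
  then have "g \<in> carrier GL" using subgroup.subset assms by blast
  then obtain h where h: "g o\<^sub>L h = id_blinfun" "h o\<^sub>L g = id_blinfun" by (auto simp: GL_def)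
  have gh: "blinfun_apply g (blinfun_apply h x) = x" "blinfun_apply h (blinfun_apply g x) = x" for x
    using h[THEN arg_cong[of _ _ "\<lambda>f. blinfun_apply f x"]] by simp_all
  have "N (blinfun_apply h x) = N x" for x
    using assms gh(1)[of x] by (auto simp: isometry_group_def dest: spec[of _ "blinfun_apply h x"])
  then have "h \<in> isometry_group N" using surjI[of "blinfun_apply h", OF gh(2)] by (simp add: isometry_group_def)
  with gh show ?thesis using that by blast
qed

lemma zero_if_zero_on_basis:
  assumes "bounded_linear f" "\<And>q. f (e q) = 0" shows "f x = (0 :: real)"
proof -
  have l: "linear f" using assms(1) by (rule bounded_linear.linear)
  have "f y = 0" if "y \<in> span (range e)" for y
    using that by (induction rule: span_induct_alt)
      (auto simp: linear_0[OF l] linear_add[OF l] linear_scale[OF l] assms(2))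
  then have "span (range e) \<subseteq> {x. f x = 0}" by blast
  moreover have "closed {x. f x = 0}"
    using linear_continuous_on[OF assms(1), of UNIV] by (intro closed_Collect_eq) auto
  ultimately have "closure (span (range e)) \<subseteq> {x. f x = 0}" by (rule closure_minimal)
  then show ?thesis using dense_span by blast
qed

text \<open>If \<open>K\<close> generates the rotations of the plane of \<open>e i\<close> and \<open>e j\<close>, then \<open>g K g\<^sup>-\<^sup>1\<close> is skew as well, so its
  entries at unrelated pairs \<open>p, q\<close> vanish. These entries are 2x2 minors built from \<open>g\<close> and \<open>g\<^sup>-\<^sup>1\<close>.\<close>

lemma isometry_pair_rel:
  assumes g: "g \<in> isometry_group N" and ij: "rel i j" "i \<noteq> j"
    and p: "\<phi> p (blinfun_apply g (e i)) \<noteq> 0 \<or> \<phi> p (blinfun_apply g (e j)) \<noteq> 0"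
    and q: "\<phi> q (blinfun_apply g (e i)) \<noteq> 0 \<or> \<phi> q (blinfun_apply g (e j)) \<noteq> 0"
  shows "rel p q"
proof (rule ccontr)
  assume npq: "\<not> rel p q"
  obtain h where h: "h \<in> isometry_group N" "\<And>x. blinfun_apply g (blinfun_apply h x) = x"
    "\<And>x. blinfun_apply h (blinfun_apply g x) = x" using isometry_inverse[OF g] by blast
  define A where "A x = blinfun_apply g (\<phi> j (blinfun_apply h x) *\<^sub>R e i - \<phi> i (blinfun_apply h x) *\<^sub>R e j)" for x
  have A: "skew A"
    unfolding A_def
  proof (rule skew_conj[where u = "blinfun_apply g" and v = "blinfun_apply h"])
    show "skew (\<lambda>x. \<phi> j x *\<^sub>R e i - \<phi> i x *\<^sub>R e j)" using ij by (simp add: rel_def)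
    show "N (blinfun_apply g x) = N x" for x using g by (simp add: isometry_group_def)
  qed (simp_all add: h(2) linear_blinfun_apply)
  have lA: "linear A"
    by (rule linearI) (simp_all add: A_def coord_simps blinfun.add_right blinfun.diff_right
      blinfun.scaleR_right algebra_simps)
  define a a' b b' where "a p = \<phi> p (blinfun_apply g (e i))" "a' p = \<phi> p (blinfun_apply g (e j))"
    "b q = \<phi> j (blinfun_apply h (e q))" "b' q = \<phi> i (blinfun_apply h (e q))" for p q
  have entry: "\<phi> p (A (e q)) = b q * a p - b' q * a' p" for p q
    by (simp add: A_def a_a'_b_b'_def coord_simps blinfun.diff_right blinfun.scaleR_right)
  have anti: "b q * a p - b' q * a' p = - (b p * a q - b' p * a' q)" for p q
    using skew_entries_antisym[OF lA A, of p q] by (simp add: entry)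
  have zero: "b q * a p = b' q * a' p" if "\<not> rel p q" for p q
    using rel_if_skew[OF lA A, of p q] that by (auto simp: entry)
  \<comment> \<open>The relation extends by density from the basis to all vectors; evaluation at
    \<open>g (e j)\<close> and at \<open>g (e i)\<close> then kills both coefficients.\<close>
  have spanning: "a p = 0 \<and> a' p = 0" if "\<And>q. b q * a p = b' q * a' p" for p
  proof -
    have "\<phi> j (blinfun_apply h x) * a p - \<phi> i (blinfun_apply h x) * a' p = 0" for x
    proof (rule zero_if_zero_on_basis[where f = "\<lambda>x. \<phi> j (blinfun_apply h x) * a p - \<phi> i (blinfun_apply h x) * a' p"])
      have "bounded_linear (\<lambda>x. \<phi> k (blinfun_apply h x) * c)" for k c
        using bounded_linear_compose[OF bounded_linear_mult_left bounded_linear_compose[OF bounded_linear_coord blinfun.bounded_linear_right]] .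
      then show "bounded_linear (\<lambda>x. \<phi> j (blinfun_apply h x) * a p - \<phi> i (blinfun_apply h x) * a' p)"
        by (intro bounded_linear_sub)
      show "\<phi> j (blinfun_apply h (e q)) * a p - \<phi> i (blinfun_apply h (e q)) * a' p = 0" for q
        using that[of q] by (simp add: a_a'_b_b'_def)
    qed
    from this[of "blinfun_apply g (e j)"] this[of "blinfun_apply g (e i)"]
    show ?thesis using ij by (simp add: h(3) coord_simps)
  qed
  have ap: "\<not> (a p = 0 \<and> a' p = 0)" "\<not> (a q = 0 \<and> a' q = 0)"
    using p q by (simp_all add: a_a'_b_b'_def)
  have "\<not> (b p = 0 \<and> b' p = 0)"
  proof
    assume "b p = 0 \<and> b' p = 0"
    then have "b s * a p = b' s * a' p" for s using anti[of s p] by simp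
    then show False using spanning ap(1) by blast
  qed
  moreover have "b p * a p = b' p * a' p" using anti[of p p] by (simp add: mult.commute)
  moreover have "b p * a q = b' p * a' q" using zero npq rel_sym by blast
  ultimately have par: "a p * a' q = a' p * a q" using parallel_transitive by blast
  \<comment> \<open>No \<open>s\<close> is related to both \<open>p\<close> and \<open>q\<close>. If
    it is related to \<open>p\<close>, its entry with \<open>q\<close> vanishes, and proportionality
    of the coefficient pairs at \<open>p\<close> and \<open>q\<close> transfers this to
    \<open>p\<close>. So the whole row \<open>p\<close> vanishes, which \<open>spanning\<close>
    excludes.\<close>
  have "b s * a p = b' s * a' p" for s
  proof (cases "rel p s")
    case True
    then have "\<not> rel q s" using npq rel_trans rel_sym by blast
    then have "b s * a q = b' s * a' q" by (rule zero)
    then show ?thesis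
      using parallel_transitive[of "a q" "b s" "a' q" "b' s" "a' p" "a p"] par ap(2) by (simp add: mult.commute)
  qed (rule zero)
  then show False using spanning ap(1) by blast
qed

definition cls :: "'i \<Rightarrow> 'i set" where "cls i = {j. rel i j}"

lemma cls_eq: "rel i j \<Longrightarrow> cls i = cls j"
  using rel_trans[of i j] rel_trans[of j i] rel_sym[of i j] by (auto simp: cls_def)

lemma in_cls_iff: "rel q p \<Longrightarrow> p \<in> cls i \<longleftrightarrow> q \<in> cls i"
  using rel_trans[of i q p] rel_trans[of i p q] rel_sym[of q p] by (auto simp: cls_def)

lemma self_in_cls [simp]: "i \<in> cls i" by (simp add: cls_def)

lemma e_eq_iff [simp]: "e i = e j \<longleftrightarrow> i = j"
  using coord_basis[of i i] coord_basis[of i j] by (auto split: if_splits)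

lemma inj_e: "inj e" by (rule injI) simp

lemma e_nonzero: "e i \<noteq> 0"
  using N_eq_0 normalised[of i] by force

lemma independent_e: "independent (e ` A)"
proof -
  have "\<forall>x\<in>e ` A. x \<notin> span (e ` A - {x})"
  proof (safe)
    fix i assume i: "i \<in> A" "e i \<in> span (e ` A - {e i})"
    have "\<phi> i y = 0" if "y \<in> span (e ` A - {e i})" for y
      using that by (induction rule: span_induct_alt) (auto simp: coord_simps)
    from this[OF i(2)] show False by (simp add: coord_simps)
  qed
  then show ?thesis by (auto simp: dependent_def)
qed

lemma in_span_basis_iff:
  assumes "finite A"
  shows "x \<in> span (e ` A) \<longleftrightarrow> (\<forall>i. i \<notin> A \<longrightarrow> \<phi> i x = 0)"
proof
  assume "x \<in> span (e ` A)"
  then show "\<forall>i. i \<notin> A \<longrightarrow> \<phi> i x = 0"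
    by (induction rule: span_induct_alt) (auto simp: coord_simps split: if_splits)
next
  assume *: "\<forall>i. i \<notin> A \<longrightarrow> \<phi> i x = 0"
  have "x - (\<Sum>i\<in>A. \<phi> i x *\<^sub>R e i) = 0"
    by (rule coord_total) (use * assms in \<open>auto simp: coord_simps if_distrib sum.delta cong: if_cong\<close>)
  then have "x = (\<Sum>i\<in>A. \<phi> i x *\<^sub>R e i)" by simp
  also have "\<dots> \<in> span (e ` A)" by (intro span_sum span_scale span_base) auto
  finally show "x \<in> span (e ` A)" .
qed

lemma nonzero_coord: "x \<noteq> 0 \<Longrightarrow> \<exists>p. \<phi> p x \<noteq> 0"
  using coord_total by blast

end

section \<open>Finite classes of distinct sizes\<close>

locale block_norm = unconditional_norm +
  assumes finite_cls: "finite (cls i)"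
    and cls_nontrivial: "\<exists>j. rel i j \<and> i \<noteq> j"
    and card_cls_inj: "card (cls i) = card (cls j) \<Longrightarrow> cls i = cls j"
begin

lemma isometry_maps_cls:
  assumes g: "g \<in> isometry_group N"
  shows "\<exists>p. blinfun_apply g ` span (e ` cls i) \<subseteq> span (e ` cls p)"
proof -
  have "N (blinfun_apply g (e i)) = 1" using g normalised by (simp add: isometry_group_def)
  then have "blinfun_apply g (e i) \<noteq> 0" using N_eq_0 by force
  then obtain p where p: "\<phi> p (blinfun_apply g (e i)) \<noteq> 0" using nonzero_coord by blast
  have "blinfun_apply g (e j) \<in> span (e ` cls p)" if "j \<in> cls i" for j
    unfolding in_span_basis_iff[OF finite_cls]
  proof (intro allI impI, rule ccontr)
    fix q assume q: "q \<notin> cls p" "\<phi> q (blinfun_apply g (e j)) \<noteq> 0"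
    \<comment> \<open>For \<open>j = i\<close> a second index of the class is needed: only a pair
      carries a rotation that \<open>g\<close> can conjugate.\<close>
    obtain k where k: "rel i k" "i \<noteq> k" using cls_nontrivial by blast
    have "rel p q"
    proof (cases "i = j")
      case True then show ?thesis using isometry_pair_rel[OF g k] p q by blast
    next
      case False then show ?thesis using isometry_pair_rel[OF g _ False] p q that by (auto simp: cls_def)
    qed
    with q show False by (simp add: cls_def)
  qed
  then have "blinfun_apply g ` e ` cls i \<subseteq> span (e ` cls p)" by blast
  then have "span (blinfun_apply g ` e ` cls i) \<subseteq> span (e ` cls p)" 
    by (intro span_minimal subspace_span)
  then have "blinfun_apply g ` span (e ` cls i) \<subseteq> span (e ` cls p)"
    by (simp only: linear_span_image[OF linear_blinfun_apply])
  then show ?thesis by blast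
qed

lemma card_le_if_embedded:
  assumes "linear f" "\<And>x. f' (f x) = x" "f ` e ` cls i \<subseteq> span (e ` B)" "finite B"
  shows "card (cls i) \<le> card B"
proof -
  have "inj f" using assms(2) by (metis injI)
  then have "independent (f ` e ` cls i)"
    using assms(1) independent_e by (intro linear_independent_injective_image) (auto intro: inj_on_subset)
  from independent_span_bound[OF _ this assms(3)] assms(4)
  have "card (f ` e ` cls i) \<le> card (e ` B)" by auto
  moreover have "card (f ` e ` cls i) = card (cls i)"
    using \<open>inj f\<close> inj_e by (metis card_image inj_on_subset subset_UNIV)
  ultimately show ?thesis using card_image_le[OF assms(4), of e] by linarith
qed

text \<open>\<open>g\<close> embeds the span of \<open>cls i\<close> into that of some
  \<open>cls p\<close>, and its inverse embeds the latter back into the span of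
  \<open>cls i\<close>. The dimensions agree, and classes of equal size coincide.\<close>

lemma isometry_preserves_cls:
  assumes g: "g \<in> isometry_group N"
  shows "blinfun_apply g ` span (e ` cls i) \<subseteq> span (e ` cls i)"
proof -
  obtain h where h: "h \<in> isometry_group N" "\<And>x. blinfun_apply g (blinfun_apply h x) = x"
    "\<And>x. blinfun_apply h (blinfun_apply g x) = x" using isometry_inverse[OF g] by blast
  obtain p where p: "blinfun_apply g ` span (e ` cls i) \<subseteq> span (e ` cls p)"
    using isometry_maps_cls[OF g] by blast
  obtain q where q: "blinfun_apply h ` span (e ` cls p) \<subseteq> span (e ` cls q)"
    using isometry_maps_cls[OF h(1)] by blast
  have "e i \<in> span (e ` cls i)" by (intro span_base) auto
  with p q h(3) have "e i \<in> span (e ` cls q)" by (metis image_subset_iff)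
  then have "rel q i" unfolding in_span_basis_iff[OF finite_cls] by (auto simp: coord_simps cls_def)
  then have "cls q = cls i" by (rule cls_eq)
  have "card (cls i) \<le> card (cls p)"
    using p by (intro card_le_if_embedded[OF linear_blinfun_apply h(3) _ finite_cls]) (auto intro: span_base)
  moreover have "card (cls p) \<le> card (cls i)"
    using q \<open>cls q = cls i\<close> by (intro card_le_if_embedded[OF linear_blinfun_apply h(2) _ finite_cls]) (auto intro: span_base)
  ultimately have "cls i = cls p" by (intro card_cls_inj) simp
  then show ?thesis using p by simp
qed

lemma isometry_coord_zero:
  assumes "g \<in> isometry_group N" "\<not> rel i p"
  shows "\<phi> p (blinfun_apply g (e i)) = 0"
proof -
  have "e i \<in> span (e ` cls i)" by (rule span_base) simp
  then have "blinfun_apply g (e i) \<in> span (e ` cls i)"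
    using isometry_preserves_cls[OF assms(1), of i] by blast
  moreover have "p \<notin> cls i" using assms(2) by (simp add: cls_def)
  ultimately show ?thesis unfolding in_span_basis_iff[OF finite_cls] by blast
qed

definition proj :: "'b set \<Rightarrow> 'a \<Rightarrow> 'a" where
  "proj D x = (\<Sum>i\<in>D. \<phi> i x *\<^sub>R e i)"

lemma bounded_linear_proj: "bounded_linear (proj D)"
  unfolding proj_def
  by (intro bounded_linear_sum bounded_linear_compose[OF bounded_linear_scaleR_left bounded_linear_coord])

lemma coord_proj: "finite D \<Longrightarrow> \<phi> p (proj D x) = (if p \<in> D then \<phi> p x else 0)"
  by (simp add: proj_def coord_simps if_distrib sum.delta' cong: if_cong)

lemma proj_commute:
  assumes g: "g \<in> isometry_group N"
  shows "proj (cls i) (blinfun_apply g x) = blinfun_apply g (proj (cls i) x)"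
proof -
  have "\<phi> p (proj (cls i) (blinfun_apply g x) - blinfun_apply g (proj (cls i) x)) = 0" for p
  proof (rule zero_if_zero_on_basis[where f = "\<lambda>x. \<phi> p (proj (cls i) (blinfun_apply g x) - blinfun_apply g (proj (cls i) x))"])
    have "bounded_linear (\<lambda>x. proj (cls i) (blinfun_apply g x))"
      by (rule bounded_linear_compose[OF bounded_linear_proj blinfun.bounded_linear_right])
    moreover have "bounded_linear (\<lambda>x. blinfun_apply g (proj (cls i) x))"
      by (rule bounded_linear_compose[OF blinfun.bounded_linear_right bounded_linear_proj])
    ultimately show "bounded_linear (\<lambda>x. \<phi> p (proj (cls i) (blinfun_apply g x) - blinfun_apply g (proj (cls i) x)))"
      by (rule bounded_linear_compose[OF bounded_linear_coord bounded_linear_sub])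
    fix q
    have "proj (cls i) (e q) = (if q \<in> cls i then e q else 0)"
      using finite_cls[of i] by (simp add: proj_def coord_simps if_distrib[of "\<lambda>c. c *\<^sub>R _"] cong: if_cong)
    moreover have "p \<in> cls i \<longleftrightarrow> q \<in> cls i" if "\<phi> p (blinfun_apply g (e q)) \<noteq> 0"
      using in_cls_iff isometry_coord_zero[OF g] that by blast
    ultimately show "\<phi> p (proj (cls i) (blinfun_apply g (e q)) - blinfun_apply g (proj (cls i) (e q))) = 0"
      by (auto simp: coord_simps coord_proj[OF finite_cls])
  qed
  then show ?thesis using coord_total by (metis eq_iff_diff_eq_0)
qed

end

text \<open>An involution is its own inverse, which gives surjectivity; boundedness follows from
  invariance of an equivalent norm. So reflections and swaps, defined as plain functions, become
  members of the group.\<close>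

lemma involution_in_isometry_group:
  assumes "equivalent_norm N" "linear u" "\<And>x. N (u x) = N x" "\<And>x. u (u x) = x"
  shows "\<exists>g\<in>isometry_group N. blinfun_apply g = u"
proof -
  obtain c C where c: "c > 0" "C > 0" "\<And>x. c * norm x \<le> N x" "\<And>x. N x \<le> C * norm x"
    using assms(1) unfolding equivalent_norm_def by blast
  have "bounded_linear u"
  proof (rule bounded_linear_intro[where K = "C / c"])
    fix x
    have "c * norm (u x) \<le> C * norm x" using c(3)[of "u x"] c(4)[of x] by (simp add: assms(3))
    then show "norm (u x) \<le> norm x * (C / c)" using c(1) by (simp add: field_simps)
  qed (simp_all add: linear_add[OF assms(2)] linear_scale[OF assms(2)])
  then have B: "blinfun_apply (Blinfun u) = u" by (rule bounded_linear_Blinfun_apply)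
  have "Blinfun u \<in> isometry_group N"
    using surjI[of u u, OF assms(4)] by (simp add: isometry_group_def B assms(3))
  with B show ?thesis by blast
qed

context unconditional_norm
begin

text \<open>A vector minus its reflection at \<open>p\<close> is a multiple of \<open>e p\<close>,
  and swaps carry \<open>e p\<close> to the other basis vectors of its class. Invariant subspaces
  are a notion that survives conjugation, unlike the basis.\<close>

lemma invariant_subspace_contains_cls:
  assumes W: "subspace W" "\<And>g. g \<in> isometry_group N \<Longrightarrow> blinfun_apply g ` W \<subseteq> W"
    and w: "w \<in> W" "w \<noteq> 0"
  shows "\<exists>p. e ` cls p \<subseteq> W"
proof -
  obtain p where p: "\<phi> p w \<noteq> 0" using nonzero_coord[OF w(2)] by blast
  have "\<exists>s\<in>isometry_group N. blinfun_apply s = refl_coord p"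
    by (rule involution_in_isometry_group[OF equivalent])
       (rule linear_refl_coord sign_change refl_coord_refl_coord)+
  then obtain s where s: "s \<in> isometry_group N" "blinfun_apply s = refl_coord p" by blast
  have "refl_coord p w \<in> W" using W(2)[OF s(1)] w(1) s(2) by auto
  from subspace_scale[OF W(1) subspace_diff[OF W(1) w(1) this], of "1 / (2 * \<phi> p w)"]
  have ep: "e p \<in> W" using p by simp
  have "e q \<in> W" if "rel p q" for q
  proof (cases "p = q")
    case False
    have "\<exists>s\<in>isometry_group N. blinfun_apply s = swap p q"
      by (rule involution_in_isometry_group[OF equivalent])
         (rule linear_swap swap_invariant[OF that] swap_swap)+
    then obtain s where s: "s \<in> isometry_group N" "blinfun_apply s = swap p q" by blast
    have "swap p q (e p) \<in> W" using W(2)[OF s(1)] ep s(2) by (metis image_subset_iff)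
    then show ?thesis using False by (simp add: coord_simps)
  qed (use ep in simp)
  then show ?thesis by (auto simp: cls_def)
qed

end

context block_norm
begin

lemma N_proj: "(N (proj (cls i) x))\<^sup>2 = (\<Sum>j\<in>cls i. (\<phi> j x)\<^sup>2)"
  unfolding proj_def by (subst N_eq_l2[of _ i, OF finite_cls]) (auto simp: cls_def sum_nonneg)

text \<open>\<open>N\<close> is Euclidean on either class span, so \<open>q\<close> is the Euclidean
  norm on their sum and does not distinguish the two classes. Isometries of \<open>N\<close> commute
  with \<open>P1\<close> and \<open>P2\<close> and so preserve \<open>q\<close> and
  \<open>N (R x)\<close>. The swap of \<open>i1\<close> and \<open>i2\<close> preserves them too,
  but it takes \<open>e i1\<close> out of its class, which no isometry of \<open>N\<close>
  does.\<close>

theorem isometry_group_extends: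
  assumes "\<not> rel i1 i2"
  shows "\<exists>M. equivalent_norm M \<and> isometry_group N \<subset> isometry_group M"
proof -
  define P1 where "P1 = proj (cls i1)"
  define P2 where "P2 = proj (cls i2)"
  define R where "R x = x - P1 x - P2 x" for x
  have disj: "cls i1 \<inter> cls i2 = {}"
    using assms rel_trans[of i1 _ i2] rel_sym by (auto simp: cls_def)
  have P: "bounded_linear P1" "bounded_linear P2" unfolding P1_def P2_def by (rule bounded_linear_proj)+
  then have lP: "linear P1" "linear P2" by (auto intro: bounded_linear.linear)
  define q where "q x = sqrt ((N (P1 x))\<^sup>2 + (N (P2 x))\<^sup>2)" for x
  define M where "M x = max (q x) (N (R x))" for x
  have q_le: "q x \<le> N (P1 x) + N (P2 x)" for x
    unfolding q_def by (rule sqrt_sum_squares_le_sum) (rule N_nonneg)+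
  have q_ge: "N (P1 x) \<le> q x" "N (P2 x) \<le> q x" for x
    unfolding q_def by (rule real_sqrt_sum_squares_ge1 real_sqrt_sum_squares_ge2)+
  have N_le: "N x \<le> 3 * M x" for x
  proof -
    have "N x \<le> N (P1 x + P2 x) + N (R x)" using N_triangle[of "P1 x + P2 x" "R x"] by (simp add: R_def)
    also have "\<dots> \<le> N (P1 x) + N (P2 x) + N (R x)" using N_triangle[of "P1 x" "P2 x"] by simp
    also have "\<dots> \<le> 3 * M x" using q_ge[of x] by (simp add: M_def)
    finally show ?thesis .
  qed
  have nrm: "is_norm M"
    unfolding is_norm_def
  proof (intro conjI allI)
    fix x y :: 'a and a :: real
    show M0: "0 \<le> M x" for x using N_nonneg[of "R x"] by (simp add: M_def)
    have "x = 0" if "M x = 0" using N_le[of x] N_nonneg[of x] N_eq_0[of x] that by simp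
    moreover have "M 0 = 0" using N_eq_0[of 0] by (simp add: M_def q_def R_def linear_0[OF lP(1)] linear_0[OF lP(2)])
    ultimately show "M x = 0 \<longleftrightarrow> x = 0" by blast
    have "q (x + y) \<le> sqrt ((N (P1 x) + N (P1 y))\<^sup>2 + (N (P2 x) + N (P2 y))\<^sup>2)"
      unfolding q_def linear_add[OF lP(1)] linear_add[OF lP(2)]
      by (intro real_sqrt_le_mono add_mono power_mono N_triangle N_nonneg)
    also have "\<dots> \<le> q x + q y" unfolding q_def by (rule real_sqrt_sum_squares_triangle_ineq)
    finally have "q (x + y) \<le> q x + q y" .
    moreover have "N (R (x + y)) \<le> N (R x) + N (R y)"
      using N_triangle[of "R x" "R y"] by (simp add: R_def linear_add[OF lP(1)] linear_add[OF lP(2)] algebra_simps)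
    ultimately show "M (x + y) \<le> M x + M y" by (auto simp: M_def)
    have "R (a *\<^sub>R x) = a *\<^sub>R R x" by (simp add: R_def linear_scale[OF lP(1)] linear_scale[OF lP(2)] algebra_simps)
    moreover have "q (a *\<^sub>R x) = \<bar>a\<bar> * q x"
      by (simp add: q_def linear_scale[OF lP(1)] linear_scale[OF lP(2)] N_scale power_mult_distrib
        distrib_left[symmetric] real_sqrt_mult)
    ultimately show "M (a *\<^sub>R x) = \<bar>a\<bar> * M x" by (simp add: M_def N_scale max_mult_distrib_left)
  qed
  have "equivalent_norm M"
    unfolding equivalent_norm_def
  proof (intro conjI nrm)
    obtain c C where c: "c > 0" "C > 0" "\<And>x. c * norm x \<le> N x" "\<And>x. N x \<le> C * norm x"
      using equivalent unfolding equivalent_norm_def by blast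
    obtain K1 where K1: "K1 > 0" "\<And>x. norm (P1 x) \<le> norm x * K1" using bounded_linear.pos_bounded[OF P(1)] by blast
    obtain K2 where K2: "K2 > 0" "\<And>x. norm (P2 x) \<le> norm x * K2" using bounded_linear.pos_bounded[OF P(2)] by blast
    have NP: "N (P1 x) \<le> C * K1 * norm x" "N (P2 x) \<le> C * K2 * norm x" for x
    proof -
      have "C * norm (P1 x) \<le> C * (norm x * K1)" "C * norm (P2 x) \<le> C * (norm x * K2)"
        using K1(2) K2(2) c(2) by (auto intro: mult_left_mono)
      then have "N (P1 x) \<le> C * (norm x * K1)" "N (P2 x) \<le> C * (norm x * K2)"
        using c(4)[of "P1 x"] c(4)[of "P2 x"] by linarith+
      then show "N (P1 x) \<le> C * K1 * norm x" "N (P2 x) \<le> C * K2 * norm x" by (simp_all add: mult_ac)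
    qed
    have "M x \<le> (C + C * K1 + C * K2) * norm x" for x
    proof -
      have "N (R x) \<le> N x + N (P1 x) + N (P2 x)"
        using N_triangle[of x "- P1 x"] N_triangle[of "x - P1 x" "- P2 x"] by (simp add: R_def N_minus)
      then have "N (R x) \<le> (C + C * K1 + C * K2) * norm x"
        using NP[of x] c(4)[of x] by (simp add: distrib_right)
      moreover have "0 \<le> C * norm x" using c(2) by simp
      then have "q x \<le> (C + C * K1 + C * K2) * norm x"
        using NP[of x] q_le[of x] unfolding distrib_right by linarith
      ultimately show ?thesis by (simp add: M_def)
    qed
    moreover have "c / 3 * norm x \<le> M x" for x using c(3)[of x] N_le[of x] by simp
    moreover have "C + C * K1 + C * K2 > 0" using c(2) K1(1) K2(1) by (simp add: add_pos_pos)
    ultimately show "\<exists>c>0. \<exists>C>0. \<forall>x. c * norm x \<le> M x \<and> M x \<le> C * norm x" using c(1)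
      by (intro exI[of _ "c / 3"] conjI exI[of _ "C + C * K1 + C * K2"]) auto
  qed
  moreover have "isometry_group N \<subseteq> isometry_group M"
  proof
    fix g assume g: "g \<in> isometry_group N"
    have "P1 (blinfun_apply g x) = blinfun_apply g (P1 x)" "P2 (blinfun_apply g x) = blinfun_apply g (P2 x)" for x
      unfolding P1_def P2_def by (rule proj_commute[OF g])+
    then have "M (blinfun_apply g x) = M x" for x
      using g by (simp add: M_def q_def R_def isometry_group_def flip: blinfun.diff_right)
    then show "g \<in> isometry_group M" using g by (simp add: isometry_group_def)
  qed
  moreover have "\<exists>g\<in>isometry_group M. g \<notin> isometry_group N"
  proof -
    define D where "D = cls i1 \<union> cls i2"
    have D: "finite D" "i1 \<in> D" "i2 \<in> D" "i1 \<noteq> i2" using assms finite_cls by (auto simp: D_def)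
    have q: "q x = sqrt (\<Sum>i\<in>D. (\<phi> i x)\<^sup>2)" for x
      unfolding q_def P1_def P2_def N_proj D_def using disj finite_cls by (simp add: sum.union_disjoint)
    have R: "\<phi> p (R x) = (if p \<in> D then 0 else \<phi> p x)" for p x
      using disj by (auto simp: R_def P1_def P2_def coord_simps coord_proj finite_cls D_def)
    have cs: "\<phi> p (swap i1 i2 x) = (if p = i1 then \<phi> i2 x else if p = i2 then \<phi> i1 x else \<phi> p x)" for p x
      using D(4) by (simp add: coord_simps)
    have Rs: "R (swap i1 i2 x) = R x" for x
    proof -
      have "\<phi> p (R (swap i1 i2 x) - R x) = 0" for p
        unfolding linear_diff[OF linear_coord] R cs using D by auto
      then show ?thesis using coord_total by (metis eq_iff_diff_eq_0)
    qed
    have "(\<Sum>i\<in>D. f i) = f i1 + (f i2 + (\<Sum>i\<in>D - {i1} - {i2}. f i))" for f :: "'b \<Rightarrow> real"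
      using D by (simp add: sum.remove)
    note split = this
    have "q (swap i1 i2 x) = q x" for x
      unfolding q split cs using D(4) by (simp add: add_ac)
    then have Ms: "M (swap i1 i2 x) = M x" for x by (simp only: M_def Rs)
    have "\<exists>s\<in>isometry_group M. blinfun_apply s = swap i1 i2"
      by (rule involution_in_isometry_group[OF \<open>equivalent_norm M\<close>])
         (rule linear_swap swap_swap Ms)+
    then obtain g where g: "g \<in> isometry_group M" "blinfun_apply g = swap i1 i2" by blast
    have "\<phi> i2 (blinfun_apply g (e i1)) = 1" unfolding g(2) using D(4) by (simp add: coord_simps)
    then have "g \<notin> isometry_group N" using isometry_coord_zero[of g i1 i2] assms by auto
    with g(1) show ?thesis by blast
  qed
  ultimately show ?thesis by blast
qed

text \<open>The image of a class span under \<open>S\<close> is invariant under the isometries of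
  \<open>M\<close>, so it contains the span of a class of \<open>M\<close>. Pulled back by
  \<open>T\<close>, this is an invariant subspace inside the original class span and contains the
  span of a class of \<open>N\<close>, which can only be the same one. So \<open>S\<close> is an
  isomorphism of class spans.\<close>

theorem card_cls_conjugate:
  assumes M: "block_norm M e \<phi>"
    and S: "linear S" "linear T" "\<And>x. T (S x) = x" "\<And>x. S (T x) = x"
    and conj: "\<And>g. g \<in> isometry_group N \<Longrightarrow> \<exists>h\<in>isometry_group M. \<forall>x. blinfun_apply h (S x) = S (blinfun_apply g x)"
      "\<And>h. h \<in> isometry_group M \<Longrightarrow> \<exists>g\<in>isometry_group N. \<forall>x. blinfun_apply h (S x) = S (blinfun_apply g x)"
  shows "\<exists>p. card (unconditional_norm.cls M e \<phi> p) = card (cls i)"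
proof -
  interpret M: block_norm M e \<phi> by (rule M)
  have "\<exists>p. e ` M.cls p \<subseteq> S ` span (e ` cls i)"
  proof (rule M.invariant_subspace_contains_cls)
    show "subspace (S ` span (e ` cls i))" by (rule linear_subspace_image[OF S(1) subspace_span])
    show "S (e i) \<in> S ` span (e ` cls i)" by (intro imageI span_base) simp
    show "S (e i) \<noteq> 0" using e_nonzero[of i] S(3)[of "e i"] linear_0[OF S(2)] by auto
    fix h assume "h \<in> isometry_group M"
    then obtain g where g: "g \<in> isometry_group N" "\<And>x. blinfun_apply h (S x) = S (blinfun_apply g x)"
      using conj(2) by blast
    show "blinfun_apply h ` S ` span (e ` cls i) \<subseteq> S ` span (e ` cls i)"
      using isometry_preserves_cls[OF g(1), of i] g(2) by (auto simp: image_subset_iff)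
  qed
  then obtain p where p: "e ` M.cls p \<subseteq> S ` span (e ` cls i)" by blast
  have Tp: "T ` span (e ` M.cls p) \<subseteq> span (e ` cls i)"
  proof -
    have "T ` e ` M.cls p \<subseteq> span (e ` cls i)" using p S(3) by fastforce
    then have "span (T ` e ` M.cls p) \<subseteq> span (e ` cls i)" by (intro span_minimal subspace_span)
    then show ?thesis by (simp only: linear_span_image[OF S(2)])
  qed
  have "\<exists>q. e ` cls q \<subseteq> T ` span (e ` M.cls p)"
  proof (rule invariant_subspace_contains_cls)
    show "subspace (T ` span (e ` M.cls p))" by (rule linear_subspace_image[OF S(2) subspace_span])
    show "T (e p) \<in> T ` span (e ` M.cls p)" by (intro imageI span_base) simp
    show "T (e p) \<noteq> 0" using e_nonzero[of p] S(4)[of "e p"] linear_0[OF S(1)] by auto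
    fix g assume "g \<in> isometry_group N"
    then obtain h where h: "h \<in> isometry_group M" "\<And>x. blinfun_apply h (S x) = S (blinfun_apply g x)"
      using conj(1) by blast
    have "blinfun_apply g (T y) = T (blinfun_apply h y)" for y
      using h(2)[of "T y"] S(3,4) by simp
    then show "blinfun_apply g ` T ` span (e ` M.cls p) \<subseteq> T ` span (e ` M.cls p)"
      using M.isometry_preserves_cls[OF h(1), of p] by (auto simp: image_subset_iff)
  qed
  then obtain q where q: "e ` cls q \<subseteq> T ` span (e ` M.cls p)" by blast
  with Tp have "e q \<in> span (e ` cls i)" using self_in_cls by blast
  then have "rel i q" unfolding in_span_basis_iff[OF finite_cls] by (auto simp: coord_simps cls_def)
  then have "cls i = cls q" by (rule cls_eq)
  have "S ` e ` cls i \<subseteq> span (e ` M.cls p)"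
    using q S(4) unfolding \<open>cls i = cls q\<close> by fastforce
  then have "card (cls i) \<le> card (M.cls p)"
    by (rule card_le_if_embedded[OF S(1,3) _ M.finite_cls])
  moreover have "T ` e ` M.cls p \<subseteq> span (e ` cls i)" using Tp by (auto intro: span_base)
  then have "card (M.cls p) \<le> card (cls i)"
    by (rule M.card_le_if_embedded[OF S(2,4) _ finite_cls])
  ultimately show ?thesis by (intro exI[of _ p]) simp
qed

end

text \<open>The supremum of \<open>norm (g x)\<close> over \<open>g\<close> in \<open>G\<close> is
  equivalent to the norm because \<open>G\<close> is bounded and contains the identity, and
  invariant because \<open>G\<close> is a group. Its isometry group is bounded and contains
  \<open>G\<close>, hence is \<open>G\<close> by maximality.\<close>

lemma maximal_bounded_subgroup_is_isometry_group:
  fixes G :: "('a::real_normed_vector \<Rightarrow>\<^sub>L 'a) set"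
  assumes G: "maximal_bounded_subgroup G"
  shows "\<exists>N. equivalent_norm N \<and> isometry_group N = G"
proof -
  have sub: "subgroup G GL" and "bounded G"
    using G by (auto simp: maximal_bounded_subgroup_def bounded_subgroup_def)
  then obtain K where K: "\<And>g. g \<in> G \<Longrightarrow> norm g \<le> K" by (auto simp: bounded_iff)
  have id: "id_blinfun \<in> G" using subgroup.one_closed[OF sub] by (simp add: GL_def)
  have mult: "g o\<^sub>L h \<in> G" if "g \<in> G" "h \<in> G" for g h
    using subgroup.m_closed[OF sub that] by (simp add: GL_def)
  have inv: "\<exists>h\<in>G. g o\<^sub>L h = id_blinfun \<and> h o\<^sub>L g = id_blinfun" if "g \<in> G" for g
  proof -
    have c: "g \<in> carrier GL" using subgroup.subset[OF sub] that by blast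
    then show ?thesis
      using subgroup.m_inv_closed[OF sub that] group.r_inv[OF group_GL c] group.l_inv[OF group_GL c]
      by (intro bexI[of _ "inv\<^bsub>GL\<^esub> g"]) (auto simp: GL_def)
  qed
  have le: "norm (blinfun_apply g x) \<le> K * norm x" if "g \<in> G" for g x
    using norm_blinfun[of g x] mult_right_mono[OF K[OF that], of "norm x"] by simp
  define N where "N x = (SUP g\<in>G. norm (blinfun_apply g x))" for x :: 'a
  have bdd: "bdd_above ((\<lambda>g. norm (blinfun_apply g x)) ` G)" for x
    using le by (intro bdd_aboveI2)
  have up: "norm (blinfun_apply g x) \<le> N x" if "g \<in> G" for g x
    unfolding N_def by (rule cSUP_upper[OF that bdd])
  have least: "N x \<le> r" if "\<And>g. g \<in> G \<Longrightarrow> norm (blinfun_apply g x) \<le> r" for x r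
    unfolding N_def using id that by (intro cSUP_least) auto
  have ge: "norm x \<le> N x" for x using up[OF id, of x] by simp
  have scale: "N (a *\<^sub>R x) \<le> \<bar>a\<bar> * N x" for a x
    by (rule least) (simp add: blinfun.scaleR_right up mult_left_mono)
  have "is_norm N"
    unfolding is_norm_def
  proof (intro conjI allI)
    fix x y :: 'a and a :: real
    show "0 \<le> N x" using ge[of x] norm_ge_zero order_trans by blast
    have "N 0 \<le> 0" by (rule least) simp
    then show "N x = 0 \<longleftrightarrow> x = 0" using ge[of x] ge[of 0] by auto
    show "N (x + y) \<le> N x + N y"
    proof (rule least)
      fix g assume "g \<in> G"
      then show "norm (blinfun_apply g (x + y)) \<le> N x + N y"
        using up[of g x] up[of g y] norm_triangle_ineq[of "blinfun_apply g x" "blinfun_apply g y"]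
        by (simp add: blinfun.add_right)
    qed
    show "N (a *\<^sub>R x) = \<bar>a\<bar> * N x"
    proof (cases "a = 0")
      case True then show ?thesis using \<open>N 0 \<le> 0\<close> ge[of 0] by simp
    next
      case False
      have "N x \<le> \<bar>inverse a\<bar> * N (a *\<^sub>R x)" using scale[of "inverse a" "a *\<^sub>R x"] False by simp
      then have "\<bar>a\<bar> * N x \<le> N (a *\<^sub>R x)" using False by (simp add: field_simps)
      with scale[of a x] show ?thesis by simp
    qed
  qed
  moreover have "N x \<le> (\<bar>K\<bar> + 1) * norm x" for x
  proof (rule least)
    fix g assume "g \<in> G"
    have "K * norm x \<le> (\<bar>K\<bar> + 1) * norm x" by (intro mult_right_mono) auto
    then show "norm (blinfun_apply g x) \<le> (\<bar>K\<bar> + 1) * norm x" using le[OF \<open>g \<in> G\<close>, of x] by simp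
  qed
  ultimately have eq: "equivalent_norm N"
    unfolding equivalent_norm_def using ge
    by (intro conjI exI[of _ 1] exI[of _ "\<bar>K\<bar> + 1"]) auto
  have "G \<subseteq> isometry_group N"
  proof
    fix g assume g: "g \<in> G"
    obtain h where h: "h \<in> G" "g o\<^sub>L h = id_blinfun" "h o\<^sub>L g = id_blinfun" using inv[OF g] by blast
    have gh: "blinfun_apply g (blinfun_apply h x) = x" "blinfun_apply h (blinfun_apply g x) = x" for x
      using h(2,3)[THEN arg_cong[of _ _ "\<lambda>f. blinfun_apply f x"]] by simp_all
    have 1: "N (blinfun_apply k x) \<le> N x" if "k \<in> G" for k x
      by (rule least) (use up[OF mult[OF _ that]] in simp)
    have "N (blinfun_apply g x) = N x" for x
      using 1[OF g, of x] 1[OF h(1), of "blinfun_apply g x"] gh(2) by simp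
    then show "g \<in> isometry_group N" using surjI[of "blinfun_apply g", OF gh(1)] by (simp add: isometry_group_def)
  qed
  moreover have "\<not> G \<subset> isometry_group N"
    using G isometry_group_bounded_subgroup[OF eq] by (simp add: maximal_bounded_subgroup_def)
  ultimately show ?thesis using eq by blast
qed

section \<open>Passing to a larger isometry group\<close>

context unconditional_norm
begin

text \<open>Sign changes and swaps are isometries of \<open>N\<close>, hence of \<open>M\<close>.
  The basis is rescaled since \<open>M (e i)\<close> may differ from 1, but swaps make it constant
  on each class of \<open>N\<close>, so for related indices \<open>e\<close> and \<open>f\<close>
  have the same rotation generator.\<close>

lemma renormalised:
  assumes M: "equivalent_norm M" and sub: "isometry_group N \<subseteq> isometry_group M"
  defines "f \<equiv> \<lambda>i. (1 / M (e i)) *\<^sub>R e i" and "\<psi> \<equiv> \<lambda>i x. M (e i) * \<phi> i x"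
  shows "unconditional_norm M f \<psi>" and "rel i j \<Longrightarrow> unconditional_norm.rel M f \<psi> i j"
proof -
  have nM: "is_norm M" using M by (simp add: equivalent_norm_def)
  have pos: "0 < M (e i)" for i
    using nM e_nonzero[of i] unfolding is_norm_def by (metis less_eq_real_def)
  have scaleM: "M (a *\<^sub>R x) = \<bar>a\<bar> * M x" and addM: "M (x + y) \<le> M x + M y" for a x y
    using nM by (auto simp: is_norm_def)
  have invM: "M (u x) = M x" if "linear u" "\<And>x. N (u x) = N x" "\<And>x. u (u x) = x" for u x
    using involution_in_isometry_group[OF equivalent that] sub by (auto simp: isometry_group_def)
  show 1: "unconditional_norm M f \<psi>"
  proof (rule unconditional_norm.intro)
    show "equivalent_norm M" by (rule M)
    show "bounded_linear (\<psi> i)" for i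
      unfolding \<psi>_def by (rule bounded_linear_compose[OF bounded_linear_mult_right bounded_linear_coord])
    show "\<psi> i (f j) = (if i = j then 1 else 0)" for i j
      using pos[of i] pos[of j] by (auto simp: \<psi>_def f_def coord_simps)
    show "x = 0" if "\<And>i. \<psi> i x = 0" for x
    proof (rule coord_total)
      show "\<phi> i x = 0" for i using that[of i] pos[of i] by (simp add: \<psi>_def)
    qed
    show "M (f i) = 1" for i using pos[of i] by (simp add: f_def scaleM)
    show "M (x - (2 * \<psi> i x) *\<^sub>R f i) = M x" for x i
      using invM[where u = "refl_coord i", OF linear_refl_coord sign_change refl_coord_refl_coord, of x] pos[of i]
      by (simp add: \<psi>_def f_def)
    have "e i \<in> span (range f)" for i
      using span_scale[OF span_base[of "f i" "range f"], of "M (e i)"] pos[of i] by (simp add: f_def)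
    then have "span (range e) \<subseteq> span (range f)" by (intro span_minimal subspace_span) auto
    then have "closure (span (range e)) \<subseteq> closure (span (range f))" by (rule closure_mono)
    then show "closure (span (range f)) = UNIV" using dense_span by blast
  qed
  interpret M: unconditional_norm M f \<psi> by (rule 1)
  show "M.rel i j" if "rel i j"
  proof (cases "i = j")
    case False
    have "M (swap i j (e i)) = M (e i)"
      by (rule invM[OF linear_swap swap_invariant[OF that] swap_swap])
    then have eqM: "M (e j) = M (e i)" using False by (simp add: coord_simps)
    define K where "K x = \<phi> j x *\<^sub>R e i - \<phi> i x *\<^sub>R e j" for x
    have K: "\<psi> j x *\<^sub>R f i - \<psi> i x *\<^sub>R f j = K x" for x
      using pos[of i] by (simp add: \<psi>_def f_def K_def eqM)
    define Q where "Q x = x - (\<phi> i x *\<^sub>R e i + \<phi> j x *\<^sub>R e j)" for x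
    \<comment> \<open>In the plane, \<open>x + t K x\<close> is \<open>r\<close> times a rotated
      copy of \<open>x\<close>; off the plane the excess is \<open>(r - 1) Q x\<close>. As
      \<open>r - 1\<close> is at most the square of \<open>t\<close>, the norm grows to second order
      only.\<close>
    have bound: "M (x + t *\<^sub>R K x) \<le> M x + t\<^sup>2 * (M x + M (Q x))" for x t
    proof -
      define r where "r = sqrt (1 + t\<^sup>2)"
      have r: "1 \<le> r" "r\<^sup>2 = 1 + t\<^sup>2" by (simp_all add: r_def)
      have r1: "r - 1 \<le> t\<^sup>2" using r mult_right_mono[OF r(1), of r] by (simp add: power2_eq_square)
      define c s where "c = 1 / r" and "s = t / r"
      have "c\<^sup>2 + s\<^sup>2 = (1 + t\<^sup>2) / r\<^sup>2" by (simp add: c_def s_def power_divide add_divide_distrib)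
      then have cs: "c\<^sup>2 + s\<^sup>2 = 1" using r by (simp add: add_nonneg_eq_0_iff)
      define rot where "rot s x = x + (c - 1) *\<^sub>R (\<phi> i x *\<^sub>R e i + \<phi> j x *\<^sub>R e j) + s *\<^sub>R K x" for s x
      have lin: "linear (rot s)" for s
        by (rule linearI) (simp_all add: rot_def K_def coord_simps algebra_simps)
      define R where "R x = swap i j (rot s x)" for x
      \<comment> \<open>\<open>R\<close> is a reflection, so that the lemma on involutions applies.\<close>
      have Ninv: "N (R x) = N x" for x
        unfolding R_def swap_invariant[OF that] unfolding rot_def K_def by (rule rotation_invariant[OF that False cs])
      have RR: "R (R x) = x" for x
      proof -
        have cR: "\<phi> k (R x) = (if k = i then c * \<phi> j x - s * \<phi> i x else if k = j then c * \<phi> i x + s * \<phi> j x else \<phi> k x)" for k x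
          using False by (simp add: R_def rot_def K_def coord_simps algebra_simps)
        have "\<phi> k (R (R x) - x) = 0" for k
        proof -
          have "c * (c * \<phi> i x + s * \<phi> j x) - s * (c * \<phi> j x - s * \<phi> i x) = (c\<^sup>2 + s\<^sup>2) * \<phi> i x"
            "c * (c * \<phi> j x - s * \<phi> i x) + s * (c * \<phi> i x + s * \<phi> j x) = (c\<^sup>2 + s\<^sup>2) * \<phi> j x"
            by (simp_all add: power2_eq_square algebra_simps)
          then show ?thesis unfolding linear_diff[OF linear_coord] cR cs using False by simp
        qed
        then show ?thesis using coord_total by (metis eq_iff_diff_eq_0)
      qed
      have "linear R" unfolding R_def using linear_compose[OF lin linear_swap] by (simp add: o_def)
      then have "M (R x) = M x" by (rule invM) (rule Ninv RR)+
      moreover have "M (R x) = M (rot s x)"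
        unfolding R_def by (rule invM[OF linear_swap swap_invariant[OF that] swap_swap])
      ultimately have Mrot: "M (rot s x) = M x" by simp
      have "x + t *\<^sub>R K x = r *\<^sub>R rot s x + (- (r - 1)) *\<^sub>R Q x"
        using r(1) by (simp add: rot_def c_def s_def Q_def algebra_simps)
      then have "M (x + t *\<^sub>R K x) \<le> r * M x + (r - 1) * M (Q x)"
        using addM[of "r *\<^sub>R rot s x" "(- (r - 1)) *\<^sub>R Q x"] r(1) unfolding scaleM Mrot by simp
      also have "\<dots> = M x + (r - 1) * (M x + M (Q x))" by (simp add: algebra_simps)
      also have "\<dots> \<le> M x + t\<^sup>2 * (M x + M (Q x))"
        using r1 nM by (intro add_left_mono mult_right_mono) (auto simp: is_norm_def)
      finally show ?thesis .
    qed
    have "M.skew K"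
      unfolding M.skew_def
    proof (intro allI impI)
      fix x and \<epsilon> :: real assume e: "0 < \<epsilon>"
      define B where "B = M x + M (Q x) + 1"
      have B: "0 < B" "M x + M (Q x) \<le> B" using nM by (auto simp: B_def is_norm_def add_nonneg_pos)
      have "M (x + t *\<^sub>R K x) \<le> M x + \<epsilon> * \<bar>t\<bar>" if "\<bar>t\<bar> < \<epsilon> / B" for t
      proof -
        have "t\<^sup>2 * (M x + M (Q x)) \<le> \<bar>t\<bar> * (\<bar>t\<bar> * B)"
          using B mult_left_mono[OF B(2), of "t\<^sup>2"] by (simp add: power2_eq_square mult.assoc[symmetric])
        also have "\<dots> \<le> \<bar>t\<bar> * \<epsilon>"
          using that B(1) by (intro mult_left_mono) (simp_all add: field_simps)
        finally show ?thesis using bound[of x t] by (simp add: mult.commute)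
      qed
      then show "\<exists>\<delta>>0. \<forall>t. \<bar>t\<bar> < \<delta> \<longrightarrow> M (x + t *\<^sub>R K x) \<le> M x + \<epsilon> * \<bar>t\<bar>"
        using e B(1) by (intro exI[of _ "\<epsilon> / B"]) auto
    qed
    then show ?thesis unfolding M.rel_def K by simp
  qed simp
qed

text \<open>The hypothesis \<open>card\<close> speaks of all finite unions of classes because it
  cannot be predicted which unions the larger group forms. On an infinite class of \<open>M\<close>
  the norm would dominate a multiple of the Euclidean norm, which \<open>not_hilbert\<close>
  forbids.\<close>

theorem isometry_group_not_in_maximal:
  assumes infinite: "infinite (UNIV :: 'i set)"
    and nontrivial: "\<And>i. \<exists>j. rel i j \<and> i \<noteq> j"
    and card: "\<And>C D. finite C \<Longrightarrow> finite D \<Longrightarrow> (\<And>i j. i \<in> C \<Longrightarrow> rel i j \<Longrightarrow> j \<in> C) \<Longrightarrow>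
      (\<And>i j. i \<in> D \<Longrightarrow> rel i j \<Longrightarrow> j \<in> D) \<Longrightarrow> card C = card D \<Longrightarrow> C = D"
    and not_hilbert: "\<And>A \<delta>. infinite A \<Longrightarrow> 0 < \<delta> \<Longrightarrow>
      \<exists>B a. finite B \<and> B \<subseteq> A \<and> norm (\<Sum>i\<in>B. a i *\<^sub>R e i) < \<delta> * sqrt (\<Sum>i\<in>B. (a i)\<^sup>2)"
    and G: "maximal_bounded_subgroup G"
  shows "\<not> isometry_group N \<subseteq> G"
proof
  assume sub: "isometry_group N \<subseteq> G"
  obtain M where M: "equivalent_norm M" "isometry_group M = G"
    using maximal_bounded_subgroup_is_isometry_group[OF G] by blast
  define f where "f = (\<lambda>i. (1 / M (e i)) *\<^sub>R e i)"
  define \<psi> where "\<psi> = (\<lambda>i x. M (e i) * \<phi> i x)"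
  have ren: "unconditional_norm M f \<psi>" "\<And>i j. rel i j \<Longrightarrow> unconditional_norm.rel M f \<psi> i j"
    unfolding f_def \<psi>_def using renormalised[OF M(1)] sub M(2) by auto
  interpret M: unconditional_norm M f \<psi> by (rule ren(1))
  have closed: "j \<in> M.cls p" if "i \<in> M.cls p" "rel i j" for i j p
    using that ren(2)[of i j] M.rel_trans[of p i j] by (simp add: M.cls_def)
  obtain c C where c: "c > 0" "C > 0" "\<And>x. c * norm x \<le> M x" "\<And>x. M x \<le> C * norm x"
    using M(1) unfolding equivalent_norm_def by blast
  obtain C' where C': "C' > 0" "\<And>x. N x \<le> C' * norm x" by (rule N_bound) blast
  have Me: "c / C' \<le> M (e i)" for i
  proof -
    have "1 / C' \<le> norm (e i)" using C'(2)[of "e i"] C'(1) by (simp add: normalised field_simps)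
    then have "c * (1 / C') \<le> c * norm (e i)" using c(1) by (intro mult_left_mono) auto
    then show ?thesis using c(3)[of "e i"] by simp
  qed
  have c0: "0 < c / C'" using c(1) C'(1) by simp
  have fin: "finite (M.cls p)" for p
  proof (rule ccontr)
    assume inf: "infinite (M.cls p)"
    have d: "0 < c / C' / C" using c0 c(2) by (rule divide_pos_pos)
    obtain B a where B: "finite B" "B \<subseteq> M.cls p"
      "norm (\<Sum>i\<in>B. a i *\<^sub>R e i) < c / C' / C * sqrt (\<Sum>i\<in>B. (a i)\<^sup>2)"
      using not_hilbert[OF inf d] by blast
    have "(\<Sum>i\<in>B. a i *\<^sub>R e i) = (\<Sum>i\<in>B. (a i * M (e i)) *\<^sub>R f i)"
    proof (rule sum.cong[OF refl])
      fix i show "a i *\<^sub>R e i = (a i * M (e i)) *\<^sub>R f i" using Me[of i] c0 by (simp add: f_def)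
    qed
    then have "M (\<Sum>i\<in>B. a i *\<^sub>R e i) = sqrt (\<Sum>i\<in>B. (a i * M (e i))\<^sup>2)"
      using M.N_eq_l2[OF B(1), of p "\<lambda>i. a i * M (e i)"] B(2) by (auto simp: M.cls_def)
    moreover have "c / C' * sqrt (\<Sum>i\<in>B. (a i)\<^sup>2) \<le> sqrt (\<Sum>i\<in>B. (a i * M (e i))\<^sup>2)"
    proof -
      have "(c / C')\<^sup>2 * (\<Sum>i\<in>B. (a i)\<^sup>2) \<le> (\<Sum>i\<in>B. (a i * M (e i))\<^sup>2)"
        unfolding sum_distrib_left
      proof (rule sum_mono)
        fix i
        have "(c / C')\<^sup>2 \<le> (M (e i))\<^sup>2" using Me[of i] c0 by (intro power_mono) auto
        then show "(c / C')\<^sup>2 * (a i)\<^sup>2 \<le> (a i * M (e i))\<^sup>2"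
          by (simp add: power_mult_distrib mult.commute mult_left_mono)
      qed
      then have "sqrt ((c / C')\<^sup>2 * (\<Sum>i\<in>B. (a i)\<^sup>2)) \<le> sqrt (\<Sum>i\<in>B. (a i * M (e i))\<^sup>2)" by (rule real_sqrt_le_mono)
      then show ?thesis using c0 by (simp only: real_sqrt_mult real_sqrt_abs abs_of_pos)
    qed
    moreover have "C * norm (\<Sum>i\<in>B. a i *\<^sub>R e i) < C * (c / C' / C * sqrt (\<Sum>i\<in>B. (a i)\<^sup>2))"
      using B(3) c(2) by (rule mult_strict_left_mono)
    ultimately show False using c(4)[of "\<Sum>i\<in>B. a i *\<^sub>R e i"] c(2) by simp
  qed
  interpret M: block_norm M f \<psi>
  proof
    show "finite (M.cls i)" for i by (rule fin)
    show "\<exists>j. M.rel i j \<and> i \<noteq> j" for i using nontrivial[of i] ren(2) by blast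
    show "M.cls i = M.cls j" if "card (M.cls i) = card (M.cls j)" for i j
      by (rule card[OF fin fin closed closed that])
  qed
  obtain i1 i2 where "\<not> M.rel i1 i2"
  proof -
    have "M.cls i \<noteq> UNIV" for i using fin infinite by metis
    then show ?thesis using that by (auto simp: M.cls_def)
  qed
  from M.isometry_group_extends[OF this] obtain M' where "equivalent_norm M'" "isometry_group M \<subset> isometry_group M'"
    by blast
  then show False
    using G isometry_group_bounded_subgroup[of M'] M(2) unfolding maximal_bounded_subgroup_def by blast
qed

end

section \<open>The Tsirelson norm\<close>

abbreviation T :: "c00 \<Rightarrow> real" where "T \<equiv> tsirelson_norm"

lemma T_good: "good T" using tsirelson_norm_good by blast

lemma T_nonneg: "0 \<le> T x" by (rule good_nonneg[OF T_good])
lemma T_0 [simp]: "T 0 = 0" by (rule good_0[OF T_good])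
lemma T_add: "T (x + y) \<le> T x + T y" using T_good by (simp add: good_def)
lemma T_scale: "T (a *\<^sub>R x) = \<bar>a\<bar> * T x" using tsirelson_norm_is_norm by (simp add: is_norm_def)
lemma T_mono: "(\<And>i. \<bar>coord x i\<bar> \<le> \<bar>coord y i\<bar>) \<Longrightarrow> T x \<le> T y" using T_good by (simp add: good_def)
lemma sup_norm_le_T: "sup_norm x \<le> T x" using T_good by (simp add: good_def)
lemma T_le_l1: "T x \<le> l1 x" using T_good by (simp add: good_def)
lemma coord_le_T: "\<bar>coord x i\<bar> \<le> T x" using coord_le_sup sup_norm_le_T order_trans by blast

lemma T_sum: "T (\<Sum>i\<in>A. f i) \<le> (\<Sum>i\<in>A. T (f i))"
proof (induction A rule: infinite_finite_induct)
  case (insert x F)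
  then show ?case using T_add[of "f x" "sum f F"] by simp
qed simp_all

lemma T_restr_le: "T (restr E x) \<le> T x"
  by (rule T_mono) simp

lemma coord_sum: "coord (\<Sum>k\<in>K. f k) i = (\<Sum>k\<in>K. coord (f k) i)"
  by (induction K rule: infinite_finite_induct) auto

lemma coord_diff [simp]: "coord (x - y) i = coord x i - coord y i"
  by transfer simp

definition separated :: "nat set \<Rightarrow> nat set \<Rightarrow> bool" where
  "separated E F \<longleftrightarrow> (\<forall>a\<in>E. \<forall>b\<in>F. a < b) \<or> (\<forall>a\<in>E. \<forall>b\<in>F. b < a)"

lemma separated_mono: "separated E F \<Longrightarrow> E' \<subseteq> E \<Longrightarrow> F' \<subseteq> F \<Longrightarrow> separated E' F'"
  unfolding separated_def by blast

lemma separated_disjoint: "separated E F \<Longrightarrow> E \<inter> F = {}"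
  unfolding separated_def by fastforce

text \<open>Dropping the empty members and sorting the others by their minima gives an admissible
  list. Indexed families are easier to build and to take apart than ordered lists.\<close>

lemma T_family:
  assumes J: "finite J" and F: "\<And>j. j \<in> J \<Longrightarrow> finite (F j)"
    and sep: "\<And>j k. j \<in> J \<Longrightarrow> k \<in> J \<Longrightarrow> j \<noteq> k \<Longrightarrow> separated (F j) (F k)"
    and card: "\<And>j a. j \<in> J \<Longrightarrow> a \<in> F j \<Longrightarrow> card J \<le> a"
  shows "(\<Sum>j\<in>J. T (restr (F j) x)) \<le> 2 * T x"
proof -
  define J' where "J' = {j \<in> J. F j \<noteq> {}}"
  have J': "finite J'" "J' \<subseteq> J" using J by (auto simp: J'_def)
  have Min_inj: "inj_on (\<lambda>j. Min (F j)) J'"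
  proof (rule inj_onI, rule ccontr)
    fix j k assume jk: "j \<in> J'" "k \<in> J'" "Min (F j) = Min (F k)" "j \<noteq> k"
    have "Min (F i) \<in> F i" if "i \<in> J'" for i using that F by (auto simp: J'_def)
    then have "Min (F j) \<in> F j" "Min (F k) \<in> F k" using jk by blast+
    moreover have "F j \<inter> F k = {}" using sep jk by (intro separated_disjoint) (auto simp: J'_def)
    ultimately show False using jk(3) by auto
  qed
  have inj: "inj_on F J'" using Min_inj by (auto simp: inj_on_def)
  have "(\<Sum>j\<in>J. T (restr (F j) x)) = (\<Sum>j\<in>J'. T (restr (F j) x))"
    by (rule sum.mono_neutral_right[OF J J'(2)]) (auto simp: J'_def restr_disj)
  also have "\<dots> \<le> 2 * T x"
  proof (cases "J' = {}")
    case True then show ?thesis using T_nonneg[of x] by simp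
  next
    case False
    obtain Es where Es: "sorted (map Min Es)" "set Es = F ` J'" "distinct Es"
      using finite_sorted_distinct_unique
      by (metis J'(1) distinct_sort finite_distinct_list finite_imageI set_sort sorted_sort_key)
    have "inj_on Min (F ` J')" using Min_inj by (auto simp: inj_on_def)
    then have "distinct (map Min Es)" using Es by (simp add: distinct_map)
    then have "sorted_wrt (<) (map Min Es)" using Es(1) by (simp add: strict_sorted_iff)
    then have "sorted_wrt (\<lambda>E F. Min E < Min F) Es" by (simp add: sorted_wrt_map)
    then have so: "sorted_wrt (\<lambda>E F. \<forall>a\<in>E. \<forall>b\<in>F. a < b) Es"
    proof (rule sorted_wrt_mono_rel[rotated])
      fix E G assume EG: "E \<in> set Es" "G \<in> set Es" "Min E < Min G"
      then obtain j k where jk: "j \<in> J'" "k \<in> J'" "E = F j" "G = F k" using Es by auto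
      have "j \<noteq> k" using EG(3) jk by auto
      then have "separated E G" using sep jk J'(2) by auto
      moreover have "Min E \<in> E" "Min G \<in> G" using F jk by (simp_all add: J'_def)
      ultimately
show "\<forall>a\<in>E. \<forall>b\<in>G. a < b" using EG(3) unfolding separated_def by fastforce
    qed
    have len: "length Es = card J'" using Es(2,3) card_image[OF inj] distinct_card by metis
    have elt: "card J \<le> a" "finite E" "E \<noteq> {}" if "E \<in> set Es" "a \<in> E" for E a
      using that Es(2) card F by (auto simp: J'_def)
    have "card J > 0" using False J J'(2) by (auto simp: card_gt_0_iff)
    have "Es \<noteq> []" using False Es(2) by auto
    then have hd: "hd Es \<in> set Es" by simp
    have ne: "finite E" "E \<noteq> {}" if "E \<in> set Es" for E using that Es(2) F by (auto simp: J'_def)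
    have "admissible Es"
      unfolding admissible_def
    proof (intro conjI ballI so)
      fix E assume E: "E \<in> set Es"
      show "finite E" "E \<noteq> {}" using ne[OF E] .
      show "0 \<notin> E" using elt(1)[OF E, of 0] \<open>card J > 0\<close> by auto
    next
      have "length Es \<le> card J" using len card_mono[OF J J'(2)] by simp
      also have "\<dots> \<le> Min (hd Es)" using elt(1)[OF hd] ne[OF hd] by auto
      finally show "length Es \<le> Min (hd Es)" .
    qed (use \<open>Es \<noteq> []\<close> in simp)
    from rhs_upper[OF _ _ this, of T x] have "(\<Sum>E\<leftarrow>Es. T (restr E x)) \<le> 2 * T x"
      using tsirelson_norm_eq[of x] by (simp add: T_nonneg)
    moreover have "(\<Sum>E\<leftarrow>Es. T (restr E x)) = (\<Sum>j\<in>J'. T (restr (F j) x))"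
      using Es(2,3) inj by (simp add: sum_list_distinct_conv_sum_set sum.reindex)
    ultimately show ?thesis by simp
  qed
  finally show ?thesis .
qed

text \<open>Members are proper subsets of \<open>A\<close>, so that an induction on the size of the
  support applies to each restriction.\<close>

definition separated_family :: "nat set \<Rightarrow> nat set set \<Rightarrow> bool" where
  "separated_family A \<E> \<longleftrightarrow> finite \<E> \<and> (\<forall>E\<in>\<E>. E \<subset> A \<and> E \<noteq> {}) \<and>
     (\<forall>E\<in>\<E>. \<forall>F\<in>\<E>. E \<noteq> F \<longrightarrow> separated E F) \<and> (\<forall>E\<in>\<E>. \<forall>a\<in>E. card \<E> \<le> a)"

lemma admissible_le: "admissible Es \<Longrightarrow> E \<in> set Es \<Longrightarrow> a \<in> E \<Longrightarrow> length Es \<le> a"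
proof -
  assume *: "admissible Es" "E \<in> set Es" "a \<in> E"
  then obtain E' Es' where Es: "Es = E' # Es'" by (cases Es) auto
  have "Min E' \<le> a"
  proof (cases "E = E'")
    case True then show ?thesis using * by (auto simp: admissible_def)
  next
    case False
    then have "\<forall>b\<in>E'. b < a" using * Es by (auto simp: admissible_def)
    moreover have "Min E' \<in> E'" using * Es by (auto simp: admissible_def)
    ultimately show ?thesis by fastforce
  qed
  then show ?thesis using * Es by (simp add: admissible_def)
qed

lemma admissible_separated:
  assumes "admissible Es" "E \<in> set Es" "F \<in> set Es" "E \<noteq> F"
  shows "separated E F"
proof -
  have "sorted_wrt (\<lambda>E F. \<forall>a\<in>E. \<forall>b\<in>F. a < b) Es" using assms by (simp add: admissible_def)
  then show ?thesis using assms(2-4)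
    by (induction Es) (auto simp: separated_def)
qed

text \<open>In the fixed point equation a member that covers the support is the only one to
  contribute, and it contributes \<open>T x / 2\<close>; this is absorbed, as
  \<open>T x \<le> max r (T x / 2)\<close> forces \<open>T x \<le> r\<close>. All other families can
  be cut down to the support.\<close>

lemma T_leI:
  assumes sup: "\<And>i. \<bar>coord x i\<bar> \<le> r"
    and fam: "\<And>\<E>. separated_family (supp x) \<E> \<Longrightarrow> (\<Sum>E\<in>\<E>. T (restr E x)) \<le> 2 * r"
  shows "T x \<le> r"
proof -
  have "0 \<le> r" using sup[of 0] by simp
  have "T x = tsirelson_rhs T x" by (rule tsirelson_norm_eq)
  also have "\<dots> \<le> max r (1 / 2 * T x)"
  proof (rule rhs_leI)
    show "sup_norm x \<le> max r (1 / 2 * T x)" using sup_leI[OF sup] by (simp add: max_def)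
    fix Es assume ad: "admissible Es"
    define \<A> where "\<A> = {E \<in> set Es. E \<inter> supp x \<noteq> {}}"
    have inj: "inj_on (\<lambda>E. E \<inter> supp x) \<A>"
      using admissible_distinct(2)[OF ad] by (intro inj_onI) (simp add: \<A>_def, blast)
    have eq: "(\<Sum>E\<leftarrow>Es. T (restr E x)) = (\<Sum>E\<in>(\<lambda>E. E \<inter> supp x) ` \<A>. T (restr E x))"
    proof -
      have "(\<Sum>E\<leftarrow>Es. T (restr E x)) = (\<Sum>E\<in>set Es. T (restr E x))" by (rule sum_admissible[OF ad])
      also have "\<dots> = (\<Sum>E\<in>\<A>. T (restr E x))"
        by (rule sum.mono_neutral_right) (auto simp: \<A>_def restr_disj)
      also have "\<dots> = (\<Sum>E\<in>(\<lambda>E. E \<inter> supp x) ` \<A>. T (restr E x))"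
        by (simp add: sum.reindex[OF inj] restr_supp)
      finally show ?thesis .
    qed
    show "1 / 2 * (\<Sum>E\<leftarrow>Es. T (restr E x)) \<le> max r (1 / 2 * T x)"
    proof (cases "\<exists>E\<in>\<A>. supp x \<subseteq> E")
      case True
      then obtain E where E: "E \<in> \<A>" "supp x \<subseteq> E" by blast
      then have "F = E" if "F \<in> \<A>" for F
        using that admissible_distinct(2)[OF ad, of E F] by (auto simp: \<A>_def)
      then have "\<A> = {E}" using E(1) by blast
      then show ?thesis unfolding eq using E(2) by (simp add: restr_super Int_absorb1)
    next
      case False
      have "card ((\<lambda>E. E \<inter> supp x) ` \<A>) \<le> length Es"
        using card_image_le[of \<A> "\<lambda>E. E \<inter> supp x"] card_mono[of "set Es" \<A>] card_length[of Es]
        by (simp add: \<A>_def)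
      moreover have "separated (E \<inter> supp x) (F \<inter> supp x)"
        if "E \<in> \<A>" "F \<in> \<A>" "E \<inter> supp x \<noteq> F \<inter> supp x" for E F
        using that by (intro separated_mono[OF admissible_separated[OF ad, of E F]]) (auto simp: \<A>_def)
      ultimately have "separated_family (supp x) ((\<lambda>E. E \<inter> supp x) ` \<A>)"
        using False admissible_le[OF ad] unfolding separated_family_def
        by (auto simp: \<A>_def intro: order_trans)
      from fam[OF this] show ?thesis unfolding eq by simp
    qed
  qed
  finally show ?thesis using \<open>0 \<le> r\<close> T_nonneg[of x] by (auto simp: max_def split: if_splits)
qed

section \<open>Shifting coordinates to the left\<close>

lift_definition delta :: "nat \<Rightarrow> c00" is "\<lambda>i j. if i = j \<and> i \<noteq> 0 then 1 else 0"
  by (auto intro: finite_subset[of _ "{_}"])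

lemma coord_delta [simp]: "coord (delta i) j = (if i = j \<and> i \<noteq> 0 then 1 else 0)"
  by transfer simp

definition vec :: "(nat \<Rightarrow> nat) \<Rightarrow> nat set \<Rightarrow> (nat \<Rightarrow> real) \<Rightarrow> c00" where
  "vec p K b = (\<Sum>k\<in>K. b k *\<^sub>R delta (p k))"

lemma coord_vec_image:
  assumes "finite K" "inj_on p K" "k \<in> K" "p k \<noteq> 0"
  shows "coord (vec p K b) (p k) = b k"
proof -
  have "coord (vec p K b) (p k) = (\<Sum>j\<in>K. if j = k then b k else 0)"
    unfolding vec_def coord_sum using assms by (intro sum.cong) (auto simp: inj_on_def)
  then show ?thesis using assms by simp
qed

lemma coord_vec_notin: "i \<notin> p ` K \<Longrightarrow> coord (vec p K b) i = 0"
  unfolding vec_def coord_sum by (intro sum.neutral) auto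

lemma restr_vec: "finite K \<Longrightarrow> restr E (vec p K b) = vec p {k \<in> K. p k \<in> E} b"
  by (rule c00_eqI) (auto simp: vec_def coord_sum sum.inter_filter intro!: sum.cong sum.neutral)

lemma T_delta: "i \<noteq> 0 \<Longrightarrow> T (delta i) = 1"
proof (rule antisym)
  assume "i \<noteq> 0"
  then have "l1 (delta i) = 1" by (simp add: l1_def supp_def)
  then show "T (delta i) \<le> 1" using T_le_l1[of "delta i"] by simp
  show "1 \<le> T (delta i)" using coord_le_T[of "delta i" i] \<open>i \<noteq> 0\<close> by simp
qed

text \<open>Moving coefficients left from \<open>q\<close> to \<open>p\<close> may spoil
  admissibility; giving up one coefficient \<open>b n\<close> repairs this. In a family on the
  \<open>q\<close> side every member loses, by induction, one coefficient \<open>b (n E)\<close> and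
  keeps a tail at \<open>p\<close>. Let \<open>n E1\<close> be the least index lost. The tails, and
  the coefficients lost by the other members as singletons, lie beyond \<open>n E1\<close>; they are
  fewer than twice as many as the members, so by sparseness they are admissible at \<open>p\<close>.
  The factor 1/2 of the norm leaves room for \<open>b (n E1)\<close>.\<close>

lemma T_vec_shift:
  assumes "finite K" "K \<noteq> {}" and b: "\<And>k. k \<in> K \<Longrightarrow> 0 \<le> b k"
    and pq: "\<And>k. k \<in> K \<Longrightarrow> 0 < p k \<and> p k \<le> q k"
    and sparse: "\<And>k k'. k \<in> K \<Longrightarrow> k' \<in> K \<Longrightarrow> k < k' \<Longrightarrow> 2 * q k \<le> p k'"
  shows "\<exists>n\<in>K. T (vec q K b) \<le> b n + T (vec p {k \<in> K. n < k} b)"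
  using assms
proof (induction "card K" arbitrary: K rule: less_induct)
  case less
  note fin = less.prems(1) and b = less.prems(3) and pq = less.prems(4) and sparse = less.prems(5)
  have mono: "q k < q k'" "p k < p k'" if "k \<in> K" "k' \<in> K" "k < k'" for k k'
    using pq[OF that(1)] pq[OF that(2)] sparse[OF that] by linarith+
  have inj: "inj_on q K" "inj_on p K" using mono by (auto intro!: linorder_inj_onI less_imp_neq)
  define f where "f n = b n + T (vec p {k \<in> K. n < k} b)" for n
  define r where "r = Max (f ` K)"
  have r: "f n \<le> r" if "n \<in> K" for n using that fin by (simp add: r_def)
  have "r \<in> f ` K" unfolding r_def using fin less.prems(2) by (intro Max_in) auto
  then obtain n0 where n0: "n0 \<in> K" "r = f n0" by blast
  have br: "b n \<le> r" if "n \<in> K" for n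
    using r[OF that] T_nonneg[of "vec p {k \<in> K. n < k} b"] by (simp add: f_def)
  have "0 \<le> r" using br[OF n0(1)] b[OF n0(1)] by linarith
  have "T (vec q K b) \<le> r"
  proof (rule T_leI)
    fix i show "\<bar>coord (vec q K b) i\<bar> \<le> r"
    proof (cases "i \<in> q ` K")
      case True
      then obtain k where "k \<in> K" "i = q k" by blast
      then show ?thesis using br b pq[of k] coord_vec_image[OF fin inj(1), of k b] by simp
    qed (simp add: coord_vec_notin \<open>0 \<le> r\<close>)
  next
    fix \<E> assume fam: "separated_family (supp (vec q K b)) \<E>"
    have supp: "supp (vec q K b) \<subseteq> q ` K" using coord_vec_notin[of _ q K b] by (fastforce simp: supp_def)
    define KE where "KE E = {k \<in> K. q k \<in> E}" for E
    have ex: "\<exists>n\<in>KE E. T (restr E (vec q K b)) \<le> b n + T (vec p {k \<in> KE E. n < k} b)" if "E \<in> \<E>" for E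
    proof -
      have E: "E \<subset> supp (vec q K b)" "E \<noteq> {}" using fam that by (auto simp: separated_family_def)
      then obtain j where j: "j \<in> supp (vec q K b)" "j \<notin> E" by blast
      then obtain k where "k \<in> K" "j = q k" using supp by blast
      then have "KE E \<subset> K" using j by (auto simp: KE_def)
      moreover have "KE E \<noteq> {}" using E supp by (auto simp: KE_def)
      ultimately show ?thesis
        unfolding restr_vec[OF fin] KE_def[symmetric]
        using fin b pq sparse by (intro less.hyps psubset_card_mono) (auto simp: KE_def)
    qed
    show "(\<Sum>E\<in>\<E>. T (restr E (vec q K b))) \<le> 2 * r"
    proof (cases "\<E> = {}")
      case True then show ?thesis using \<open>0 \<le> r\<close> by simp
    next
      case False
      obtain n where n: "\<And>E. E \<in> \<E> \<Longrightarrow> n E \<in> KE E"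
        "\<And>E. E \<in> \<E> \<Longrightarrow> T (restr E (vec q K b)) \<le> b (n E) + T (vec p {k \<in> KE E. n E < k} b)"
        using ex by metis
      have fE: "finite \<E>" using fam by (simp add: separated_family_def)
      obtain E1 where E1: "E1 \<in> \<E>" "\<And>E. E \<in> \<E> \<Longrightarrow> n E1 \<le> n E"
        using arg_min_if_finite(1)[OF fE False, of n] arg_min_least[OF fE False, of _ n] by blast
      define K' where "K' = {k \<in> K. n E1 < k}"
      define y where "y = vec p K' b"
      have nK: "n E \<in> K" "q (n E) \<in> E" if "E \<in> \<E>" for E using n(1)[OF that] by (auto simp: KE_def)
      have later: "n E1 < k" if "E \<in> \<E>" "E \<noteq> E1" "k \<in> KE E" for E k
      proof -
        have sep: "separated E1 E" using fam that E1 by (auto simp: separated_family_def)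
        then have "n E1 \<noteq> n E" using nK[OF E1(1)] nK[OF that(1)] separated_disjoint by force
        then have "q (n E1) < q (n E)" using E1(2)[OF that(1)] mono nK E1(1) that(1) by simp
        then have "q (n E1) < q k"
          using sep that(3) nK[OF E1(1)] nK[OF that(1)] unfolding separated_def KE_def by force
        moreover from this have "\<not> k < n E1"
          using mono(1)[of k "n E1"] nK[OF E1(1)] that(3) by (auto simp: KE_def)
        ultimately show ?thesis by (metis less_irrefl linorder_neqE_nat)
      qed
      have sepK: "separated (p ` KE E) (p ` KE E')" if "E \<in> \<E>" "E' \<in> \<E>" "E \<noteq> E'" for E E'
      proof -
        have "separated E E'" using fam that by (auto simp: separated_family_def)
        moreover have "p k < p k'" if "q k < q k'" "k \<in> K" "k' \<in> K" for k k'
          using that mono[of k' k] mono[of k k'] by (cases k k' rule: linorder_cases) auto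
        ultimately show ?thesis unfolding separated_def KE_def by auto
      qed
      \<comment> \<open>\<open>Inl\<close> stands for the tails and \<open>Inr\<close> for the
        singletons of lost coefficients. The index set used below omits \<open>Inr E1\<close>, since
        \<open>b (n E1)\<close> is the coefficient given up.\<close>
      define F where "F = case_sum (\<lambda>E. p ` {k \<in> KE E. n E < k}) (\<lambda>E. {p (n E)})"
      have Fsub: "F (Inl E) \<subseteq> p ` KE E" "F (Inr E) \<subseteq> p ` KE E" if "E \<in> \<E>" for E
        using n(1)[OF that] by (auto simp: F_def)
      have sepF: "separated (F j) (F k)" if jk: "j \<in> \<E> <+> (\<E> - {E1})" "k \<in> \<E> <+> (\<E> - {E1})" "j \<noteq> k" for j k
      proof -
        obtain E where E: "E \<in> \<E>" "j = Inl E \<or> j = Inr E" using jk(1) by auto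
        obtain E' where E': "E' \<in> \<E>" "k = Inl E' \<or> k = Inr E'" using jk(2) by auto
        show ?thesis
        proof (cases "E = E'")
          case True
          have "p (n E) < p k" if "k \<in> KE E" "n E < k" for k
            using mono(2)[of "n E" k] that nK[OF E(1)] by (auto simp: KE_def)
          then show ?thesis using True E E' jk(3) by (auto simp: F_def separated_def)
        next
          case False
          have "F j \<subseteq> p ` KE E" "F k \<subseteq> p ` KE E'" using E(2) E'(2) Fsub[OF E(1)] Fsub[OF E'(1)] by auto
          then show ?thesis by (rule separated_mono[OF sepK[OF E(1) E'(1) False]])
        qed
      qed
      have FK: "F j \<subseteq> p ` K'" if j: "j \<in> \<E> <+> (\<E> - {E1})" for j
        using j
      proof (rule PlusE)
        fix E assume E: "E \<in> \<E>" "j = Inl E"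
        have "n E1 \<le> n E" using E1(2) E by blast
        then show ?thesis by (auto simp: E(2) F_def K'_def KE_def)
      next
        fix E assume E: "E \<in> \<E> - {E1}" "j = Inr E"
        then show ?thesis using later[of E "n E"] n(1)[of E] by (auto simp: F_def K'_def KE_def)
      qed
      have cd: "card (\<E> <+> (\<E> - {E1})) \<le> a" if ja: "j \<in> \<E> <+> (\<E> - {E1})" "a \<in> F j" for j a
      proof -
        obtain k where k: "k \<in> K" "n E1 < k" "a = p k" using FK[OF ja(1)] ja(2) by (auto simp: K'_def)
        have "card (\<E> <+> (\<E> - {E1})) \<le> 2 * card \<E>"
          using fE card_mono[of \<E> "\<E> - {E1}"] by (simp add: card_Plus)
        also have "card \<E> \<le> q (n E1)" using fam E1 nK by (auto simp: separated_family_def)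
        then have "2 * card \<E> \<le> 2 * q (n E1)" by simp
        also have "\<dots> \<le> a" using sparse k nK[OF E1(1)] by simp
        finally show ?thesis .
      qed
      have finK: "finite (KE E)" "finite K'" for E using fin by (auto simp: KE_def K'_def)
      have "(\<Sum>j\<in>\<E> <+> (\<E> - {E1}). T (restr (F j) y)) \<le> 2 * T y"
      proof (rule T_family)
        show "finite (F j)" if "j \<in> \<E> <+> (\<E> - {E1})" for j
          using FK[OF that] finK(2) finite_subset by blast
      qed (use fE sepF cd in auto)
      moreover have "(\<Sum>j\<in>\<E> <+> (\<E> - {E1}). T (restr (F j) y))
          = (\<Sum>E\<in>\<E>. T (restr (F (Inl E)) y)) + (\<Sum>E\<in>\<E> - {E1}. T (restr (F (Inr E)) y))"
        using fE by (simp add: sum.Plus)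
      moreover have "T (restr (F (Inl E)) y) = T (vec p {k \<in> KE E. n E < k} b)" if "E \<in> \<E>" for E
      proof -
        have "{k \<in> K'. p k \<in> F (Inl E)} = {k \<in> KE E. n E < k}"
          using inj(2) E1(2)[OF that] by (auto simp: F_def K'_def KE_def inj_on_def)
        then show ?thesis by (simp add: y_def restr_vec[OF finK(2)])
      qed
      moreover have "T (restr (F (Inr E)) y) \<ge> b (n E)" if "E \<in> \<E> - {E1}" for E
      proof -
        have nE: "n E \<in> K'" using that later[of E "n E"] n(1)[of E] by (auto simp: K'_def KE_def)
        have "coord (restr (F (Inr E)) y) (p (n E)) = b (n E)"
          using coord_vec_image[OF finK(2) _ nE, of p b] pq[of "n E"] nE inj(2)
          by (auto simp: F_def y_def K'_def intro: inj_on_subset)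
        then show ?thesis using coord_le_T[of "restr (F (Inr E)) y" "p (n E)"] by linarith
      qed
      then have "(\<Sum>E\<in>\<E> - {E1}. b (n E)) \<le> (\<Sum>E\<in>\<E> - {E1}. T (restr (F (Inr E)) y))"
        by (rule sum_mono)
      moreover have "(\<Sum>E\<in>\<E>. T (restr E (vec q K b))) \<le> (\<Sum>E\<in>\<E>. b (n E) + T (vec p {k \<in> KE E. n E < k} b))"
        using n(2) by (rule sum_mono)
      moreover have "(\<Sum>E\<in>\<E>. b (n E)) = b (n E1) + (\<Sum>E\<in>\<E> - {E1}. b (n E))"
        using fE E1(1) by (rule sum.remove)
      ultimately have "(\<Sum>E\<in>\<E>. T (restr E (vec q K b))) \<le> b (n E1) + 2 * T y"
        by (simp add: sum.distrib)
      also have "\<dots> \<le> 2 * f (n E1)" using b[OF nK(1)[OF E1(1)]] by (simp add: f_def y_def K'_def)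
      also have "\<dots> \<le> 2 * r" using r[OF nK(1)[OF E1(1)]] by simp
      finally show ?thesis .
    qed
  qed
  then show ?case using n0 by (auto simp: f_def)
qed

section \<open>Concentrating blocks on single coordinates\<close>

lemma l1_superset: "finite A \<Longrightarrow> supp x \<subseteq> A \<Longrightarrow> l1 x = (\<Sum>i\<in>A. \<bar>coord x i\<bar>)"
  unfolding l1_def by (rule sum.mono_neutral_left) (auto simp: supp_def)

text \<open>There are at most \<open>a\<close> coordinates, all from \<open>a\<close> on, so the
  singletons of the support form an admissible family.\<close>

lemma l1_le_2T:
  assumes "supp v \<subseteq> {a..<2*a}" shows "l1 v \<le> 2 * T v"
proof -
  have "(\<Sum>i\<in>supp v. T (restr {i} v)) \<le> 2 * T v"
  proof (rule T_family)
    fix i j assume "i \<in> supp v" "j \<in> {i}"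
    moreover have "card (supp v) \<le> a" using card_mono[OF _ assms] by simp
    ultimately show "card (supp v) \<le> j" using assms by auto
  qed (auto simp: finite_supp separated_def)
  moreover have "\<bar>coord v i\<bar> \<le> T (restr {i} v)" for i
    using coord_le_T[of "restr {i} v" i] by simp
  then have "l1 v \<le> (\<Sum>i\<in>supp v. T (restr {i} v))" unfolding l1_def by (intro sum_mono)
  ultimately show ?thesis by linarith
qed

lemma l1_le_6T:
  assumes "supp v \<subseteq> {a..<8*a}" shows "l1 v \<le> 6 * T v"
proof -
  let ?A = "{a..<2*a}" and ?B = "{2*a..<4*a}" and ?C = "{4*a..<8*a}"
  have "l1 v = (\<Sum>i\<in>supp v. \<bar>coord v i\<bar>)" by (simp add: l1_def)
  also have "\<dots> = (\<Sum>i\<in>supp v. \<bar>coord (restr ?A v) i\<bar> + \<bar>coord (restr ?B v) i\<bar> + \<bar>coord (restr ?C v) i\<bar>)"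
    using assms by (intro sum.cong refl) auto
  also have "\<dots> = l1 (restr ?A v) + l1 (restr ?B v) + l1 (restr ?C v)"
    using l1_superset[of "supp v"] by (simp add: finite_supp supp_restr sum.distrib)
  also have "\<dots> \<le> 2 * T (restr ?A v) + 2 * T (restr ?B v) + 2 * T (restr ?C v)"
    using l1_le_2T[of "restr ?A v" a] l1_le_2T[of "restr ?B v" "2*a"] l1_le_2T[of "restr ?C v" "4*a"]
    by (intro add_mono) (auto simp: supp_restr)
  also have "\<dots> \<le> 6 * T v" using T_restr_le[of ?A v] T_restr_le[of ?B v] T_restr_le[of ?C v] by linarith
  finally show ?thesis .
qed

lemma vec_subset_le:
  assumes "finite K" "K' \<subseteq> K" "inj_on p K"
  shows "T (vec p K' b) \<le> T (vec p K b)"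
proof -
  have "{k \<in> K. p k \<in> p ` K'} = K'" using assms(2,3) by (auto simp: inj_on_def)
  then show ?thesis using T_restr_le[of "p ` K'" "vec p K b"] by (simp add: restr_vec[OF assms(1)])
qed

text \<open>The label of \<open>i\<close> is its block, and \<open>pos\<close> gives the coordinate
  that represents a block. The factor 8 comes from the merged block \<open>{1..7}\<close>, whose
  first element is 1. A coordinate of block \<open>k\<close> is below \<open>8 * pos k\<close>, so
  \<open>16 = 2 * 8\<close> is the gap that \<open>T_vec_shift\<close> asks for, available between
  labels four apart. Labels may be skipped, as merging does.\<close>

locale labelling =
  fixes c pos :: "nat \<Rightarrow> nat"
  assumes pos_pos: "0 < pos k"
    and pos_strict: "k < k' \<Longrightarrow> pos k < pos k'"
    and pos_sparse: "k + 4 \<le> k' \<Longrightarrow> 16 * pos k \<le> pos k'"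
    and label_mono: "0 < i \<Longrightarrow> i \<le> j \<Longrightarrow> c i \<le> c j"
    and pos_label_le: "0 < i \<Longrightarrow> pos (c i) \<le> i"
    and less_pos_label: "0 < i \<Longrightarrow> i < 8 * pos (c i)"
begin

definition fib :: "nat \<Rightarrow> nat set" where "fib k = {i. 0 < i \<and> c i = k}"

lemma fib_iff: "i \<in> fib k \<longleftrightarrow> 0 < i \<and> c i = k" by (simp add: fib_def)

lemma finite_fib [simp]: "finite (fib k)"
  by (rule finite_subset[of _ "{..<8 * pos k}"]) (auto simp: fib_def dest: less_pos_label)

definition mass :: "c00 \<Rightarrow> nat \<Rightarrow> real" where "mass y k = (\<Sum>i\<in>fib k. coord y i)"

lemma inj_pos: "inj_on pos A"
  using pos_strict by (auto intro!: linorder_inj_onI less_imp_neq)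

lemma supp_pos: "i \<in> supp y \<Longrightarrow> 0 < i"
  by (cases i) (auto simp: supp_def)

lemma mass_add: "mass (x + y) k = mass x k + mass y k"
  by (simp add: mass_def sum.distrib)

lemma mass_scale: "mass (a *\<^sub>R x) k = a * mass x k"
  by (simp add: mass_def sum_distrib_left)

lemma mass_delta: "0 < i \<Longrightarrow> mass (delta i) k = (if c i = k then 1 else 0)"
proof -
  assume "0 < i"
  then have "mass (delta i) k = (\<Sum>j\<in>fib k. if j = i then 1 else 0)"
    unfolding mass_def by (intro sum.cong) (auto simp: fib_def)
  then show ?thesis using \<open>0 < i\<close> by (simp add: fib_iff)
qed

text \<open>By convexity, moving the mass of two coordinates with the same label onto one of them
  does not decrease the norm in at least one of the two ways.\<close>

lemma concentrate:
  assumes "\<And>i. 0 \<le> coord y i"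
  shows "\<exists>z. (\<forall>i. 0 \<le> coord z i) \<and> supp z \<subseteq> supp y \<and> inj_on c (supp z) \<and> mass z = mass y \<and> T y \<le> T z"
  using assms
proof (induction "card (supp y)" arbitrary: y rule: less_induct)
  case less
  show ?case
  proof (cases "inj_on c (supp y)")
    case True with less.prems show ?thesis by blast
  next
    case False
    then obtain i j where ij: "i \<in> supp y" "j \<in> supp y" "i \<noteq> j" "c i = c j" by (auto simp: inj_on_def)
    define move where "move i j = y + coord y j *\<^sub>R (delta i + (-1) *\<^sub>R delta j)" for i j
    have step: "\<exists>z. (\<forall>i. 0 \<le> coord z i) \<and> supp z \<subseteq> supp y \<and> inj_on c (supp z) \<and> mass z = mass y \<and> T y \<le> T z"
      if ij: "i \<in> supp y" "j \<in> supp y" "i \<noteq> j" "c i = c j" and le: "T y \<le> T (move i j)" for i j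
    proof -
      have "coord (move i j) j = 0" using ij supp_pos[OF ij(2)] by (simp add: move_def)
      then have "supp (move i j) \<subset> supp y" using ij by (auto simp: move_def supp_def split: if_splits)
      then have sub: "supp (move i j) \<subseteq> supp y" "card (supp (move i j)) < card (supp y)"
        by (auto intro: psubset_card_mono finite_supp)
      have nn: "0 \<le> coord (move i j) k" for k using less.prems ij(3) by (auto simp: move_def)
      have ms: "mass (move i j) = mass y"
        using ij supp_pos[OF ij(1)] supp_pos[OF ij(2)]
        by (intro ext) (simp only: move_def mass_add mass_scale mass_delta, simp)
      from less.hyps[OF sub(2) nn] obtain z where
        "\<forall>i. 0 \<le> coord z i" "supp z \<subseteq> supp (move i j)" "inj_on c (supp z)" "mass z = mass (move i j)" "T (move i j) \<le> T z"
        by blast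
      then show ?thesis using sub(1) ms le by (intro exI[of _ z]) auto
    qed
    define s where "s = coord y i + coord y j"
    have pos: "0 < coord y i" "0 < coord y j" using ij less.prems by (auto simp: supp_def less_le)
    have "y = (coord y i / s) *\<^sub>R move i j + (coord y j / s) *\<^sub>R move j i"
    proof (rule c00_eqI)
      fix k
      define \<alpha> \<beta> d where "\<alpha> = coord y i / s" "\<beta> = coord y j / s" "d = coord (delta i + (-1) *\<^sub>R delta j) k"
      have d: "coord (delta j + (-1) *\<^sub>R delta i) k = - d" by (simp add: \<alpha>_\<beta>_d_def)
      have "\<alpha> + \<beta> = 1" "\<alpha> * coord y j = \<beta> * coord y i"
        using pos by (simp_all add: \<alpha>_\<beta>_d_def s_def add_divide_distrib[symmetric])
      moreover have "coord ((coord y i / s) *\<^sub>R move i j + (coord y j / s) *\<^sub>R move j i) k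
          = \<alpha> * (coord y k + coord y j * d) + \<beta> * (coord y k + coord y i * - d)"
        unfolding move_def coord_add[of "_ *\<^sub>R _" "_ *\<^sub>R _"] coord_scale[of _ "_ + _"] coord_add[of y] d
        by (simp only: \<alpha>_\<beta>_d_def)
      moreover have "\<alpha> * (coord y k + coord y j * d) + \<beta> * (coord y k + coord y i * - d)
          = (\<alpha> + \<beta>) * coord y k + (\<alpha> * coord y j - \<beta> * coord y i) * d"
        by (simp add: algebra_simps)
      ultimately show "coord y k = coord ((coord y i / s) *\<^sub>R move i j + (coord y j / s) *\<^sub>R move j i) k"
        by simp
    qed
    then have "T y \<le> (coord y i / s) * T (move i j) + (coord y j / s) * T (move j i)"
      using T_add[of "(coord y i / s) *\<^sub>R move i j" "(coord y j / s) *\<^sub>R move j i"] pos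
      by (simp add: T_scale s_def)
    also have "\<dots> \<le> (coord y i / s) * max (T (move i j)) (T (move j i)) + (coord y j / s) * max (T (move i j)) (T (move j i))"
      using pos by (intro add_mono mult_left_mono) (auto simp: s_def)
    also have "\<dots> = max (T (move i j)) (T (move j i))"
      using pos by (simp add: s_def add_divide_distrib[symmetric] distrib_right[symmetric])
    finally consider "T y \<le> T (move i j)" | "T y \<le> T (move j i)" by (auto simp: max_def split: if_splits)
    then show ?thesis using step[of i j] step[of j i] ij by cases auto
  qed
qed

text \<open>Concentration leaves at most one coordinate \<open>q k\<close> per block. Labels in one
  residue class modulo 4 are sparse enough to shift these to \<open>pos k\<close>, and both terms of
  the shift estimate are at most the target norm: a constant 2 for each of four classes.\<close>

lemma T_le_mass:
  assumes nn: "\<And>i. 0 \<le> coord y i" and K: "finite K" "c ` supp y \<subseteq> K"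
  shows "T y \<le> 8 * T (vec pos K (mass y))"
proof -
  obtain z where z: "\<And>i. 0 \<le> coord z i" "supp z \<subseteq> supp y" "inj_on c (supp z)" "mass z = mass y" "T y \<le> T z"
    using concentrate[OF nn] by blast
  define K' where "K' = c ` supp z"
  define q where "q = inv_into (supp z) c"
  have K': "finite K'" "K' \<subseteq> K" using z(2) K finite_supp by (auto simp: K'_def)
  have q12: "q k \<in> supp z" "c (q k) = k" if "k \<in> K'" for k
    using that unfolding q_def K'_def by (auto intro: inv_into_into f_inv_into_f)
  note q = q12 supp_pos[OF q12(1)]
  have qc: "q (c i) = i" if "i \<in> supp z" for i using that z(3) by (simp add: q_def)
  have injq: "inj_on q K'" unfolding q_def K'_def by (rule inj_on_inv_into) simp
  have nnm: "0 \<le> mass z k" for k by (simp add: mass_def sum_nonneg z(1))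
  have zvec: "z = vec q K' (mass z)"
  proof (rule c00_eqI)
    fix i show "coord z i = coord (vec q K' (mass z)) i"
    proof (cases "i \<in> supp z")
      case True
      then have "mass z (c i) = (\<Sum>j\<in>fib (c i). if j = i then coord z i else 0)"
        using z(3) unfolding mass_def by (intro sum.cong) (auto simp: fib_def inj_on_def supp_def)
      also have "\<dots> = coord z i" using supp_pos[OF True] by (simp add: fib_iff)
      finally have "mass z (c i) = coord z i" .
      moreover have "c i \<in> K'" using True by (auto simp: K'_def)
      from coord_vec_image[OF K'(1) injq this, of "mass z"]
      have "coord (vec q K' (mass z)) i = mass z (c i)" using q[OF \<open>c i \<in> K'\<close>] qc[OF True] by simp
      ultimately show ?thesis by simp
    next
      case False
      then have "i \<notin> q ` K'" using q by blast
      then show ?thesis using False by (simp add: coord_vec_notin supp_def)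
    qed
  qed
  have part: "T (vec q {k \<in> K'. k mod 4 = r} (mass z)) \<le> 2 * T (vec pos K (mass z))" for r
  proof (cases "{k \<in> K'. k mod 4 = r} = {}")
    case True
    show ?thesis unfolding True by (simp add: vec_def T_nonneg)
  next
    case False
    let ?K = "{k \<in> K'. k mod 4 = r}"
    have "\<exists>n\<in>?K. T (vec q ?K (mass z)) \<le> mass z n + T (vec pos {k \<in> ?K. n < k} (mass z))"
    proof (rule T_vec_shift[OF _ False])
      fix k k' assume k: "k \<in> ?K" "k' \<in> ?K" "k < k'"
      have "k + 4 \<le> k'"
      proof (rule ccontr)
        assume "\<not> k + 4 \<le> k'"
        then have "0 < k' - k" "k' - k < 4" using k(3) by auto
        moreover have "4 dvd k' - k" using k by (intro mod_eq_dvd_iff_nat[THEN iffD1]) auto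
        ultimately show False using nat_dvd_not_less by blast
      qed
      then have "16 * pos k \<le> pos k'" by (rule pos_sparse)
      moreover have "q k < 8 * pos k" using less_pos_label[of "q k"] q k by auto
      ultimately show "2 * q k \<le> pos k'" by simp
    qed (use K'(1) nnm pos_pos pos_label_le q in auto, metis pos_label_le q(2,3))
    then obtain n where n: "n \<in> ?K" "T (vec q ?K (mass z)) \<le> mass z n + T (vec pos {k \<in> ?K. n < k} (mass z))"
      by blast
    have "mass z n \<le> T (vec pos K (mass z))"
      using coord_vec_image[OF K(1) inj_pos, of n "mass z"] coord_le_T[of "vec pos K (mass z)" "pos n"] n(1) K'(2) pos_pos[of n]
      by auto
    moreover have "T (vec pos {k \<in> ?K. n < k} (mass z)) \<le> T (vec pos K (mass z))"
      using K' by (intro vec_subset_le K(1) inj_pos) auto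
    ultimately show ?thesis using n(2) by linarith
  qed
  have "z = (\<Sum>r<4. vec q {k \<in> K'. k mod 4 = r} (mass z))"
    by (subst zvec, unfold vec_def, rule sum.group[symmetric]) (use K'(1) in auto)
  then have "T z \<le> (\<Sum>r<4. T (vec q {k \<in> K'. k mod 4 = r} (mass z)))"
    using T_sum[of "\<lambda>r. vec q {k \<in> K'. k mod 4 = r} (mass z)" "{..<4}"] by simp
  also have "\<dots> \<le> (\<Sum>r<(4::nat). 2 * T (vec pos K (mass z)))" by (intro sum_mono part)
  also have "\<dots> = 8 * T (vec pos K (mass z))" by simp
  finally show ?thesis using z(4,5) by simp
qed

lemma mass_le_T: "\<bar>mass y k\<bar> \<le> 6 * T (restr (fib k) y)"
proof -
  have "\<bar>mass y k\<bar> \<le> (\<Sum>i\<in>fib k. \<bar>coord (restr (fib k) y) i\<bar>)"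
    unfolding mass_def by (rule order_trans[OF sum_abs]) (simp cong: sum.cong)
  also have "\<dots> = l1 (restr (fib k) y)" by (rule l1_superset[symmetric]) (auto simp: supp_restr)
  also have "\<dots> \<le> 6 * T (restr (fib k) y)"
    by (rule l1_le_6T[of _ "pos k"]) (auto simp: supp_restr fib_def intro: pos_label_le dest: less_pos_label)
  finally show ?thesis .
qed

text \<open>A family on the positions \<open>pos k\<close> pulls back to a family of coordinates
  with the labels concerned. It stays admissible because no coordinate lies to the left of the
  position of its block. So the recursion reproduces the constant 6, which enters only for single
  positions, through the l1 norm of a block.\<close>

lemma mass_le_T_aux:
  assumes "finite K"
  shows "T (vec pos K (mass y)) \<le> 6 * T (restr {i. c i \<in> K} y)"
  using assms
proof (induction "card K" arbitrary: K rule: less_induct)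
  case less
  note fin = less.prems
  let ?y = "restr {i. c i \<in> K} y"
  show ?case
  proof (rule T_leI)
    fix i show "\<bar>coord (vec pos K (mass y)) i\<bar> \<le> 6 * T ?y"
    proof (cases "i \<in> pos ` K")
      case True
      then obtain k where k: "k \<in> K" "i = pos k" by blast
      have "T (restr (fib k) y) \<le> T ?y" using k(1) by (intro T_mono) (auto simp: fib_def)
      then show ?thesis using mass_le_T[of y k] coord_vec_image[OF fin inj_pos k(1), of "mass y"] k pos_pos[of k] by simp
    qed (simp add: coord_vec_notin T_nonneg)
  next
    fix \<E> assume fam: "separated_family (supp (vec pos K (mass y))) \<E>"
    have supp: "supp (vec pos K (mass y)) \<subseteq> pos ` K"
      using coord_vec_notin[of _ pos K "mass y"] by (fastforce simp: supp_def)
    define KE where "KE E = {k \<in> K. pos k \<in> E}" for E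
    have "T (restr E (vec pos K (mass y))) \<le> 6 * T (restr {i \<in> supp y. c i \<in> KE E} ?y)" if "E \<in> \<E>" for E
    proof -
      have "E \<subset> supp (vec pos K (mass y))" using fam that by (auto simp: separated_family_def)
      then obtain j where j: "j \<in> supp (vec pos K (mass y))" "j \<notin> E" by blast
      then obtain k where "k \<in> K" "j = pos k" using supp by blast
      then have "KE E \<subset> K" using j by (auto simp: KE_def)
      then have "T (vec pos (KE E) (mass y)) \<le> 6 * T (restr {i. c i \<in> KE E} y)"
        using fin by (intro less.hyps psubset_card_mono) (auto simp: KE_def)
      moreover have "restr {i. c i \<in> KE E} y = restr {i \<in> supp y. c i \<in> KE E} ?y"
        by (rule c00_eqI) (auto simp: KE_def supp_def)
      ultimately show ?thesis by (simp add: restr_vec[OF fin] KE_def[symmetric])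
    qed
    then have "(\<Sum>E\<in>\<E>. T (restr E (vec pos K (mass y)))) \<le> 6 * (\<Sum>E\<in>\<E>. T (restr {i \<in> supp y. c i \<in> KE E} ?y))"
      unfolding sum_distrib_left by (rule sum_mono)
    also have "(\<Sum>E\<in>\<E>. T (restr {i \<in> supp y. c i \<in> KE E} ?y)) \<le> 2 * T ?y"
    proof (rule T_family)
      show "finite \<E>" using fam by (simp add: separated_family_def)
      fix E assume E: "E \<in> \<E>"
      show "finite {i \<in> supp y. c i \<in> KE E}" by (simp add: finite_supp)
      fix i assume i: "i \<in> {i \<in> supp y. c i \<in> KE E}"
      then have "card \<E> \<le> pos (c i)" using fam E by (auto simp: separated_family_def KE_def)
      also have "\<dots> \<le> i" using pos_label_le supp_pos i by blast
      finally show "card \<E> \<le> i" .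
    next
      fix E F assume EF: "E \<in> \<E>" "F \<in> \<E>" "E \<noteq> F"
      then have "separated E F" using fam by (auto simp: separated_family_def)
      moreover have "i < j" if "pos (c i) < pos (c j)" "i \<in> supp y" "j \<in> supp y" for i j
      proof (rule ccontr)
        assume "\<not> i < j"
        then have "c j \<le> c i" using label_mono[of j i] supp_pos[OF that(3)] by simp
        then show False using that(1) pos_strict[of "c j" "c i"] by (auto simp: le_less)
      qed
      ultimately show "separated {i \<in> supp y. c i \<in> KE E} {i \<in> supp y. c i \<in> KE F}"
        unfolding separated_def KE_def by auto
    qed
    finally show "(\<Sum>E\<in>\<E>. T (restr E (vec pos K (mass y)))) \<le> 2 * (6 * T ?y)" by simp
  qed
qed

lemma T_mass_le:
  assumes "finite K" shows "T (vec pos K (mass y)) \<le> 6 * T y"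
  using mass_le_T_aux[OF assms, of y] T_restr_le[of "{i. c i \<in> K}" y] by linarith

end

section \<open>No domination of the l1 norm on infinite coordinate sets\<close>

lemma l1_add:
  assumes "\<And>i. 0 \<le> coord x i" "\<And>i. 0 \<le> coord y i"
  shows "l1 (x + y) = l1 x + l1 y"
proof -
  have f: "finite (supp x \<union> supp y)" by (simp add: finite_supp)
  have "l1 (x + y) = (\<Sum>i\<in>supp x \<union> supp y. \<bar>coord (x + y) i\<bar>)"
    by (rule l1_superset[OF f]) (auto simp: supp_def)
  also have "\<dots> = (\<Sum>i\<in>supp x \<union> supp y. \<bar>coord x i\<bar> + \<bar>coord y i\<bar>)"
    using assms by (intro sum.cong refl) auto
  also have "\<dots> = l1 x + l1 y"
    using l1_superset[OF f, of x] l1_superset[OF f, of y] by (simp add: sum.distrib)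
  finally show ?thesis .
qed

lemma l1_scale: "l1 (a *\<^sub>R x) = \<bar>a\<bar> * l1 x"
proof -
  have "l1 (a *\<^sub>R x) = (\<Sum>i\<in>supp x. \<bar>coord (a *\<^sub>R x) i\<bar>)"
    by (rule l1_superset[OF finite_supp]) (auto simp: supp_def)
  then show ?thesis by (simp add: l1_def abs_mult sum_distrib_left)
qed

lemma l1_sum:
  assumes "\<And>j i. 0 \<le> coord (f j) i"
  shows "l1 (\<Sum>j\<in>J. f j) = (\<Sum>j\<in>J. l1 (f j))"
proof (induction J rule: infinite_finite_induct)
  case (insert j J)
  then show ?case using assms by (simp add: l1_add coord_sum sum_nonneg)
qed (simp_all add: l1_def supp_def)

lemma restr_sum: "restr E (\<Sum>j\<in>J. f j) = (\<Sum>j\<in>J. restr E (f j))"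
  by (rule c00_eqI) (simp add: coord_sum)

text \<open>Send \<open>(E, i)\<close> to \<open>E\<close> if \<open>i\<close> is the first index
  whose \<open>D i\<close> meets \<open>E\<close>, and to \<open>i\<close> otherwise. Two sets sent
  to the same \<open>i\<close> both meet \<open>D i\<close> and an earlier set, so neither precedes
  the other; by separation they are equal.\<close>

lemma card_incidences_le:
  fixes D :: "nat \<Rightarrow> nat set"
  assumes fin: "finite \<E>" "finite I"
    and sep: "\<And>E F. E \<in> \<E> \<Longrightarrow> F \<in> \<E> \<Longrightarrow> E \<noteq> F \<Longrightarrow> separated E F"
    and D: "\<And>i j a b. i < j \<Longrightarrow> a \<in> D i \<Longrightarrow> b \<in> D j \<Longrightarrow> a < b"
  shows "card {(E, i). E \<in> \<E> \<and> i \<in> I \<and> E \<inter> D i \<noteq> {}} \<le> card \<E> + card I"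
proof -
  define S where "S = {(E, i). E \<in> \<E> \<and> i \<in> I \<and> E \<inter> D i \<noteq> {}}"
  define least where "least E i \<longleftrightarrow> (\<forall>i'\<in>I. E \<inter> D i' \<noteq> {} \<longrightarrow> i \<le> i')" for E i
  define h where "h = (\<lambda>(E, i). if least E i then Inl E else Inr i)"
  have "inj_on h S"
  proof (rule inj_onI)
    fix s t assume st: "s \<in> S" "t \<in> S" "h s = h t"
    obtain E i E' i' where eq: "s = (E, i)" "t = (E', i')" by (cases s, cases t) auto
    show "s = t"
    proof (cases "least E i")
      case True
      then have "E = E'" "least E' i'" using st(3) by (auto simp: h_def eq split: if_splits)
      then show ?thesis using True st(1,2) by (auto simp: least_def eq S_def intro: le_antisym)
    next
      case False
      then have "i = i'" "\<not> least E' i'" using st(3) by (auto simp: h_def eq split: if_splits)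
      then obtain a b where ab: "a < i" "E \<inter> D a \<noteq> {}" "b < i" "E' \<inter> D b \<noteq> {}"
        using False by (auto simp: least_def not_le)
      then obtain x x' y y' where xy: "x \<in> E" "x \<in> D i" "x' \<in> E" "x' \<in> D a"
        "y \<in> E'" "y \<in> D i" "y' \<in> E'" "y' \<in> D b"
        using st(1,2) \<open>i = i'\<close> by (auto simp: S_def eq)
      then have "x' < y" "y' < x" using D ab by blast+
      then have "\<not> separated E E'" using xy unfolding separated_def by (meson less_asym)
      then have "E = E'" using sep st(1,2) by (auto simp: S_def eq)
      then show ?thesis using \<open>i = i'\<close> eq by simp
    qed
  qed
  moreover have "h ` S \<subseteq> \<E> <+> I" by (auto simp: h_def S_def split: if_splits)
  ultimately have "card S \<le> card (\<E> <+> I)" using fin by (intro card_inj_on_le[of h]) auto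
  then show ?thesis using fin by (simp add: card_Plus S_def)
qed

text \<open>James' distortion argument: if \<open>T\<close> dominated a multiple of the \<open>\<ell>\<^sub>1\<close> norm on \<open>A\<close>, then vectors
  \<open>u\<^sub>0, u\<^sub>1, \<dots>\<close> far out in \<open>A\<close> could be chosen almost minimal, and \<open>u\<^sub>0 + (u\<^sub>1 + \<dots> + u\<^sub>r) / r\<close>
  with \<open>r\<close> large would be too small: an admissible family meeting \<open>u\<^sub>0\<close> has few members, so it
  splits only few of the remaining \<open>u\<^sub>i\<close>, and the factor 1/2 is effective on the others.\<close>

lemma T_not_l1_on_infinite_set:
  assumes "infinite A" "0 < \<delta>"
    and low: "\<And>y. (\<And>i. 0 \<le> coord y i) \<Longrightarrow> supp y \<subseteq> A \<Longrightarrow> \<delta> * l1 y \<le> T y"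
  shows False
proof -
  define P where "P n y \<longleftrightarrow> (\<forall>i. 0 \<le> coord y i) \<and> supp y \<subseteq> A \<inter> {n..} \<and> l1 y = 1" for n y
  \<comment> \<open>The infimum of \<open>T\<close> over normalised positive vectors beyond
    \<open>n\<close> grows with \<open>n\<close>. Its supremum \<open>L\<close> is almost attained
    at \<open>n0\<close>, so from there on norms cannot drop much below \<open>L\<close>, while
    vectors of norm below \<open>B\<close> exist arbitrarily far out.\<close>
  define m where "m n = Inf (T ` {y. P n y})" for n
  have ex: "\<exists>y. P n y \<and> T y = 1" for n
  proof -
    obtain a where "a \<in> A" "max 1 n < a" using assms(1) unfolding infinite_nat_iff_unbounded by blast
    then have "P n (delta a) \<and> T (delta a) = 1"
      by (auto simp: P_def l1_def supp_def T_delta split: if_splits)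
    then show ?thesis by blast
  qed
  have bdd: "bdd_below (T ` {y. P n y})" for n
    by (intro bdd_belowI2[where m = 0]) (rule T_nonneg)
  have ne: "T ` {y. P n y} \<noteq> {}" for n using ex by blast
  have m_le: "m n \<le> T y" if "P n y" for n y
    unfolding m_def using that by (intro cInf_lower bdd) auto
  have m1: "m n \<le> 1" for n using ex[of n] m_le by force
  have "\<delta> \<le> m n" for n unfolding m_def
  proof (rule cInf_greatest[OF ne])
    fix t assume "t \<in> T ` {y. P n y}"
    then show "\<delta> \<le> t" using low by (force simp: P_def)
  qed
  define L where "L = (SUP n. m n)"
  have bdd': "bdd_above (range m)" using m1 by (intro bdd_aboveI2)
  have mL: "m n \<le> L" for n unfolding L_def by (rule cSUP_upper[OF UNIV_I bdd'])
  have L: "0 < L" using \<open>\<delta> \<le> m 0\<close> mL[of 0] assms(2) by linarith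
  \<comment> \<open>What counts is that \<open>31/20 * 21/20\<close> is less than
    \<open>2 * 19/20\<close>: the vector \<open>x\<close> below has l1 norm 2, hence
    \<open>T x\<close> exceeds \<open>2 * 19/20 * L\<close>, against the upper bound
    \<open>31/20 * B\<close>.\<close>
  define B where "B = 21/20 * L"
  have B: "0 < B" "L < B" using L by (auto simp: B_def)
  have "19/20 * L < L" using L by simp
  then obtain n0 where n0: "19/20 * L < m n0" 
    using less_cSUP_iff[OF _ bdd', of "19/20 * L"] unfolding L_def[symmetric] by auto
  have small: "\<exists>y. P n y \<and> T y < B" for n
  proof -
    have "m n < B" using mL[of n] B by linarith
    then show ?thesis unfolding m_def using cInf_lessD[OF ne] by fastforce
  qed
  have large: "m n0 * l1 y \<le> T y" if y: "\<And>i. 0 \<le> coord y i" "supp y \<subseteq> A \<inter> {n0..}" for y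
  proof (cases "l1 y = 0")
    case True then show ?thesis by (simp add: T_nonneg)
  next
    case False
    then have l: "0 < l1 y" by (simp add: l1_def less_le sum_nonneg)
    have "supp ((1 / l1 y) *\<^sub>R y) = supp y" using False by (auto simp: supp_def)
    then have "P n0 ((1 / l1 y) *\<^sub>R y)" using y l by (simp add: P_def l1_scale)
    from m_le[OF this] show ?thesis using l by (simp add: T_scale field_simps)
  qed
  obtain u where u: "\<And>n. P n0 (u n) \<and> T (u n) < B" "\<And>n. \<forall>a\<in>supp (u n). \<forall>b\<in>supp (u (Suc n)). a < b"
  proof -
    have "\<exists>f. \<forall>n::nat. (P n0 (f n) \<and> T (f n) < B) \<and> (\<forall>a\<in>supp (f n). \<forall>b\<in>supp (f (Suc n)). a < b)"
    proof (rule dependent_nat_choice)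
      show "\<exists>x. P n0 x \<and> T x < B" by (rule small)
      fix x and n :: nat
      obtain y where y: "P (max n0 (Suc (Max (supp x)))) y" "T y < B" using small by blast
      then have "\<forall>a\<in>supp x. \<forall>b\<in>supp y. a < b"
        using Max_ge[OF finite_supp[of x]] by (fastforce simp: P_def)
      moreover have "P n0 y" using y(1) by (auto simp: P_def)
      ultimately show "\<exists>y. (P n0 y \<and> T y < B) \<and> (\<forall>a\<in>supp x. \<forall>b\<in>supp y. a < b)" using y(2) by blast
    qed
    then show ?thesis using that by blast
  qed
  have nonneg: "0 \<le> coord (u n) i" and suppA: "supp (u n) \<subseteq> A \<inter> {n0..}" and l1u: "l1 (u n) = 1"
    and Tu: "T (u n) < B" for n i using u(1)[of n] by (auto simp: P_def)
  have une: "supp (u n) \<noteq> {}" for n using l1u[of n] by (auto simp: l1_def)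
  have chain: "a < b" if "i < j" "a \<in> supp (u i)" "b \<in> supp (u j)" for i j a b
    using that
  proof (induction j arbitrary: b)
    case (Suc j)
    show ?case
    proof (cases "i = j")
      case True then show ?thesis using u(2) Suc.prems by blast
    next
      case False
      obtain d where d: "d \<in> supp (u j)" using une by blast
      have "a < d" using Suc.IH[OF _ Suc.prems(2) d] Suc.prems(1) False by simp
      also have "d < b" using u(2) d Suc.prems(3) by blast
      finally show ?thesis .
    qed
  qed simp
  define M where "M = Max (supp (u 0))"
  \<comment> \<open>A family that meets \<open>u 0\<close> has at most \<open>M\<close>, hence at
    most \<open>r / 10\<close> members, so its incidences with the \<open>r\<close> vectors number
    at most \<open>11/10 * r\<close>. With \<open>2 * B\<close> from \<open>u 0\<close> this gives
    \<open>31/10 * B\<close>, twice the bound claimed.\<close>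
  define r where "r = 10 * M + 10"
  define v where "v = (1 / real r) *\<^sub>R (\<Sum>i\<in>{1..r}. u i)"
  define x where "x = u 0 + v"
  have r: "0 < real r" by (simp add: r_def)
  have v_nonneg: "0 \<le> coord v i" for i by (simp add: v_def coord_sum sum_nonneg nonneg)
  have l1v: "l1 v = 1" using r by (simp add: v_def l1_scale l1_sum nonneg l1u)
  have suppv: "supp v \<subseteq> (\<Union>i\<in>{1..r}. supp (u i))"
  proof
    fix i assume "i \<in> supp v"
    then have "(\<Sum>j\<in>{1..r}. coord (u j) i) \<noteq> 0" by (simp add: supp_def v_def coord_sum)
    then obtain j where "j \<in> {1..r}" "coord (u j) i \<noteq> 0" by (meson sum.not_neutral_contains_not_neutral)
    then show "i \<in> (\<Union>i\<in>{1..r}. supp (u i))" by (auto simp: supp_def)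
  qed
  have Tv: "T v \<le> B"
  proof -
    have "T v = (1 / real r) * T (\<Sum>i\<in>{1..r}. u i)" using r by (simp add: v_def T_scale)
    also have "\<dots> \<le> (1 / real r) * (\<Sum>i\<in>{1..r}. B)"
      using r Tu by (intro mult_left_mono order_trans[OF T_sum] sum_mono) (auto simp: less_imp_le)
    also have "\<dots> = B" using r by simp
    finally show ?thesis .
  qed
  have "2 * m n0 \<le> T x"
  proof -
    have "supp x \<subseteq> supp (u 0) \<union> supp v" by (auto simp: x_def supp_def)
    then have "supp x \<subseteq> A \<inter> {n0..}" using suppv suppA by blast
    then have "m n0 * l1 x \<le> T x" by (intro large) (auto simp: x_def nonneg v_nonneg)
    moreover have "l1 x = 2" unfolding x_def by (subst l1_add) (auto simp: nonneg v_nonneg l1u l1v)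
    ultimately show ?thesis by (simp add: mult.commute)
  qed
  moreover have "T x \<le> 31/20 * B"
  proof (rule T_leI)
    fix i
    have disj: "coord (u 0) i = 0 \<or> coord v i = 0"
    proof (rule ccontr)
      assume "\<not> ?thesis"
      then have "i \<in> supp (u 0)" "i \<in> supp v" by (auto simp: supp_def)
      then obtain j where "j \<in> {1..r}" "i \<in> supp (u j)" using suppv by blast
      then show False using chain[of 0 j i i] \<open>i \<in> supp (u 0)\<close> by simp
    qed
    then have "\<bar>coord x i\<bar> \<le> max \<bar>coord (u 0) i\<bar> \<bar>coord v i\<bar>" by (auto simp: x_def)
    also have "\<dots> \<le> B" using coord_le_T[of "u 0" i] coord_le_T[of v i] Tu[of 0] Tv by linarith
    finally show "\<bar>coord x i\<bar> \<le> 31/20 * B" using B by linarith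
  next
    fix \<E> assume fam: "separated_family (supp x) \<E>"
    have fE: "finite \<E>" and sep: "\<And>E F. E \<in> \<E> \<Longrightarrow> F \<in> \<E> \<Longrightarrow> E \<noteq> F \<Longrightarrow> separated E F"
      and cd: "\<And>E a. E \<in> \<E> \<Longrightarrow> a \<in> E \<Longrightarrow> card \<E> \<le> a"
      using fam by (auto simp: separated_family_def)
    have finE: "finite E" if "E \<in> \<E>" for E
      using fam that finite_supp[of x] by (auto simp: separated_family_def intro: finite_subset)
    have fam_le: "(\<Sum>E\<in>\<E>. T (restr E y)) \<le> 2 * T y" for y
      by (rule T_family[OF fE, where F = "\<lambda>E. E"]) (use finE sep cd in auto)
    show "(\<Sum>E\<in>\<E>. T (restr E x)) \<le> 2 * (31/20 * B)"
    proof (cases "\<forall>E\<in>\<E>. E \<inter> supp (u 0) = {}")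
      case True
      then have "(\<Sum>E\<in>\<E>. T (restr E x)) = (\<Sum>E\<in>\<E>. T (restr E v))"
        by (intro sum.cong refl) (simp add: x_def restr_add restr_disj)
      then show ?thesis using fam_le[of v] Tv B by linarith
    next
      case False
      then obtain E a where "E \<in> \<E>" "a \<in> E" "a \<in> supp (u 0)" by blast
      then have "card \<E> \<le> M" using cd[of E a] Max_ge[OF finite_supp, of a "u 0"] by (simp add: M_def)
      then have card: "real (card \<E>) \<le> real r / 10" by (simp add: r_def)
      have "T (restr E x) \<le> T (restr E (u 0)) + T (restr E v)" for E
        using T_add by (simp add: x_def restr_add)
      then have 1: "(\<Sum>E\<in>\<E>. T (restr E x)) \<le> (\<Sum>E\<in>\<E>. T (restr E (u 0))) + (\<Sum>E\<in>\<E>. T (restr E v))"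
        unfolding sum.distrib[symmetric] by (rule sum_mono)
      define S where "S = {(E, i). E \<in> \<E> \<and> i \<in> {1..r} \<and> E \<inter> supp (u i) \<noteq> {}}"
      have S: "S \<subseteq> \<E> \<times> {1..r}" by (auto simp: S_def)
      have "T (restr E (u i)) \<le> (if (E, i) \<in> S then B else 0)" if "E \<in> \<E>" "i \<in> {1..r}" for E i
        using T_restr_le[of E "u i"] Tu[of i] that restr_disj[of E "u i"] by (auto simp: S_def)
      then have "(\<Sum>E\<in>\<E>. \<Sum>i\<in>{1..r}. T (restr E (u i))) \<le> (\<Sum>E\<in>\<E>. \<Sum>i\<in>{1..r}. if (E, i) \<in> S then B else 0)"
        by (intro sum_mono)
      also have "\<dots> = (\<Sum>s\<in>\<E> \<times> {1..r}. if s \<in> S then B else 0)"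
        by (simp add: sum.cartesian_product)
      also have "\<dots> = real (card S) * B"
        using fE S by (simp add: sum.If_cases Int_absorb1)
      also have "\<dots> \<le> (real (card \<E>) + real r) * B"
        using card_incidences_le[OF fE _ sep, of "{1..r}" "\<lambda>i. supp (u i)"] chain B
        by (intro mult_right_mono) (auto simp: S_def simp flip: of_nat_add)
      also have "\<dots> \<le> (real r / 10 + real r) * B" using card B by (intro mult_right_mono) auto
      finally have 2: "(\<Sum>E\<in>\<E>. \<Sum>i\<in>{1..r}. T (restr E (u i))) \<le> (11/10 * B) * real r" by (simp add: algebra_simps)
      have "T (restr E v) \<le> (1 / real r) * (\<Sum>i\<in>{1..r}. T (restr E (u i)))" for E
        unfolding v_def restr_scale T_scale restr_sum using r T_sum[of "\<lambda>i. restr E (u i)" "{1..r}"]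
        by (auto intro: divide_right_mono)
      then have "(\<Sum>E\<in>\<E>. T (restr E v)) \<le> (1 / real r) * (\<Sum>E\<in>\<E>. \<Sum>i\<in>{1..r}. T (restr E (u i)))"
        unfolding sum_distrib_left[of "1 / real r" _ \<E>] by (rule sum_mono)
      also have "\<dots> \<le> (1 / real r) * ((11/10 * B) * real r)" using 2 r by (intro mult_left_mono) auto
      also have "\<dots> = 11/10 * B" using r by simp
      finally show ?thesis using 1 fam_le[of "u 0"] Tu[of 0] by linarith
    qed
  qed
  ultimately show False using n0 L by (simp add: B_def)
qed

section \<open>Block norms on the convexified Tsirelson space\<close>

lemma norm_c00_square: "(norm z)\<^sup>2 = T (square z)" for z :: c00
  by (simp add: norm_c00_def T_nonneg)

lemma norm_c00_mono: "(\<And>i. \<bar>coord x i\<bar> \<le> \<bar>coord y i\<bar>) \<Longrightarrow> norm x \<le> norm y" for x y :: c00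
  unfolding norm_c00_def by (intro real_sqrt_le_mono T_mono) (simp add: abs_le_square_iff)

lemma abs_coord_le_norm: "\<bar>coord x i\<bar> \<le> norm x"
proof -
  have "(coord x i)\<^sup>2 \<le> T (square x)" using coord_le_T[of "square x" i] by simp
  then show ?thesis unfolding norm_c00_def by (metis real_sqrt_abs real_sqrt_le_iff)
qed

lemma norm_delta: "i \<noteq> 0 \<Longrightarrow> norm (delta i) = 1"
proof -
  assume "i \<noteq> 0"
  moreover have "square (delta i) = delta i" by (rule c00_eqI) simp
  ultimately show ?thesis by (simp add: norm_c00_def T_delta)
qed

lemma bounded_linear_coord: "bounded_linear (\<lambda>x. coord x i)"
  by (rule bounded_linear_intro[where K = 1]) (auto simp: abs_coord_le_norm)

section \<open>Coordinates and basis of the completion\<close>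

lemma null_diff_coord_lim:
  assumes "null_diff X Y" shows "(\<lambda>n. coord (X n) i) \<longlonglongrightarrow> lim (\<lambda>n. coord (Y n) i)"
proof -
  have "Cauchy (\<lambda>n. coord (Y n) i)"
    using assms bounded_linear.Cauchy[OF bounded_linear_coord] by (auto simp: null_diff_def)
  then have "(\<lambda>n. coord (Y n) i) \<longlonglongrightarrow> lim (\<lambda>n. coord (Y n) i)"
    by (simp add: real_Cauchy_convergent convergent_LIMSEQ_iff[symmetric])
  moreover have "(\<lambda>n. coord (X n - Y n) i) \<longlonglongrightarrow> 0"
    using bounded_linear.tendsto[OF bounded_linear_coord, of "\<lambda>n. X n - Y n" 0] assms
    by (simp add: null_diff_def)
  ultimately show ?thesis using tendsto_add by fastforce
qed

lift_definition ccoord :: "nat \<Rightarrow> convexified_tsirelson \<Rightarrow> real" is "\<lambda>i X. lim (\<lambda>n. coord (X n) i)"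
  using null_diff_coord_lim by (metis limI)

lemma ccoord_to_completion [simp]: "ccoord i (to_completion z) = coord z i"
  by transfer simp

lemma ccoord_abs: "Cauchy X \<Longrightarrow> (\<lambda>n. coord (X n) i) \<longlonglongrightarrow> ccoord i (abs_banach_completion X)"
  using null_diff_coord_lim[of X X i] by (simp add: ccoord.abs_eq null_diff_refl)

lemma abs_ccoord_le_norm: "\<bar>ccoord i x\<bar> \<le> norm x"
proof -
  obtain X where X: "Cauchy X" "x = abs_banach_completion X" by (rule completion_rep)
  have "(\<lambda>n. \<bar>coord (X n) i\<bar>) \<longlonglongrightarrow> \<bar>ccoord i x\<bar>" unfolding X(2) by (intro tendsto_rabs ccoord_abs X)
  moreover have "(\<lambda>n. norm (X n)) \<longlonglongrightarrow> norm x"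
    unfolding X(2) using tendsto_norm[OF to_completion_tendsto[OF X(1)]] by (simp add: norm_to_completion)
  ultimately show ?thesis using abs_coord_le_norm by (auto intro: LIMSEQ_le)
qed

lemma bounded_linear_ccoord: "bounded_linear (ccoord i)"
proof (rule bounded_linear_intro[where K = 1])
  have lim: "(\<lambda>n. coord (X n) i) \<longlonglongrightarrow> lim (\<lambda>n. coord (X n) i)" if "Cauchy X" for X i
    using that null_diff_coord_lim[of X X i] by (simp add: null_diff_refl)
  fix x y :: convexified_tsirelson and r :: real
  show "ccoord i (x + y) = ccoord i x + ccoord i y"
    by transfer (auto simp: null_diff_refl intro!: limI tendsto_add lim)
  show "ccoord i (r *\<^sub>R x) = r *\<^sub>R ccoord i x"
    by transfer (auto simp: null_diff_refl intro!: limI tendsto_mult_left lim)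
  show "norm (ccoord i x) \<le> norm x * 1" using abs_ccoord_le_norm by simp
qed

lemmas ccoord_linear = bounded_linear.linear[OF bounded_linear_ccoord]
lemmas ccoord_simps = linear_add[OF ccoord_linear] linear_diff[OF ccoord_linear]
  linear_scale[OF ccoord_linear] linear_0[OF ccoord_linear] linear_neg[OF ccoord_linear]

lemma approximated_by_c00:
  fixes x :: "'a::real_normed_vector banach_completion"
  assumes "0 < \<epsilon>" obtains z where "norm (x - to_completion z) < \<epsilon>"
proof -
  have "x \<in> closure (range to_completion)" by (simp add: closure_range_to_completion)
  then obtain z where "dist (to_completion z) x < \<epsilon>" using assms unfolding closure_approachable by blast
  then show ?thesis using that[of z] by (simp add: dist_norm norm_minus_commute)
qed

text \<open>Coordinate 0 of \<open>c00\<close> is always zero; the shift makes every natural number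
  an index of the basis.\<close>

definition basis_vec :: "nat \<Rightarrow> convexified_tsirelson" where
  "basis_vec i = to_completion (delta (Suc i))"

lemma ccoord_basis_vec: "ccoord (Suc i) (basis_vec j) = (if i = j then 1 else 0)"
  by (simp add: basis_vec_def)

lemma c00_eq_sum_delta: "z = (\<Sum>i\<in>supp z. coord z i *\<^sub>R delta i)"
proof (rule c00_eqI)
  fix i
  have "coord (\<Sum>j\<in>supp z. coord z j *\<^sub>R delta j) i = (\<Sum>j\<in>supp z. if j = i then coord z i else 0)"
    unfolding coord_sum by (intro sum.cong refl) (cases i, auto)
  also have "\<dots> = (if i \<in> supp z then coord z i else 0)" using finite_supp by simp
  finally show "coord z i = coord (\<Sum>j\<in>supp z. coord z j *\<^sub>R delta j) i"
    by (simp add: supp_def)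
qed

lemma to_completion_eq_sum: "to_completion z = (\<Sum>i | Suc i \<in> supp z. coord z (Suc i) *\<^sub>R basis_vec i)"
proof -
  have "to_completion z = (\<Sum>i\<in>supp z. coord z i *\<^sub>R to_completion (delta i))"
    using arg_cong[OF c00_eq_sum_delta[of z], of to_completion]
    by (simp add: linear_sum[OF linear_to_completion] linear_scale[OF linear_to_completion])
  also have "supp z = Suc ` {i. Suc i \<in> supp z}"
  proof -
    have "i \<in> Suc ` {i. Suc i \<in> supp z}" if "i \<in> supp z" for i using that by (cases i) (auto simp: supp_def)
    then show ?thesis by auto
  qed
  finally show ?thesis by (simp add: sum.reindex basis_vec_def)
qed

lemma closure_span_basis_vec: "closure (span (range basis_vec)) = UNIV"
proof -
  have "to_completion z \<in> span (range basis_vec)" for z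
    unfolding to_completion_eq_sum by (intro span_sum span_scale span_base rangeI)
  then have "range to_completion \<subseteq> span (range basis_vec)" by blast
  then have "closure (range to_completion) \<subseteq> closure (span (range basis_vec))" by (rule closure_mono)
  then show ?thesis by (simp only: closure_range_to_completion top.extremum_unique)
qed

section \<open>The block norm and its equivalence with the original norm\<close>

context labelling
begin

definition block_l2 :: "convexified_tsirelson \<Rightarrow> nat \<Rightarrow> real" where
  "block_l2 x k = L2_set (\<lambda>i. ccoord i x) (fib k)"

text \<open>A vector of the completion may have infinitely many nonzero blocks, while
  \<open>c00\<close> holds finite vectors only. Hence the cut at \<open>m\<close> labels, followed
  by a supremum over \<open>m\<close>.\<close>

definition collapse :: "nat \<Rightarrow> convexified_tsirelson \<Rightarrow> c00" where
  "collapse m x = vec pos {..<m} (block_l2 x)"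

definition block_norm_l2 :: "convexified_tsirelson \<Rightarrow> real" where
  "block_norm_l2 x = (SUP m. norm (collapse m x))"

lemma block_l2_nonneg: "0 \<le> block_l2 x k"
  by (simp add: block_l2_def)

lemma coord_vec: "coord (vec pos {..<m} b) j = (if j \<in> pos ` {..<m} then b (inv_into UNIV pos j) else 0)"
proof (cases "j \<in> pos ` {..<m}")
  case True
  then obtain k where k: "k < m" "j = pos k" by blast
  then show ?thesis
    using coord_vec_image[OF finite_lessThan inj_pos, of k m b] pos_pos[of k] inv_f_f[OF inj_pos, of k] by simp
qed (simp add: coord_vec_notin)

lemma collapse_le:
  assumes "\<And>k. k < m \<Longrightarrow> block_l2 x k \<le> s * block_l2 y k" "0 \<le> s"
  shows "norm (collapse m x) \<le> s * norm (collapse m y)"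
proof -
  have "norm (collapse m x) \<le> norm (s *\<^sub>R collapse m y)"
  proof (rule norm_c00_mono)
    fix j
    have "inv_into UNIV pos j < m" if "j \<in> pos ` {..<m}" using that inv_f_f[OF inj_pos] by auto
    then show "\<bar>coord (collapse m x) j\<bar> \<le> \<bar>coord (s *\<^sub>R collapse m y) j\<bar>"
      using assms block_l2_nonneg by (simp add: collapse_def coord_vec)
  qed
  then show ?thesis using assms(2) by simp
qed

lemma collapse_triangle: "norm (collapse m (x + y)) \<le> norm (collapse m x) + norm (collapse m y)"
proof -
  have "block_l2 (x + y) k \<le> block_l2 x k + block_l2 y k" for k
    unfolding block_l2_def ccoord_simps by (rule L2_set_triangle_ineq)
  then have "norm (collapse m (x + y)) \<le> norm (collapse m x + collapse m y)"
    by (intro norm_c00_mono) (simp add: collapse_def coord_vec block_l2_nonneg abs_of_nonneg add_nonneg_nonneg)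
  also have "\<dots> \<le> norm (collapse m x) + norm (collapse m y)" by (rule norm_triangle_ineq)
  finally show ?thesis .
qed

lemma block_l2_scale: "block_l2 (a *\<^sub>R x) k = \<bar>a\<bar> * block_l2 x k"
  by (simp add: block_l2_def ccoord_simps L2_set_def power_mult_distrib real_sqrt_mult
      flip: sum_distrib_left)

text \<open>Squaring turns the l2 norms of blocks into masses, so both inequalities for the block
  norm reduce to the mass estimates for \<open>T\<close>.\<close>

lemma collapse_to_completion:
  "(norm (collapse m (to_completion z)))\<^sup>2 = T (vec pos {..<m} (mass (square z)))"
proof -
  have "square (collapse m (to_completion z)) = vec pos {..<m} (mass (square z))"
    by (rule c00_eqI) (simp add: collapse_def coord_vec block_l2_def L2_set_def mass_def sum_nonneg)
  then show ?thesis by (simp add: norm_c00_square)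
qed

lemma collapse_to_completion_le: "norm (collapse m (to_completion z)) \<le> 3 * norm z"
proof (rule power2_le_imp_le)
  have "(norm (collapse m (to_completion z)))\<^sup>2 \<le> 6 * (norm z)\<^sup>2"
    unfolding collapse_to_completion norm_c00_square[of z] by (rule T_mass_le) simp
  also have "\<dots> \<le> (3 * norm z)\<^sup>2" by (simp add: power_mult_distrib)
  finally show "(norm (collapse m (to_completion z)))\<^sup>2 \<le> (3 * norm z)\<^sup>2" .
qed simp

text \<open>For fixed \<open>m\<close> a crude constant \<open>C\<close> makes the collapse
  continuous; it disappears when the estimate on \<open>c00\<close>, whose constant is independent
  of \<open>m\<close>, is extended by density.\<close>

lemma collapse_le_norm: "norm (collapse m x) \<le> 3 * norm x"
proof -
  define C where "C = (\<Sum>k<m. real (card (fib k)))"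
  have C: "norm (collapse m y) \<le> C * norm y" for y
  proof -
    have "norm (collapse m y) \<le> (\<Sum>k<m. norm (block_l2 y k *\<^sub>R delta (pos k)))"
      unfolding collapse_def vec_def by (rule norm_sum)
    also have "\<dots> = (\<Sum>k<m. block_l2 y k)"
      using pos_pos by (simp add: norm_delta block_l2_nonneg)
    also have "\<dots> \<le> (\<Sum>k<m. \<Sum>i\<in>fib k. \<bar>ccoord i y\<bar>)"
      unfolding block_l2_def by (intro sum_mono L2_set_le_sum_abs)
    also have "\<dots> \<le> (\<Sum>k<m. \<Sum>i\<in>fib k. norm y)"
      using abs_ccoord_le_norm by (intro sum_mono) blast
    finally show ?thesis by (simp add: C_def sum_distrib_right)
  qed
  have "0 \<le> C" by (simp add: C_def sum_nonneg)
  have "norm (collapse m x) \<le> 3 * norm x + \<epsilon>" if "0 < \<epsilon>" for \<epsilon>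
  proof -
    define d where "d = \<epsilon> / (C + 3)"
    have d: "0 < d" "(C + 3) * d = \<epsilon>" using that \<open>0 \<le> C\<close> by (simp_all add: d_def)
    obtain z where z: "norm (x - to_completion z) < d" using approximated_by_c00[OF d(1)] .
    have "norm (collapse m x) \<le> norm (collapse m (x - to_completion z)) + norm (collapse m (to_completion z))"
      using collapse_triangle[of m "x - to_completion z" "to_completion z"] by simp
    also have "\<dots> \<le> C * norm (x - to_completion z) + 3 * norm z" by (intro add_mono C collapse_to_completion_le)
    also have "norm z \<le> norm x + norm (x - to_completion z)"
      using norm_triangle_ineq4[of x "x - to_completion z"] by (simp add: norm_to_completion)
    also have "C * norm (x - to_completion z) + 3 * (norm x + norm (x - to_completion z))
        = 3 * norm x + (C + 3) * norm (x - to_completion z)" by (simp add: algebra_simps)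
    also have "\<dots> \<le> 3 * norm x + (C + 3) * d" using z \<open>0 \<le> C\<close> by (intro add_left_mono mult_left_mono) auto
    finally show ?thesis using d(2) by simp
  qed
  then show ?thesis by (rule field_le_epsilon)
qed

lemma bdd_collapse: "bdd_above (range (\<lambda>m. norm (collapse m x)))"
  using collapse_le_norm by (intro bdd_aboveI2)

lemma collapse_le_block_norm: "norm (collapse m x) \<le> block_norm_l2 x"
  unfolding block_norm_l2_def by (rule cSUP_upper[OF UNIV_I bdd_collapse])

lemma block_norm_leI: "(\<And>m. norm (collapse m x) \<le> r) \<Longrightarrow> block_norm_l2 x \<le> r"
  unfolding block_norm_l2_def by (rule cSUP_least) auto

lemma block_norm_le:
  assumes "\<And>k. block_l2 x k \<le> s * block_l2 y k" "0 \<le> s"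
  shows "block_norm_l2 x \<le> s * block_norm_l2 y"
  by (rule block_norm_leI) (rule order_trans[OF collapse_le[OF assms] mult_left_mono[OF collapse_le_block_norm assms(2)]])

lemma block_norm_triangle: "block_norm_l2 (x + y) \<le> block_norm_l2 x + block_norm_l2 y"
  by (rule block_norm_leI) (rule order_trans[OF collapse_triangle add_mono[OF collapse_le_block_norm collapse_le_block_norm]])

lemma block_norm_scale: "block_norm_l2 (a *\<^sub>R x) = \<bar>a\<bar> * block_norm_l2 x"
proof (cases "a = 0")
  case True
  have "block_norm_l2 (0 *\<^sub>R x) \<le> 0 * block_norm_l2 x" by (rule block_norm_le) (simp_all add: block_l2_scale[of 0, simplified])
  moreover have "0 \<le> block_norm_l2 0" using collapse_le_block_norm[of 0 0] norm_ge_zero order_trans by blast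
  ultimately show ?thesis using True by simp
next
  case False
  show ?thesis
  proof (rule antisym)
    show "block_norm_l2 (a *\<^sub>R x) \<le> \<bar>a\<bar> * block_norm_l2 x" by (rule block_norm_le) (simp_all add: block_l2_scale)
    have "block_norm_l2 x \<le> \<bar>1 / a\<bar> * block_norm_l2 (a *\<^sub>R x)"
      using False by (intro block_norm_le) (simp_all add: block_l2_scale)
    then show "\<bar>a\<bar> * block_norm_l2 x \<le> block_norm_l2 (a *\<^sub>R x)" using False by (simp add: field_simps)
  qed
qed

lemma norm_le_block_norm: "norm x \<le> 3 * block_norm_l2 x"
proof -
  have fin: "norm z \<le> 3 * block_norm_l2 (to_completion z)" for z
  proof -
    define m where "m = Suc (Max (c ` supp z))"
    have s: "supp (square z) = supp z" by (simp add: supp_def)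
    have "c ` supp (square z) \<subseteq> {..<m}"
      using Max_ge[of "c ` supp z"] finite_supp[of z] unfolding s by (fastforce simp: m_def less_Suc_eq_le)
    then have "(norm z)\<^sup>2 \<le> 8 * (norm (collapse m (to_completion z)))\<^sup>2"
      unfolding collapse_to_completion norm_c00_square[of z] by (intro T_le_mass) auto
    also have "\<dots> \<le> (3 * norm (collapse m (to_completion z)))\<^sup>2" by (simp add: power_mult_distrib)
    finally have "norm z \<le> 3 * norm (collapse m (to_completion z))" by (rule power2_le_imp_le) simp
    then show ?thesis using collapse_le_block_norm[of m "to_completion z"] by linarith
  qed
  have "norm x \<le> 3 * block_norm_l2 x + \<epsilon>" if "0 < \<epsilon>" for \<epsilon>
  proof -
    have "0 < \<epsilon> / 10" using that by simp
    then obtain z where z: "norm (x - to_completion z) < \<epsilon> / 10" by (rule approximated_by_c00)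
    have "block_norm_l2 (to_completion z) \<le> block_norm_l2 x + block_norm_l2 (to_completion z - x)"
      using block_norm_triangle[of x "to_completion z - x"] by simp
    moreover have "block_norm_l2 (to_completion z - x) \<le> 3 * norm (x - to_completion z)"
      using block_norm_leI[of "to_completion z - x", OF collapse_le_norm] by (simp add: norm_minus_commute)
    moreover have "norm x \<le> norm z + norm (x - to_completion z)"
      using norm_triangle_ineq[of "to_completion z" "x - to_completion z"] by (simp add: norm_to_completion)
    ultimately show ?thesis using z fin[of z] by linarith
  qed
  then show ?thesis by (rule field_le_epsilon)
qed

lemma equivalent_block_norm: "equivalent_norm block_norm_l2"
  unfolding equivalent_norm_def is_norm_def
proof (intro conjI allI)
  fix x y :: convexified_tsirelson and a :: real
  show "0 \<le> block_norm_l2 x" using norm_le_block_norm[of x] norm_ge_zero[of x] by linarith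
  show "block_norm_l2 x = 0 \<longleftrightarrow> x = 0"
  proof
    assume "block_norm_l2 x = 0"
    then have "norm x \<le> 0" using norm_le_block_norm[of x] by linarith
    then show "x = 0" by simp
  next
    assume "x = 0"
    then show "block_norm_l2 x = 0" using block_norm_scale[of 0 x] by simp
  qed
  show "block_norm_l2 (x + y) \<le> block_norm_l2 x + block_norm_l2 y" by (rule block_norm_triangle)
  show "block_norm_l2 (a *\<^sub>R x) = \<bar>a\<bar> * block_norm_l2 x" by (rule block_norm_scale)
  show "\<exists>c>0. \<exists>C>0. \<forall>x. c * norm x \<le> block_norm_l2 x \<and> block_norm_l2 x \<le> C * norm x"
    using norm_le_block_norm block_norm_leI[OF collapse_le_norm]
    by (intro exI[of _ "1/3"] exI[of _ 3] conjI allI) (simp_all add: field_simps)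
qed

end

text \<open>Proper nonempty subsets of two points are singletons, so a family sums to at most 2,
  which the factor 1/2 halves. In a Euclidean plane the sum of two basis vectors would have norm
  \<open>sqrt 2\<close>; this tells different blocks apart.\<close>

lemma T_two_delta_le:
  assumes "p \<noteq> q" shows "T (delta p + delta q) \<le> 1"
proof (rule T_leI)
  fix i show "\<bar>coord (delta p + delta q) i\<bar> \<le> 1" using assms by auto
next
  fix \<E> assume fam: "separated_family (supp (delta p + delta q)) \<E>"
  have sub: "\<E> \<subseteq> {{p}, {q}}"
  proof
    fix E assume "E \<in> \<E>"
    then have E: "E \<subset> supp (delta p + delta q)" "E \<noteq> {}" using fam by (auto simp: separated_family_def)
    have "supp (delta p + delta q) \<subseteq> {p, q}" by (auto simp: supp_def split: if_splits)
    with E have "E \<subset> {p, q}" by blast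
    then show "E \<in> {{p}, {q}}" using E(2) by auto
  qed
  have "(\<Sum>E\<in>\<E>. T (restr E (delta p + delta q))) \<le> (\<Sum>E\<in>{{p}, {q}}. T (restr E (delta p + delta q)))"
    by (rule sum_mono2) (use sub T_nonneg in auto)
  also have "\<dots> = T (restr {p} (delta p + delta q)) + T (restr {q} (delta p + delta q))" using assms by simp
  also have "restr {p} (delta p + delta q) = delta p" using assms by (intro c00_eqI) auto
  also have "restr {q} (delta p + delta q) = delta q" using assms by (intro c00_eqI) auto
  also have "T (delta p) + T (delta q) \<le> 2 * 1"
  proof -
    have "T (delta i) \<le> 1" for i
      by (cases "i = 0") (simp_all add: T_delta order_trans[OF T_le_l1] l1_def supp_def)
    from this[of p] this[of q] show ?thesis by linarith
  qed
  finally show "(\<Sum>E\<in>\<E>. T (restr E (delta p + delta q))) \<le> 2 * 1" .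
qed

lemma norm_two_delta_le: "p \<noteq> q \<Longrightarrow> norm (delta p + delta q) \<le> 1"
proof -
  assume "p \<noteq> q"
  then have "square (delta p + delta q) = delta p + delta q" by (intro c00_eqI) auto
  then show ?thesis using T_two_delta_le[OF \<open>p \<noteq> q\<close>] by (simp add: norm_c00_def)
qed

text \<open>With square roots of the coordinates of \<open>y\<close> as coefficients, domination of
  the l2 norm with constant \<delta> becomes domination of the l1 norm by \<open>T\<close> with the
  square of \<delta>, which is excluded.\<close>

lemma basis_vec_not_hilbert:
  assumes "infinite A" "0 < \<delta>"
  shows "\<exists>B a. finite B \<and> B \<subseteq> A \<and> norm (\<Sum>i\<in>B. a i *\<^sub>R basis_vec i) < \<delta> * sqrt (\<Sum>i\<in>B. (a i)\<^sup>2)"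
proof (rule ccontr)
  assume *: "\<not> ?thesis"
  show False
  proof (rule T_not_l1_on_infinite_set)
    show "infinite (Suc ` A)" using assms(1) by (simp add: finite_image_iff)
    show "0 < \<delta>\<^sup>2" using assms(2) by simp
    fix y assume y: "\<And>i. 0 \<le> coord y i" "supp y \<subseteq> Suc ` A"
    define B where "B = {i. Suc i \<in> supp y}"
    have SB: "Suc ` B = supp y" using y(2) by (auto simp: B_def)
    have B: "finite B" "B \<subseteq> A"
      using finite_supp[of y] y(2) by (auto simp: SB[symmetric] finite_image_iff)
    define a where "a i = sqrt (coord y (Suc i))" for i
    define z where "z = (\<Sum>i\<in>B. a i *\<^sub>R delta (Suc i))"
    have "to_completion z = (\<Sum>i\<in>B. a i *\<^sub>R basis_vec i)"
      by (simp add: z_def basis_vec_def linear_sum[OF linear_to_completion] linear_scale[OF linear_to_completion])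
    then have "\<delta> * sqrt (\<Sum>i\<in>B. (a i)\<^sup>2) \<le> norm z"
      using * B by (metis norm_to_completion not_le)
    moreover have "(\<Sum>i\<in>B. (a i)\<^sup>2) = l1 y"
      using y(1) by (simp add: l1_def SB[symmetric] sum.reindex a_def)
    moreover have "square z = y"
    proof (rule c00_eqI)
      fix j
      have "coord z j = (\<Sum>i\<in>B. if Suc i = j then sqrt (coord y j) else 0)"
        unfolding z_def coord_sum by (intro sum.cong refl) (auto simp: a_def)
      also have "\<dots> = sqrt (coord y j)"
        using B(1) by (cases j) (auto simp: B_def supp_def)
      finally show "coord (square z) j = coord y j" using y(1) by simp
    qed
    ultimately have "\<delta> * sqrt (l1 y) \<le> sqrt (T y)" by (simp add: norm_c00_def)
    then have "(\<delta> * sqrt (l1 y))\<^sup>2 \<le> (sqrt (T y))\<^sup>2"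
      using assms(2) by (intro power_mono) (auto simp: l1_def sum_nonneg)
    then show "\<delta>\<^sup>2 * l1 y \<le> T y" by (simp add: power_mult_distrib T_nonneg l1_def sum_nonneg)
  qed
qed

section \<open>The classes of a block norm\<close>

context labelling
begin

lemma coord_fib_basis_vec: "p \<in> fib k \<Longrightarrow> ccoord p (basis_vec i) = (if p = Suc i then 1 else 0)"
  by (auto simp: basis_vec_def)

lemma block_l2_basis_vec: "block_l2 (basis_vec i) k = (if k = c (Suc i) then 1 else 0)"
proof -
  have "(\<Sum>p\<in>fib k. (ccoord p (basis_vec i))\<^sup>2) = (\<Sum>p\<in>fib k. if p = Suc i then 1 else 0)"
    by (intro sum.cong refl) (simp add: coord_fib_basis_vec)
  also have "\<dots> = (if k = c (Suc i) then 1 else 0)" by (auto simp: fib_iff)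
  finally show ?thesis by (simp add: block_l2_def L2_set_def)
qed

lemma collapse_basis_vec:
  "collapse m (basis_vec i) = (if c (Suc i) < m then delta (pos (c (Suc i))) else 0)"
proof -
  have "collapse m (basis_vec i) = (\<Sum>k<m. if k = c (Suc i) then delta (pos (c (Suc i))) else 0)"
    unfolding collapse_def vec_def block_l2_basis_vec by (intro sum.cong) auto
  then show ?thesis by simp
qed

lemma block_norm_basis_vec: "block_norm_l2 (basis_vec i) = 1"
proof (rule antisym)
  show "block_norm_l2 (basis_vec i) \<le> 1"
    using pos_pos by (intro block_norm_leI) (simp add: collapse_basis_vec norm_delta)
  show "1 \<le> block_norm_l2 (basis_vec i)"
    using collapse_le_block_norm[of "Suc (c (Suc i))" "basis_vec i"] pos_pos by (simp add: collapse_basis_vec norm_delta)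
qed

lemma block_norm_two_basis_vec_le:
  assumes "c (Suc i) \<noteq> c (Suc j)"
  shows "block_norm_l2 (basis_vec i + basis_vec j) \<le> 1"
proof (rule block_norm_leI)
  fix m
  let ?p = "pos (c (Suc i))" and ?q = "pos (c (Suc j))"
  have "?p \<noteq> ?q" using assms inj_pos[of UNIV] by (auto simp: inj_on_def)
  have "block_l2 (basis_vec i + basis_vec j) k \<le> block_l2 (basis_vec i) k + block_l2 (basis_vec j) k" for k
    unfolding block_l2_def ccoord_simps by (rule L2_set_triangle_ineq)
  then have "norm (collapse m (basis_vec i + basis_vec j)) \<le> norm (collapse m (basis_vec i) + collapse m (basis_vec j))"
    by (intro norm_c00_mono) (simp add: collapse_def coord_vec block_l2_nonneg abs_of_nonneg add_nonneg_nonneg)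
  also have "\<dots> \<le> norm (delta ?p + delta ?q)"
    by (rule norm_c00_mono) (auto simp: collapse_basis_vec)
  also have "\<dots> \<le> 1" by (rule norm_two_delta_le[OF \<open>?p \<noteq> ?q\<close>])
  finally show "norm (collapse m (basis_vec i + basis_vec j)) \<le> 1" .
qed

lemma block_norm_cong:
  assumes "\<And>p. 0 < p \<Longrightarrow> \<bar>ccoord p x\<bar> = \<bar>ccoord p y\<bar>" shows "block_norm_l2 x = block_norm_l2 y"
proof -
  have "block_l2 x k = block_l2 y k" for k
    unfolding block_l2_def L2_set_def
    by (intro arg_cong[of _ _ sqrt] sum.cong refl) (metis assms fib_iff power2_abs)
  then have "block_l2 x = block_l2 y" by blast
  then show ?thesis by (simp add: block_norm_l2_def collapse_def)
qed

sublocale BN: unconditional_norm block_norm_l2 basis_vec "\<lambda>i. ccoord (Suc i)"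
proof (rule unconditional_norm.intro)
  show "equivalent_norm block_norm_l2" by (rule equivalent_block_norm)
  show "bounded_linear (ccoord (Suc i))" for i by (rule bounded_linear_ccoord)
  show "ccoord (Suc i) (basis_vec j) = (if i = j then 1 else 0)" for i j by (rule ccoord_basis_vec)
  show "closure (span (range basis_vec)) = UNIV" by (rule closure_span_basis_vec)
  show "block_norm_l2 (basis_vec i) = 1" for i by (rule block_norm_basis_vec)
  show "x = 0" if "\<And>i. ccoord (Suc i) x = 0" for x
  proof -
    have "block_norm_l2 x = block_norm_l2 0"
      by (rule block_norm_cong) (metis Suc_pred that ccoord_simps(4))
    then have "norm x \<le> 0" using norm_le_block_norm[of x] block_norm_scale[of 0 0] by simp
    then show ?thesis by simp
  qed
  show "block_norm_l2 (x - (2 * ccoord (Suc i) x) *\<^sub>R basis_vec i) = block_norm_l2 x" for x i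
  proof (rule block_norm_cong)
    fix p :: nat assume "0 < p"
    then have "ccoord p (basis_vec i) = (if p = Suc i then 1 else 0)" by (auto simp: basis_vec_def)
    then show "\<bar>ccoord p (x - (2 * ccoord (Suc i) x) *\<^sub>R basis_vec i)\<bar> = \<bar>ccoord p x\<bar>"
      by (simp add: ccoord_simps)
  qed
qed

text \<open>The part of \<open>x\<close> in the plane is orthogonal to its quarter turn, so it is
  stretched by exactly \<open>sqrt (1 + t\<^sup>2)\<close>; the other coordinates stay put.\<close>

lemma block_l2_rotation_le:
  assumes c: "c (Suc i) = c (Suc j)" and ij: "i \<noteq> j"
  shows "block_l2 (x + t *\<^sub>R (ccoord (Suc j) x *\<^sub>R basis_vec i - ccoord (Suc i) x *\<^sub>R basis_vec j)) k
    \<le> sqrt (1 + t\<^sup>2) * block_l2 x k"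
proof -
  define y where "y = x + t *\<^sub>R (ccoord (Suc j) x *\<^sub>R basis_vec i - ccoord (Suc i) x *\<^sub>R basis_vec j)"
  define F where "F = fib k - {Suc i} - {Suc j}"
  have y: "ccoord (Suc i) y = ccoord (Suc i) x + t * ccoord (Suc j) x"
    "ccoord (Suc j) y = ccoord (Suc j) x - t * ccoord (Suc i) x"
    using ij by (simp_all add: y_def ccoord_simps ccoord_basis_vec)
  have yF: "ccoord p y = ccoord p x" if "p \<in> F" for p
    using that by (auto simp: y_def ccoord_simps coord_fib_basis_vec F_def)
  have "(\<Sum>p\<in>F. (ccoord p x)\<^sup>2) \<le> (1 + t\<^sup>2) * (\<Sum>p\<in>F. (ccoord p x)\<^sup>2)"
    using mult_right_mono[of 1 "1 + t\<^sup>2" "\<Sum>p\<in>F. (ccoord p x)\<^sup>2"] by (simp add: sum_nonneg)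
  then have F: "(\<Sum>p\<in>F. (ccoord p y)\<^sup>2) \<le> (1 + t\<^sup>2) * (\<Sum>p\<in>F. (ccoord p x)\<^sup>2)"
    by (simp add: yF cong: sum.cong)
  have "(\<Sum>p\<in>fib k. (ccoord p y)\<^sup>2) \<le> (1 + t\<^sup>2) * (\<Sum>p\<in>fib k. (ccoord p x)\<^sup>2)"
  proof (cases "k = c (Suc i)")
    case True
    then have mem: "Suc i \<in> fib k" "Suc j \<in> fib k - {Suc i}" using c ij by (auto simp: fib_iff)
    have split: "(\<Sum>p\<in>fib k. f p) = f (Suc i) + (f (Suc j) + (\<Sum>p\<in>F. f p))" for f :: "nat \<Rightarrow> real"
      unfolding F_def sum.remove[OF finite_fib mem(1)] using sum.remove[OF _ mem(2)] by simp
    have "(ccoord (Suc i) y)\<^sup>2 + (ccoord (Suc j) y)\<^sup>2 = (1 + t\<^sup>2) * ((ccoord (Suc i) x)\<^sup>2 + (ccoord (Suc j) x)\<^sup>2)"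
      unfolding y by (simp add: power2_eq_square algebra_simps)
    then show ?thesis using F unfolding split by (simp add: distrib_left)
  next
    case False
    then have "F = fib k" using c by (auto simp: F_def fib_iff)
    then show ?thesis using F by simp
  qed
  then have "sqrt (\<Sum>p\<in>fib k. (ccoord p y)\<^sup>2) \<le> sqrt ((1 + t\<^sup>2) * (\<Sum>p\<in>fib k. (ccoord p x)\<^sup>2))"
    by (rule real_sqrt_le_mono)
  then show ?thesis unfolding y_def[symmetric] block_l2_def L2_set_def by (simp add: real_sqrt_mult)
qed

text \<open>The sum of two distinct related basis vectors has norm \<open>sqrt 2\<close>, whereas
  across blocks it has norm at most 1. Within a block, a step \<open>t\<close> along the generator
  stretches the norm at most by \<open>sqrt (1 + t\<^sup>2)\<close>, which differs from 1 to second
  order.\<close>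

lemma rel_iff: "BN.rel i j \<longleftrightarrow> c (Suc i) = c (Suc j)"
proof
  assume r: "BN.rel i j"
  show "c (Suc i) = c (Suc j)"
  proof (rule ccontr)
    assume ne: "c (Suc i) \<noteq> c (Suc j)"
    then have "i \<noteq> j" by blast
    have "BN.rel i k" if "k \<in> {i, j}" for k using r that by auto
    from BN.N_eq_l2[where A = "{i, j}" and a = "\<lambda>_. 1", OF _ this] \<open>i \<noteq> j\<close>
    have "block_norm_l2 (basis_vec i + basis_vec j) = sqrt 2" by simp
    then show False using block_norm_two_basis_vec_le[OF ne] by simp
  qed
next
  assume c: "c (Suc i) = c (Suc j)"
  show "BN.rel i j"
  proof (cases "i = j")
    case False
    define K where "K = (\<lambda>x. ccoord (Suc j) x *\<^sub>R basis_vec i - ccoord (Suc i) x *\<^sub>R basis_vec j)"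
    have bound: "block_norm_l2 (x + t *\<^sub>R K x) \<le> block_norm_l2 x + t\<^sup>2 * block_norm_l2 x" for x t
    proof -
      have "block_norm_l2 (x + t *\<^sub>R K x) \<le> sqrt (1 + t\<^sup>2) * block_norm_l2 x"
        unfolding K_def by (rule block_norm_le[OF block_l2_rotation_le[OF c False]]) simp
      also have "\<dots> \<le> (1 + t\<^sup>2) * block_norm_l2 x"
      proof (rule mult_right_mono)
        have "sqrt (1 + t\<^sup>2) * 1 \<le> sqrt (1 + t\<^sup>2) * sqrt (1 + t\<^sup>2)"
          by (rule mult_left_mono) simp_all
        also have "\<dots> = 1 + t\<^sup>2" by (simp add: add_nonneg_nonneg)
        finally show "sqrt (1 + t\<^sup>2) \<le> 1 + t\<^sup>2" by simp
      qed (rule BN.N_nonneg)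
      finally show ?thesis by (simp add: distrib_right)
    qed
    have "BN.skew K"
      unfolding BN.skew_def
    proof (intro allI impI)
      fix x and \<epsilon> :: real assume e: "0 < \<epsilon>"
      define B where "B = block_norm_l2 x + 1"
      have B: "0 < B" "block_norm_l2 x \<le> B" using BN.N_nonneg[of x] by (auto simp: B_def)
      have "block_norm_l2 (x + t *\<^sub>R K x) \<le> block_norm_l2 x + \<epsilon> * \<bar>t\<bar>" if "\<bar>t\<bar> < \<epsilon> / B" for t
      proof -
        have "t\<^sup>2 * block_norm_l2 x \<le> \<bar>t\<bar> * (\<bar>t\<bar> * B)"
          using B mult_left_mono[OF B(2), of "t\<^sup>2"] by (simp add: power2_eq_square mult.assoc[symmetric])
        also have "\<dots> \<le> \<bar>t\<bar> * \<epsilon>"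
          using that B(1) by (intro mult_left_mono) (simp_all add: field_simps)
        finally show ?thesis using bound[of x t] by (simp add: mult.commute)
      qed
      then show "\<exists>\<delta>>0. \<forall>t. \<bar>t\<bar> < \<delta> \<longrightarrow> block_norm_l2 (x + t *\<^sub>R K x) \<le> block_norm_l2 x + \<epsilon> * \<bar>t\<bar>"
        using e B(1) by (intro exI[of _ "\<epsilon> / B"]) auto
    qed
    then show ?thesis by (simp add: BN.rel_def K_def)
  qed simp
qed

end

section \<open>A continuum of block norms\<close>

text \<open>The positive integers are cut into the blocks \<open>{1, 2, 3}, {4, \<dots>, 7}, {8, \<dots>, 15}, \<dots>\<close>; for
  \<open>m \<in> \<alpha>\<close> the blocks \<open>2 m\<close> and \<open>2 m + 1\<close> are merged. \<open>start k\<close> is the first element of block \<open>k\<close>.\<close>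

definition block :: "nat \<Rightarrow> nat" where "block i = (LEAST k. i < 2 ^ (k + 2))"

definition merge :: "nat set \<Rightarrow> nat \<Rightarrow> nat" where
  "merge \<alpha> k = (if k div 2 \<in> \<alpha> then 2 * (k div 2) else k)"

definition start :: "nat \<Rightarrow> nat" where "start k = (if k = 0 then 1 else 2 ^ (k + 1))"

lemma block_le_iff: "block i \<le> k \<longleftrightarrow> i < 2 ^ (k + 2)"
proof
  have "i < 2 ^ i" by (rule less_exp)
  also have "\<dots> \<le> 2 ^ (i + 2)" by (rule power_increasing) auto
  finally have "i < 2 ^ (block i + 2)" unfolding block_def by (rule LeastI)
  also assume "block i \<le> k"
  then have "(2::nat) ^ (block i + 2) \<le> 2 ^ (k + 2)" by (intro power_increasing) auto
  finally show "i < 2 ^ (k + 2)" .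
qed (simp add: block_def Least_le)

lemma block_eq_iff: "block i = k \<longleftrightarrow> i < 2 ^ (k + 2) \<and> (k = 0 \<or> 2 ^ (k + 1) \<le> i)"
proof (cases k)
  case 0 then show ?thesis using block_le_iff[of i 0] by simp
next
  case (Suc m)
  have "block i = k \<longleftrightarrow> block i \<le> k \<and> \<not> block i \<le> m" using Suc by auto
  then show ?thesis unfolding block_le_iff using Suc by (simp add: not_less)
qed

lemma merge_bounds: "2 * (k div 2) \<le> merge \<alpha> k" "merge \<alpha> k \<le> k" "k \<le> merge \<alpha> k + 1"
  by (auto simp: merge_def)

lemma merge_mono: "k \<le> k' \<Longrightarrow> merge \<alpha> k \<le> merge \<alpha> k'"
proof (cases "k div 2 = k' div 2")
  case True
  assume "k \<le> k'" then show ?thesis using True by (simp add: merge_def)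
next
  case False
  assume "k \<le> k'"
  then have "k div 2 < k' div 2" using False div_le_mono[of k k' 2] by simp
  then have "k < 2 * (k' div 2)" by linarith
  then show ?thesis using merge_bounds(2)[of \<alpha> k] merge_bounds(1)[of k' \<alpha>] by linarith
qed

lemma start_bounds: "2 ^ k \<le> start k" "start k \<le> 2 ^ (k + 1)"
  by (simp_all add: start_def)

lemma start_mono: "k \<le> k' \<Longrightarrow> start k \<le> start k'"
  by (auto simp: start_def intro: power_increasing)

lemma labelling_merge: "labelling (\<lambda>i. merge \<alpha> (block i)) start"
proof
  show "0 < start k" for k by (simp add: start_def)
  show "start k < start k'" if "k < k'" for k k'
    using that power_strict_increasing[of 0 "k' + 1" "2::nat"] power_strict_increasing[of k k' "2::nat"] by (auto simp: start_def)
  show "16 * start k \<le> start k'" if "k + 4 \<le> k'" for k k'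
  proof -
    have "16 * start k \<le> 2 ^ (k + 4 + 1)" using start_bounds(2)[of k] by (simp add: power_add)
    also have "\<dots> \<le> 2 ^ (k' + 1)" using that by (intro power_increasing) auto
    also have "\<dots> = start k'" using that by (simp add: start_def)
    finally show ?thesis .
  qed
  show "merge \<alpha> (block i) \<le> merge \<alpha> (block j)" if "i \<le> j" for i j
  proof (rule merge_mono)
    have "j < 2 ^ (block j + 2)" using block_le_iff[of j "block j"] by simp
    then show "block i \<le> block j" unfolding block_le_iff using that by linarith
  qed
  fix i :: nat assume i: "0 < i"
  have "start (merge \<alpha> (block i)) \<le> start (block i)" by (intro start_mono merge_bounds)
  also have "\<dots> \<le> i" using i block_eq_iff[of i "block i"] by (auto simp: start_def)
  finally show "start (merge \<alpha> (block i)) \<le> i" .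
  have "i < 2 ^ (block i + 2)" using block_le_iff[of i "block i"] by simp
  also have "\<dots> \<le> 2 ^ (merge \<alpha> (block i) + 3)"
    using merge_bounds(3)[of "block i" \<alpha>] by (intro power_increasing) auto
  also have "\<dots> = 8 * 2 ^ merge \<alpha> (block i)" by (simp add: power_add)
  also have "\<dots> \<le> 8 * start (merge \<alpha> (block i))" using start_bounds(1) by simp
  finally show "i < 8 * start (merge \<alpha> (block i))" .
qed

interpretation labelling "\<lambda>i. merge \<alpha> (block i)" start for \<alpha>
  by (rule labelling_merge)

abbreviation "merged_norm \<alpha> \<equiv> labelling.block_norm_l2 (\<lambda>i. merge \<alpha> (block i)) start"

lemma card_block: "card {i. block (Suc i) = k} = 2 * 2 ^ k + (if k = 0 then 1 else 0)"
proof -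
  have eq: "{i. block (Suc i) = k} = (if k = 0 then {..<3} else {2 ^ (k + 1) - 1..<2 ^ (k + 2) - 1})"
    unfolding block_eq_iff by auto
  show ?thesis unfolding eq by simp
qed

text \<open>Block \<open>k\<close> has \<open>2 * 2 ^ k\<close> elements, plus one if
  \<open>k = 0\<close>, as the first block runs from 1 to 3. Up to this element, the size of a union
  is twice the binary code of its set of blocks.\<close>

lemma card_union_of_blocks:
  assumes C: "finite C" "\<And>i j. i \<in> C \<Longrightarrow> block (Suc i) = block (Suc j) \<Longrightarrow> j \<in> C"
  defines "K \<equiv> (\<lambda>i. block (Suc i)) ` C"
  shows "card C = 2 * set_encode K + (if 0 \<in> K then 1 else 0)"
proof -
  have K: "finite K" using C(1) by (simp add: K_def)
  have "card C = (\<Sum>k\<in>K. \<Sum>i | i \<in> C \<and> block (Suc i) = k. 1)"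
    using sum.group[OF C(1) K, of "\<lambda>i. block (Suc i)" "\<lambda>_. 1::nat"] by (simp add: K_def)
  also have "\<dots> = (\<Sum>k\<in>K. card {i. block (Suc i) = k})"
  proof (rule sum.cong[OF refl])
    fix k assume "k \<in> K"
    then have "{i. i \<in> C \<and> block (Suc i) = k} = {i. block (Suc i) = k}"
      using C(2) by (auto simp: K_def)
    then show "(\<Sum>i | i \<in> C \<and> block (Suc i) = k. 1) = card {i. block (Suc i) = k}" by simp
  qed
  also have "\<dots> = 2 * set_encode K + (\<Sum>k\<in>K. if k = 0 then 1 else 0)"
    by (simp add: card_block sum.distrib set_encode_def sum_distrib_left)
  also have "(\<Sum>k\<in>K. if k = 0 then 1 else 0) = (if 0 \<in> K then 1 else (0::nat))" using K by simp
  finally show ?thesis .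
qed

text \<open>The block sizes 3, 4, 8, 16, \dots have distinct subset sums.\<close>

lemma union_of_blocks_eqI:
  assumes "finite C" "finite D"
    and C: "\<And>i j. i \<in> C \<Longrightarrow> block (Suc i) = block (Suc j) \<Longrightarrow> j \<in> C"
    and D: "\<And>i j. i \<in> D \<Longrightarrow> block (Suc i) = block (Suc j) \<Longrightarrow> j \<in> D"
    and "card C = card D"
  shows "C = D"
proof -
  let ?K = "\<lambda>C. (\<lambda>i. block (Suc i)) ` C"
  have "2 * set_encode (?K C) + (if 0 \<in> ?K C then 1 else 0) = 2 * set_encode (?K D) + (if 0 \<in> ?K D then 1 else 0)"
    using card_union_of_blocks[OF assms(1) C] card_union_of_blocks[OF assms(2) D] assms(5) by simp
  \<comment> \<open>Parity decides whether block 0 occurs; after that the codes agree.\<close>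
  then have "set_encode (?K C) = set_encode (?K D)" by (simp split: if_splits; presburger)
  then have "?K C = ?K D" using assms(1,2) by (simp add: set_encode_eq)
  then show ?thesis using C D by (auto simp: set_eq_iff) (metis image_iff)+
qed

lemma merged_rel_iff: "BN.rel \<alpha> i j \<longleftrightarrow> merge \<alpha> (block (Suc i)) = merge \<alpha> (block (Suc j))"
  by (rule rel_iff)

lemma nontrivial_block: "\<exists>j. block (Suc i) = block (Suc j) \<and> i \<noteq> j"
proof (rule ccontr)
  assume "\<not> ?thesis"
  then have "\<And>j. block (Suc j) = block (Suc i) \<Longrightarrow> j = i" by metis
  then have "{j. block (Suc j) = block (Suc i)} = {i}" by blast
  moreover have "2 \<le> card {j. block (Suc j) = block (Suc i)}" unfolding card_block by simp
  ultimately show False by simp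
qed

lemma block_norm_merged: "block_norm (merged_norm \<alpha>) basis_vec (\<lambda>i. ccoord (Suc i))"
proof -
  have cls: "BN.cls \<alpha> i = {j. merge \<alpha> (block (Suc j)) = merge \<alpha> (block (Suc i))}" for i
    by (auto simp: BN.cls_def merged_rel_iff)
  have fin: "finite (BN.cls \<alpha> i)" for i
  proof -
    have "Suc ` BN.cls \<alpha> i \<subseteq> fib \<alpha> (merge \<alpha> (block (Suc i)))" by (auto simp: cls fib_iff)
    then show ?thesis using finite_fib finite_imageD[of Suc] finite_subset by (metis inj_Suc)
  qed
  show ?thesis
  proof (rule block_norm.intro[OF BN.unconditional_norm_axioms], rule block_norm_axioms.intro)
    show "finite (BN.cls \<alpha> i)" for i by (rule fin)
    show "\<exists>j. BN.rel \<alpha> i j \<and> i \<noteq> j" for i using nontrivial_block[of i] by (auto simp: merged_rel_iff)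
    show "BN.cls \<alpha> i = BN.cls \<alpha> j" if "card (BN.cls \<alpha> i) = card (BN.cls \<alpha> j)" for i j
      by (rule union_of_blocks_eqI[OF fin fin _ _ that]) (auto simp: cls)
  qed
qed

lemma merged_not_in_maximal:
  assumes "maximal_bounded_subgroup G"
  shows "\<not> isometry_group (merged_norm \<alpha>) \<subseteq> G"
proof (rule BN.isometry_group_not_in_maximal[OF _ _ _ basis_vec_not_hilbert assms])
  show "\<exists>j. BN.rel \<alpha> i j \<and> i \<noteq> j" for i using nontrivial_block[of i] by (auto simp: merged_rel_iff)
  show "C = D" if "finite C" "finite D" "\<And>i j. i \<in> C \<Longrightarrow> BN.rel \<alpha> i j \<Longrightarrow> j \<in> C"
    "\<And>i j. i \<in> D \<Longrightarrow> BN.rel \<alpha> i j \<Longrightarrow> j \<in> D" "card C = card D" for C D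
    using that by (intro union_of_blocks_eqI) (auto simp: merged_rel_iff)
qed simp_all

text \<open>Every class size of the first norm occurs for the second. The classes of both are unions
  of the same unmerged blocks, and such unions are determined by their sizes, so the classes
  coincide and show which blocks were merged.\<close>

lemma conjugate_merged:
  assumes "conjugate_in_GL (isometry_group (merged_norm \<alpha>)) (isometry_group (merged_norm \<beta>))"
  shows "\<alpha> = \<beta>"
proof -
  obtain S where S: "S \<in> carrier GL" "isometry_group (merged_norm \<alpha>)
      = (\<lambda>g. inv\<^bsub>GL\<^esub> S \<otimes>\<^bsub>GL\<^esub> g \<otimes>\<^bsub>GL\<^esub> S) ` isometry_group (merged_norm \<beta>)"
    using assms unfolding conjugate_in_GL_def by blast
  define R where "R = inv\<^bsub>GL\<^esub> S"
  have "S o\<^sub>L R = id_blinfun" "R o\<^sub>L S = id_blinfun"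
    using group.r_inv[OF group_GL S(1)] group.l_inv[OF group_GL S(1)] by (simp_all add: GL_def R_def)
  then have SR: "blinfun_apply S (blinfun_apply R x) = x" "blinfun_apply R (blinfun_apply S x) = x" for x
    by (metis blinfun_apply_blinfun_compose id_blinfun.rep_eq id_apply)+
  have eq: "isometry_group (merged_norm \<alpha>) = (\<lambda>g. R o\<^sub>L g o\<^sub>L S) ` isometry_group (merged_norm \<beta>)"
    using S(2) by (simp add: GL_def R_def)
  interpret A: block_norm "merged_norm \<alpha>" basis_vec "\<lambda>i. ccoord (Suc i)" by (rule block_norm_merged)
  interpret B: block_norm "merged_norm \<beta>" basis_vec "\<lambda>i. ccoord (Suc i)" by (rule block_norm_merged)
  have cards: "\<exists>p. card (BN.cls \<beta> p) = card (BN.cls \<alpha> i)" for i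
  proof (rule A.card_cls_conjugate[OF block_norm_merged linear_blinfun_apply linear_blinfun_apply SR(2,1)])
    show "\<exists>h\<in>isometry_group (merged_norm \<beta>). \<forall>x. blinfun_apply h (blinfun_apply S x) = blinfun_apply S (blinfun_apply g x)"
      if "g \<in> isometry_group (merged_norm \<alpha>)" for g
      using that unfolding eq by (auto simp: SR)
    show "\<exists>g\<in>isometry_group (merged_norm \<alpha>). \<forall>x. blinfun_apply h (blinfun_apply S x) = blinfun_apply S (blinfun_apply g x)"
      if "h \<in> isometry_group (merged_norm \<beta>)" for h
      using that unfolding eq by (auto simp: SR)
  qed
  have cls: "BN.cls \<alpha> i = BN.cls \<beta> i" for i
  proof -
    obtain p where p: "card (BN.cls \<beta> p) = card (BN.cls \<alpha> i)" using cards by blast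
    have "BN.cls \<beta> p = BN.cls \<alpha> i"
      by (rule union_of_blocks_eqI[OF B.finite_cls A.finite_cls _ _ p]) (auto simp: BN.cls_def merged_rel_iff)
    moreover from this have "BN.rel \<beta> p i" using BN.self_in_cls[of i \<alpha>] by (auto simp: BN.cls_def)
    ultimately show ?thesis using BN.cls_eq by metis
  qed
  \<comment> \<open>\<open>2 ^ (2 * m + 1)\<close> and \<open>2 ^ (2 * m + 2)\<close> lie in the
    blocks \<open>2 * m\<close> and \<open>2 * m + 1\<close>; subtracting 1 accounts for the shifted
    indices.\<close>
  have char: "m \<in> \<gamma> \<longleftrightarrow> 2 ^ (2 * m + 2) - 1 \<in> BN.cls \<gamma> (2 ^ (2 * m + 1) - 1)" for m \<gamma>
  proof -
    have "block (Suc (2 ^ (2 * m + 1) - 1)) = 2 * m" "block (Suc (2 ^ (2 * m + 2) - 1)) = 2 * m + 1"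
      by (simp_all add: block_eq_iff)
    then show ?thesis unfolding BN.cls_def mem_Collect_eq merged_rel_iff by (simp add: merge_def)
  qed
  show ?thesis using char cls by blast
qed

text \<open>Dedekind cuts, read through an enumeration of the rationals, inject the reals into the
  sets of naturals, so that the family can be indexed by the reals directly.\<close>

definition rational_cut :: "real \<Rightarrow> nat set" where
  "rational_cut r = {m. of_rat (nat_to_rat_surj m) < r}"

lemma inj_rational_cut: "inj rational_cut"
proof -
  have "rational_cut r \<noteq> rational_cut s" if rs: "r < s" for r s
  proof -
    obtain q where q: "r < of_rat q" "of_rat q < s" using of_rat_dense[OF rs] by blast
    obtain m where "q = nat_to_rat_surj m" using surj_nat_to_rat_surj by (metis surjD)
    then have "m \<in> rational_cut s" "m \<notin> rational_cut r" using q by (auto simp: rational_cut_def)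
    then show ?thesis by blast
  qed
  then show ?thesis by (metis injI linorder_neqE_linordered_idom)
qed

theorem proposition4p5:
  shows "\<exists>F :: (convexified_tsirelson \<Rightarrow> real) set.
    F \<approx> (UNIV :: real set) \<and>
    (\<forall>N\<in>F. equivalent_norm N) \<and>
    (\<forall>N\<in>F. \<forall>G. maximal_bounded_subgroup G \<longrightarrow> \<not> isometry_group N \<subseteq> G) \<and>
    (\<forall>N\<in>F. \<forall>N'\<in>F. N \<noteq> N' \<longrightarrow> \<not> conjugate_in_GL (isometry_group N) (isometry_group N'))"
proof -
  define NN where "NN r = merged_norm (rational_cut r)" for r
  have conj: "\<not> conjugate_in_GL (isometry_group (NN r)) (isometry_group (NN s))" if "r \<noteq> s" for r s
    using conjugate_merged[of "rational_cut r" "rational_cut s"] that inj_rational_cut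
    unfolding NN_def by (auto dest: injD)
  have refl: "conjugate_in_GL (isometry_group N) (isometry_group N)" for N :: "convexified_tsirelson \<Rightarrow> real"
  proof -
    have "\<one>\<^bsub>GL\<^esub> \<in> carrier (GL :: (convexified_tsirelson \<Rightarrow>\<^sub>L convexified_tsirelson) monoid)"
      by (rule monoid.one_closed[OF group.is_monoid[OF group_GL]])
    moreover have "inv\<^bsub>GL\<^esub> \<one>\<^bsub>GL\<^esub> = (\<one>\<^bsub>GL\<^esub> :: convexified_tsirelson \<Rightarrow>\<^sub>L convexified_tsirelson)"
      by (rule monoid.inv_one[OF group.is_monoid[OF group_GL]])
    moreover have "id_blinfun o\<^sub>L g o\<^sub>L id_blinfun = g" for g :: "convexified_tsirelson \<Rightarrow>\<^sub>L convexified_tsirelson"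
      by (rule blinfun_eqI) simp
    ultimately show ?thesis
      unfolding conjugate_in_GL_def by (intro bexI[of _ "\<one>\<^bsub>GL\<^esub>"]) (simp_all, simp add: GL_def)
  qed
  \<comment> \<open>Equal norms have the same isometry group, which is conjugate to itself; so
    different parameters give different norms.\<close>
  have inj: "inj NN"
  proof (rule injI, rule ccontr)
    fix r s assume "NN r = NN s" "r \<noteq> s"
    then show False using conj refl by metis
  qed
  show ?thesis
  proof (intro exI[of _ "range NN"] conjI ballI allI impI)
    show "range NN \<approx> (UNIV :: real set)" by (rule inj_on_image_eqpoll_self[OF inj])
    fix N assume "N \<in> range NN"
    then obtain r where r: "N = NN r" by blast
    show "equivalent_norm N" unfolding r NN_def by (rule equivalent_block_norm)
    show "\<not> isometry_group N \<subseteq> G" if "maximal_bounded_subgroup G" for G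
      unfolding r NN_def by (rule merged_not_in_maximal[OF that])
    fix N' assume "N' \<in> range NN" "N \<noteq> N'"
    then obtain s where "N' = NN s" "r \<noteq> s" using r by blast
    then show "\<not> conjugate_in_GL (isometry_group N) (isometry_group N')" using conj r by blast
  qed
qed

end
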